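(* Assume $|U|\ge 2$ and suppose that $g_U(x)=Gx^{\beta}$ for $x>0$ (and $g_U(x)=0$ for $x\le 0$) with $\beta,G\in(0,\infty)$. Let $\tau_v^{\mathrm{ext}}$ be the transition time in the external model. Then $$\mathbb{E}_u[\tau_v^{\mathrm{ext}}]=F_c\,r^{\,1\wedge\beta(|U|-1)}\,[1+o(1)],\qquad r\to\infty,$$ where $a\wedge b=\min\{a,b\}$ and $$F_c=\begin{cases}\dfrac{\gamma_U^{\beta(|U|-1)}}{|U|\,G^{-(|U|-1)}}, & \beta\in\left(0,\frac{1}{|U|-1}\right),\\[2mm] \dfrac{\gamma_U}{|U|\,G^{-(|U|-1)}+(c-\rho_U)}, & \beta=\frac{1}{|U|-1},\\[2mm] \dfrac{\gamma_U}{c-\rho_U}, & \beta\in\left(\frac{1}{|U|-1},\infty\right),\end{cases}$$ and $$\lim_{r\to\infty}\mathbb{P}_u\left(\frac{\tau_v^{\mathrm{ext}}}{\mathbb{E}_u[\tau_v^{\mathrm{ext}}]}>x\right)=\mathcal{P}(x),\qquad x\in[0,\infty),$$ with $$\mathcal{P}(x)=\begin{cases} e^{-x}, & \beta\in(0,\frac1{|U|-1}),\ x\in[0,\infty),\\ (1-Cx)^{\frac{1-C}{C}}, & \beta=\frac1{|U|-1},\ x\in[0,\frac1C),\\ 0, & \beta=\frac1{|U|-1},\ x\in[\frac1C,\infty),\\ 1, & \beta\in(\frac1{|U|-1},\infty),\ x\in[0,1),\\ 0, & \beta\in(\frac1{|U|-1},\infty),\ x\in[1,\infty),\end{cases}$$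 where, in the case $\beta=\frac{1}{|U|-1}$, $C=\frac{F_c(c-\rho_U)}{\gamma_U}\in(0,1)$.
   Context: Network: $U,V$ are disjoint finite nonempty sets; the interference graph is the complete bipartite graph on $N=U\cup V$, in which two nodes are neighbors iff one lies in $U$ and the other in $V$. Each node $i$ has a state $X_i(t)\in\{0,1\}$ at time $t\ge 0$ ($0$ = inactive, $1$ = active). Each node $i$ carries a deactivation Poisson clock of rate $1$ and an activation Poisson clock with rate $r_i(t)$ at time $t$; clocks are independent. An active node becomes inactive when its deactivation clock ticks; an inactive node becomes active when its activation clock ticks at a time $t$, provided no neighbor is active at time $t^-$. $u$ is the configuration with all nodes of $U$ active and all nodes of $V$ inactive; $v$ is the configuration with all nodes of $U$ inactive and all nodes of $V$ active. $\mathbb{P}_u,\mathbb{E}_u$ denote probability and expectation when starting from $u$, and $\tau_v=\min\{t\ge 0: X(t)=v\}$ is the transition time. Parameters: $c,\rho_U,\rho_V,\gamma_U,\gamma_V$ are constants with $c>\rho_U>0$, $c>\rho_V>0$, $\gamma_U\ge\gamma_V>0$; $r>0$ is a parameter tending to infinity. $\mathcal{G}$ is the class of continuous non-decreasing functions $g:\mathbb{R}\to\mathbb{R}_{\ge0}$ with $g(x)=0$ for $x\le 0$ and $\lim_{x\to\infty}g(x)=\infty$. Standing assumption: $g_U,g_V\in\mathcal{G}$ and $\lim_{x\to\infty}g_V(x)/g_U(x)=\infty$. External model: the activation rates are deterministic: $r_i(t)=g_U(\gamma_U r-(c-\rho_U)t)$ for $i\in U$ and $r_i(t)=g_V(\gamma_V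 r+\rho_V t)$ for $i\in V$, $t\ge 0$. The superscript "ext" refers to this model.
   Formalization: The limit of the tail probabilities is proved for all x ≥ 0 except x = 1 in the case β > 1/(|U|−1), where the printed value P(1) = 0 is false because the probability that τ exceeds its mean stays bounded away from 0. *)

theory Defs
  imports "HOL-Probability.Probability" "HOL-Library.Landau_Symbols"
begin

definition activation_functions :: "(real \<Rightarrow> real) set" where
  "activation_functions =
     {g. continuous_on UNIV g \<and> mono g \<and> (\<forall>x. 0 \<le> g x) \<and> (\<forall>x\<le>0. g x = 0) \<and>
         filterlim g at_top at_top}"

section \<open>Poisson clocks\<close>

text \<open>A clock is given by its counting process: \<open>N t \<omega>\<close> is the number of ticks in \<open>(0, t]\<close>.
  The mean of an increment may be 0 (the rates below can vanish on intervals), where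
  \<open>0 ^ 0 = 1\<close> makes the formula give the point mass at 0.\<close>

definition poisson_clock :: "'w measure \<Rightarrow> (real \<Rightarrow> real) \<Rightarrow> (real \<Rightarrow> 'w \<Rightarrow> nat) \<Rightarrow> bool" where
  "poisson_clock M rate N \<longleftrightarrow>
     (\<forall>t\<ge>0. N t \<in> measurable M (count_space UNIV)) \<and>
     (\<forall>\<omega>\<in>space M. N 0 \<omega> = 0 \<and> mono_on {0..} (\<lambda>t. N t \<omega>) \<and>
        (\<forall>t\<ge>0. eventually (\<lambda>s. N s \<omega> = N t \<omega>) (at_right t))) \<and>
     (\<forall>s t k. 0 \<le> s \<and> s \<le> t \<longrightarrow>
        measure M {\<omega> \<in> space M. N t \<omega> - N s \<omega> = k} =
          integral {s..t} rate ^ k / fact k * exp (- integral {s..t} rate)) \<and>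
     (\<forall>T :: nat \<Rightarrow> real. \<forall>n. 0 \<le> T 0 \<and> mono T \<longrightarrow>
        prob_space.indep_vars M (\<lambda>_. count_space UNIV)
          (\<lambda>j \<omega>. N (T (Suc j)) \<omega> - N (T j) \<omega>) {..<n})"

definition ticks :: "(real \<Rightarrow> nat) \<Rightarrow> real \<Rightarrow> bool" where
  "ticks n t \<longleftrightarrow> (\<forall>s. 0 \<le> s \<and> s < t \<longrightarrow> n s < n t)"

datatype 'a clock = Deactivation 'a | Activation 'a

fun clock_rate :: "('a \<Rightarrow> real \<Rightarrow> real) \<Rightarrow> 'a clock \<Rightarrow> real \<Rightarrow> real" where
  "clock_rate rate (Deactivation i) t = 1"
| "clock_rate rate (Activation i) t = rate i t"

section \<open>Hard-core dynamics on a complete bipartite graph\<close>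

text \<open>A configuration is represented by its set of active nodes: node \<open>i\<close> has state 1 in
  configuration \<open>x\<close> iff \<open>i \<in> x\<close>. Thus \<open>u\<close> is the set \<open>U\<close>, and \<open>v\<close> is the set \<open>V\<close>.\<close>

definition neighbors :: "'a set \<Rightarrow> 'a set \<Rightarrow> 'a \<Rightarrow> 'a \<Rightarrow> bool" where
  "neighbors U V i j \<longleftrightarrow> (i \<in> U \<and> j \<in> V) \<or> (i \<in> V \<and> j \<in> U)"

text \<open>The configuration after the clock ticks at time \<open>t\<close>, if it was \<open>y\<close> just before.\<close>

definition update ::
  "'a set \<Rightarrow> 'a set \<Rightarrow> ('a clock \<Rightarrow> real \<Rightarrow> nat) \<Rightarrow> real \<Rightarrow> 'a set \<Rightarrow> 'a set" where
  "update U V n t y =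
     {i \<in> U \<union> V. if i \<in> y then \<not> ticks (n (Deactivation i)) t
                  else ticks (n (Activation i)) t \<and> \<not> (\<exists>j\<in>y. neighbors U V i j)}"

text \<open>The path is right-continuous and has a left limit \<open>y\<close> at each time \<open>t > 0\<close> (configurations
  carry the discrete topology), from which the clocks determine the configuration at time \<open>t\<close>.\<close>

definition hard_core_path ::
  "'a set \<Rightarrow> 'a set \<Rightarrow> 'a set \<Rightarrow> ('a clock \<Rightarrow> real \<Rightarrow> nat) \<Rightarrow> (real \<Rightarrow> 'a set) \<Rightarrow> bool" where
  "hard_core_path U V x0 n x \<longleftrightarrow>
     x 0 = x0 \<and>
     (\<forall>t\<ge>0. eventually (\<lambda>s. x s = x t) (at_right t)) \<and>
     (\<forall>t>0. \<exists>y. eventually (\<lambda>s. x s = y) (at_left t) \<and> x t = update U V n t y)"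

definition hard_core_process ::
  "'a set \<Rightarrow> 'a set \<Rightarrow> ('a \<Rightarrow> real \<Rightarrow> real) \<Rightarrow> 'a set \<Rightarrow>
   'w measure \<Rightarrow> ('a clock \<Rightarrow> real \<Rightarrow> 'w \<Rightarrow> nat) \<Rightarrow> (real \<Rightarrow> 'w \<Rightarrow> 'a set) \<Rightarrow> bool" where
  "hard_core_process U V rate x0 M N X \<longleftrightarrow>
     prob_space M \<and>
     (\<forall>k \<in> Deactivation ` (U \<union> V) \<union> Activation ` (U \<union> V).
        poisson_clock M (clock_rate rate k) (N k)) \<and>
     prob_space.indep_vars M (\<lambda>_. PiM {0..} (\<lambda>_. count_space UNIV))
       (\<lambda>k \<omega>. \<lambda>t\<in>{0..}. N k t \<omega>) (Deactivation ` (U \<union> V) \<union> Activation ` (U \<union> V)) \<and>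
     (\<forall>t\<ge>0. X t \<in> measurable M (count_space (Pow (U \<union> V)))) \<and>
     (\<forall>\<omega>\<in>space M. hard_core_path U V x0 (\<lambda>k t. N k t \<omega>) (\<lambda>t. X t \<omega>))"

text \<open>The hitting time is \<open>\<infinity>\<close> if the configuration is never reached. Otherwise the infimum is a
  minimum, by right-continuity of the paths.\<close>

definition hitting_time :: "(real \<Rightarrow> 'w \<Rightarrow> 'a set) \<Rightarrow> 'a set \<Rightarrow> 'w \<Rightarrow> ennreal" where
  "hitting_time X y \<omega> = (INF t \<in> {t. 0 \<le> t \<and> X t \<omega> = y}. ennreal t)"

definition expected_hitting_time ::
  "'w measure \<Rightarrow> (real \<Rightarrow> 'w \<Rightarrow> 'a set) \<Rightarrow> 'a set \<Rightarrow> ennreal" where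
  "expected_hitting_time M X y = (\<integral>\<^sup>+\<omega>. hitting_time X y \<omega> \<partial>M)"

section \<open>The external model\<close>

definition external_rate ::
  "'a set \<Rightarrow> (real \<Rightarrow> real) \<Rightarrow> (real \<Rightarrow> real) \<Rightarrow> real \<Rightarrow> real \<Rightarrow> real \<Rightarrow> real \<Rightarrow> real \<Rightarrow> real \<Rightarrow>
   'a \<Rightarrow> real \<Rightarrow> real" where
  "external_rate U gU gV c \<rho>U \<rho>V \<gamma>U \<gamma>V r i t =
     (if i \<in> U then gU (\<gamma>U * r - (c - \<rho>U) * t) else gV (\<gamma>V * r + \<rho>V * t))"

text \<open>In the two definitions below, \<open>k\<close> is the number of nodes in \<open>U\<close>.\<close>

definition prefactor :: "nat \<Rightarrow> real \<Rightarrow> real \<Rightarrow> real \<Rightarrow> real \<Rightarrow> real \<Rightarrow> real" where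
  "prefactor k \<beta> G c \<rho>U \<gamma>U =
     (if \<beta> < 1 / (real k - 1)
        then \<gamma>U powr (\<beta> * (real k - 1)) / (real k * G powr (- (real k - 1)))
      else if \<beta> = 1 / (real k - 1)
        then \<gamma>U / (real k * G powr (- (real k - 1)) + (c - \<rho>U))
      else \<gamma>U / (c - \<rho>U))"

text \<open>The limit tail is continuous on \<open>[0, \<infinity>)\<close> except for the jump at \<open>x = 1\<close> in the
  last case, where the transition time is concentrated around its mean. Convergence of the tails
  fails at that point, and only there: \<open>\<tau>\<close> differs from \<open>\<gamma>U * r / (c - \<rho>U)\<close> by a quantity that
  is tight in \<open>r\<close>, whose positive part has bounded mean, and whose tails have positive probability
  uniformly in \<open>r\<close>; so the probability that \<open>\<tau>\<close> exceeds its mean stays away from 0.\<close>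

definition limit_tail :: "nat \<Rightarrow> real \<Rightarrow> real \<Rightarrow> real \<Rightarrow> real \<Rightarrow> real \<Rightarrow> real \<Rightarrow> real" where
  "limit_tail k \<beta> G c \<rho>U \<gamma>U x =
     (if \<beta> < 1 / (real k - 1) then exp (- x)
      else if \<beta> = 1 / (real k - 1) then
        (let C = prefactor k \<beta> G c \<rho>U \<gamma>U * (c - \<rho>U) / \<gamma>U
         in if x < 1 / C then (1 - C * x) powr ((1 - C) / C) else 0)
      else (if x < 1 then 1 else 0))"

end

theory Submission
  imports Defs
begin

text \<open>
  The proof compares the process with explicit functions of time and of the number of active nodes.
  If \<open>h t x\<close> satisfies a differential inequality for the backward generator, then
  \<open>\<lambda>t. E[h t (X t); \<tau> > t]\<close> is monotone. Since the rates are deterministic, this can be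
  proved without filtrations: on a fine grid, a jump chain that is driven by the independent clock
  increments coincides with the process up to an event of vanishing probability.

  Let \<open>k\<close> be the number of nodes in \<open>U\<close>. At a constant activation rate \<open>x\<close>, the mean time until all
  nodes of \<open>U\<close> are inactive is a polynomial in \<open>x\<close> with leading term \<open>x ^ (k - 1) / k\<close>. This
  polynomial, evaluated at the current rate and multiplied by a suitable function of time, is a
  subsolution that bounds the tail of \<open>\<tau>\<close> from below. With a correction for the short excursions
  in which the nodes of \<open>V\<close> take over, it is a supersolution that bounds the mean of \<open>\<tau>\<close> from
  above. The limit of the tail bounds has mean equal to the limit of the mean bounds, so that both
  bounds are sharp, by Fatou's lemma.
\<close>

section \<open>Paths between ticks\<close>

text \<open>Write \<open>y = \<gamma>U * r - d * t\<close> with \<open>d = c - \<rho>U\<close>. At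
  the rate \<open>gU y\<close> the leading term of the exit time is
  \<open>y powr \<alpha> / \<kappa>\<close>, where \<open>\<alpha> = \<beta> * (k - 1)\<close> and
  \<open>\<kappa> = k * G powr (- (k - 1))\<close>, so \<tau> has the approximate hazard rate
  \<open>\<kappa> / y powr \<alpha>\<close>. If \<open>\<alpha> < 1\<close>, \<open>y\<close> hardly
  moves before the exit, and the law is exponential. If \<open>\<alpha> > 1\<close>, the hazard is
  negligible until \<open>y\<close> is a small fraction of its start, and the time is deterministic.
  If \<open>\<alpha> = 1\<close>, integrating the hazard gives the survival probability
  \<open>(1 - d * t / (\<gamma>U * r)) powr (\<kappa> / d)\<close>, with mean
  \<open>\<gamma>U * r / (\<kappa> + d)\<close>. The delicate point is a sharp upper bound on the
  tail, in which returns from \<open>V\<close> to \<open>U\<close> would have to be controlled path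
  by path. A mean needs just one supersolution, so tails are bounded only from below and means only
  from above. The lower bounds give the empty configuration the value 0; hence the growth of
  \<open>gV\<close> over \<open>gU\<close> matters only for the mean, where it makes a return from
  the empty configuration to \<open>U\<close> unlikely.\<close>

definition clocks :: "'a set \<Rightarrow> 'a set \<Rightarrow> 'a clock set" where
  "clocks U V = Deactivation ` (U \<union> V) \<union> Activation ` (U \<union> V)"

text \<open>The effect of a single tick, whereas \<open>update\<close> applies all simultaneous
  ticks to the left limit at once; the two agree when exactly one clock ticks. Blocked activations
  and ticks without effect leave the configuration unchanged.\<close>

fun flip :: "'a set \<Rightarrow> 'a set \<Rightarrow> 'a clock \<Rightarrow> 'a set \<Rightarrow> 'a set" where
  "flip U V (Deactivation i) x = x - {i}"
| "flip U V (Activation i) x = (if \<exists>j\<in>x. neighbors U V i j then x else insert i x)"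

lemma update_no_ticks:
  assumes "\<forall>q\<in>clocks U V. \<not> ticks (n q) t" "y \<subseteq> U \<union> V"
  shows "update U V n t y = y"
  using assms by (auto simp: update_def clocks_def)

lemma update_one_tick:
  assumes "q \<in> clocks U V" "ticks (n q) t" "\<forall>q'\<in>clocks U V - {q}. \<not> ticks (n q') t" "y \<subseteq> U \<union> V"
  shows "update U V n t y = flip U V q y"
proof (cases q)
  case (Deactivation i)
  have 1: "\<not> ticks (n (Activation j)) t" if "j \<in> U \<union> V" for j
    using assms(3) that Deactivation by (auto simp: clocks_def)
  have 2: "ticks (n (Deactivation j)) t \<longleftrightarrow> j = i" if "j \<in> U \<union> V" for j
    using assms(2,3) that Deactivation by (auto simp: clocks_def)
  show ?thesis
    using 1 2 assms(4) Deactivation by (auto simp: update_def)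
next
  case (Activation i)
  have 0: "i \<in> U \<union> V"
    using assms(1) Activation by (auto simp: clocks_def)
  have 1: "\<not> ticks (n (Deactivation j)) t" if "j \<in> U \<union> V" for j
    using assms(3) that Activation by (auto simp: clocks_def)
  have 2: "ticks (n (Activation j)) t \<longleftrightarrow> j = i" if "j \<in> U \<union> V" for j
    using assms(2,3) that Activation by (auto simp: clocks_def)
  have "update U V n t y = {j \<in> U \<union> V. j \<in> y \<or> j = i \<and> \<not> (\<exists>j\<in>y. neighbors U V i j)}"
    unfolding update_def using 1 2 by (intro Collect_cong) auto
  then show ?thesis
    using 0 assms(4) Activation by auto
qed

lemma hard_core_path_subset:
  assumes "hard_core_path U V x0 n x" "x0 \<subseteq> U \<union> V" "0 \<le> t"
  shows "x t \<subseteq> U \<union> V"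
proof (cases "t = 0")
  case True
  then show ?thesis using assms by (simp add: hard_core_path_def)
next
  case False
  then obtain y where "x t = update U V n t y"
    using assms unfolding hard_core_path_def by (metis less_eq_real_def)
  then show ?thesis by (auto simp: update_def)
qed

text \<open>Left limits are unique because \<open>at_left b\<close> is a nontrivial filter, so the
  value on \<open>[a, b)\<close> is the left limit that the dynamics refer to.\<close>

lemma hard_core_path_left_limit:
  assumes path: "hard_core_path U V x0 n x" and "0 \<le> a" "a < b" and "\<forall>s\<in>{a..<b}. x s = z"
  shows "x b = update U V n b z"
proof -
  obtain y where y: "eventually (\<lambda>s. x s = y) (at_left b)" "x b = update U V n b y"
    using path assms(2,3) unfolding hard_core_path_def by (metis le_less_trans)
  have "eventually (\<lambda>s. x s = z) (at_left b)"
    using eventually_at_left[OF assms(3), of "\<lambda>s. x s = z"] assms(3,4) by auto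
  with y(1) have "eventually (\<lambda>s. y = z) (at_left b)"
    by eventually_elim simp
  then show ?thesis using y(2) by simp
qed

text \<open>At the infimum \<open>i\<close> of the times at which the path has moved, the left limit
  is still \<open>x a\<close> and no clock ticks, so \<open>x i = x a\<close>. Right-continuity then
  keeps the path there beyond \<open>i\<close>, contrary to the choice of \<open>i\<close>.\<close>

lemma hard_core_path_no_ticks:
  assumes path: "hard_core_path U V x0 n x" and x0: "x0 \<subseteq> U \<union> V" and a: "0 \<le> a"
    and no: "\<forall>s\<in>{a<..<b}. \<forall>q\<in>clocks U V. \<not> ticks (n q) s"
  shows "\<forall>s\<in>{a..<b}. x s = x a"
proof (rule ccontr)
  define B where "B = {s \<in> {a..<b}. x s \<noteq> x a}"
  assume "\<not> (\<forall>s\<in>{a..<b}. x s = x a)"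
  then have ne: "B \<noteq> {}" unfolding B_def by blast
  have bdd: "bdd_below B" by (auto simp: B_def intro!: bdd_belowI[of _ a])
  define i where "i = Inf B"
  have ia: "a \<le> i"
    unfolding i_def using ne by (intro cInf_greatest) (auto simp: B_def)
  obtain s1 where s1: "s1 \<in> B" using ne by auto
  have ib: "i < b"
    using cInf_lower[OF s1 bdd] s1 by (auto simp: i_def B_def)
  have below: "x s = x a" if "a \<le> s" "s < i" for s
    using cInf_lower[OF _ bdd, of s] that ib by (auto simp: B_def i_def)
  have xi: "x i = x a"
  proof (cases "a = i")
    case False
    then have ai: "a < i" using ia by simp
    have "x i = update U V n i (x a)"
      by (rule hard_core_path_left_limit[OF path a ai], rule ballI, rule below) auto
    also have "\<dots> = x a"
      using no ai ib hard_core_path_subset[OF path x0 a] by (intro update_no_ticks) auto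
    finally show ?thesis .
  qed auto
  have "eventually (\<lambda>s. x s = x i) (at_right i)"
    using path a ia unfolding hard_core_path_def by auto
  then obtain e where e: "i < e" "\<forall>s. i < s \<and> s < e \<longrightarrow> x s = x i"
    using eventually_at_right[of i "i+1"] by auto
  obtain s where s: "s \<in> B" "s < e"
    using cInf_lessD[OF ne, of e] e(1) by (auto simp: i_def)
  have "i \<le> s" using cInf_lower[OF s(1) bdd] by (simp add: i_def)
  then have "x s = x a" using e(2) s(2) xi by (cases "s = i") auto
  then show False using s(1) by (auto simp: B_def)
qed

lemma hard_core_path_no_ticks_closed:
  assumes path: "hard_core_path U V x0 n x" and x0: "x0 \<subseteq> U \<union> V" and a: "0 \<le> a"
    and no: "\<forall>s\<in>{a<..b}. \<forall>q\<in>clocks U V. \<not> ticks (n q) s"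
  shows "\<forall>s\<in>{a..b}. x s = x a"
proof
  fix s assume s: "s \<in> {a..b}"
  have c: "\<forall>s\<in>{a..<b}. x s = x a"
    using no by (intro hard_core_path_no_ticks[OF path x0 a]) auto
  show "x s = x a"
  proof (cases "s < b \<or> a = b")
    case False
    then have "s = b" "a < b" using s by auto
    then have "x b = update U V n b (x a)"
      by (intro hard_core_path_left_limit[OF path a _ c])
    also have "\<dots> = x a"
      using no \<open>a < b\<close> hard_core_path_subset[OF path x0 a] by (intro update_no_ticks) auto
    finally show ?thesis using \<open>s = b\<close> by simp
  next
    case True
    then have "s \<in> {a..<b} \<or> s = a" using s by auto
    then show ?thesis using c by blast
  qed
qed

section \<open>Tick times of counting paths\<close>

definition counting_path :: "(real \<Rightarrow> nat) \<Rightarrow> bool" where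
  "counting_path n \<longleftrightarrow> mono_on {0..} n \<and> (\<forall>t\<ge>0. eventually (\<lambda>s. n s = n t) (at_right t))"

lemma counting_path_no_tick:
  assumes "counting_path n" "0 \<le> a" "n b - n a = 0" "s \<in> {a<..b}"
  shows "\<not> ticks n s"
proof
  assume "ticks n s"
  then have "n a < n s" using assms(2,4) by (auto simp: ticks_def)
  moreover have "n s \<le> n b"
    using assms unfolding counting_path_def mono_on_def by auto
  ultimately show False using assms(3) by simp
qed

text \<open>The tick is the infimum of the times at which the count exceeds \<open>n a\<close>. An
  increment of 1 leaves no intermediate value, and right-continuity puts the value
  \<open>n b\<close> at the infimum itself.\<close>

lemma counting_path_one_tick:
  assumes n: "counting_path n" and a: "0 \<le> a" "a \<le> b" and one: "n b - n a = 1"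
  obtains s where "s \<in> {a<..b}" "ticks n s" "\<And>s'. s' \<in> {a<..b} \<Longrightarrow> s' \<noteq> s \<Longrightarrow> \<not> ticks n s'"
proof -
  have mono: "n s \<le> n s'" if "0 \<le> s" "s \<le> s'" for s s'
    using n that unfolding counting_path_def mono_on_def by auto
  define B where "B = {s \<in> {a..b}. n a < n s}"
  have bB: "b \<in> B" using one a by (auto simp: B_def)
  have bdd: "bdd_below B" by (auto simp: B_def intro!: bdd_belowI[of _ a])
  define i where "i = Inf B"
  have ia: "a \<le> i"
    unfolding i_def using bB by (intro cInf_greatest) (auto simp: B_def)
  have ib: "i \<le> b"
    using cInf_lower[OF bB bdd] by (auto simp: i_def)
  have below: "n s = n a" if "a \<le> s" "s < i" for s
    using cInf_lower[OF _ bdd, of s] that ib mono[of a s] a by (force simp: B_def i_def)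
  have above: "n s = n b" if s: "i < s" "s \<le> b" for s
  proof -
    obtain s' where "s' \<in> B" "s' < s"
      using cInf_lessD[of B s] bB s(1) unfolding i_def by auto
    then have "n a < n s" using mono[of s' s] a by (auto simp: B_def)
    then show ?thesis using mono[of s b] one s a ia by auto
  qed
  have ni: "n i = n b"
  proof (cases "i = b")
    case False
    then have "i < b" using ib by simp
    have "eventually (\<lambda>s. n s = n i) (at_right i)"
      using n a ia unfolding counting_path_def by auto
    moreover have "eventually (\<lambda>s. n s = n b) (at_right i)"
      unfolding eventually_at_right[OF \<open>i < b\<close>] using above \<open>i < b\<close> less_imp_le by blast
    ultimately have "eventually (\<lambda>s. n i = n b) (at_right i)"
      by eventually_elim simp
    then show ?thesis by simp
  qed auto
  have "a \<noteq> i" using ni one by auto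
  then have ai: "a < i" using ia by simp
  show ?thesis
  proof
    show "i \<in> {a<..b}" using ai ib by auto
    show "ticks n i"
      unfolding ticks_def
    proof (intro allI impI)
      fix s assume s: "0 \<le> s \<and> s < i"
      have "n s \<le> n a" using below[of s] mono[of s a] s by (cases "a \<le> s") auto
      then show "n s < n i" using ni one by simp
    qed
    fix s assume s: "s \<in> {a<..b}" "s \<noteq> i"
    show "\<not> ticks n s"
    proof (cases "s < i")
      case True
      then show ?thesis
        using below[of s] below[of a] s a ai by (auto simp: ticks_def intro!: exI[of _ a])
    next
      case False
      then show ?thesis
        using above[of s] ni s a ai by (auto simp: ticks_def intro!: exI[of _ i])
    qed
  qed
qed

text \<open>Only two configurations occur on \<open>[a, b]\<close>. This later rules out that the
  target is visited and left again inside a cell.\<close>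

lemma hard_core_path_one_tick:
  assumes path: "hard_core_path U V x0 n x" and x0: "x0 \<subseteq> U \<union> V" and a: "0 \<le> a" "a \<le> b"
    and n: "\<forall>q\<in>clocks U V. counting_path (n q)"
    and q: "q \<in> clocks U V" "n q b - n q a = 1" "\<forall>q'\<in>clocks U V - {q}. n q' b - n q' a = 0"
  obtains s where "s \<in> {a<..b}" "\<forall>s'\<in>{a..<s}. x s' = x a" "\<forall>s'\<in>{s..b}. x s' = flip U V q (x a)"
proof -
  obtain s where s: "s \<in> {a<..b}" "ticks (n q) s"
    "\<And>s'. s' \<in> {a<..b} \<Longrightarrow> s' \<noteq> s \<Longrightarrow> \<not> ticks (n q) s'"
    using counting_path_one_tick[of "n q" a b] n q a by metis
  have other: "\<not> ticks (n q') s'" if "q' \<in> clocks U V - {q}" "s' \<in> {a<..b}" for q' s'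
    using counting_path_no_tick[of "n q'" a b s'] n q a that by auto
  have 1: "\<forall>s'\<in>{a..<s}. x s' = x a"
  proof (rule hard_core_path_no_ticks[OF path x0 a(1)], intro ballI)
    fix s' q' assume "s' \<in> {a<..<s}" "q' \<in> clocks U V"
    then show "\<not> ticks (n q') s'"
      using s(1) s(3)[of s'] other[of q' s'] by (cases "q' = q") auto
  qed
  have "x s = update U V n s (x a)"
    by (rule hard_core_path_left_limit[OF path a(1) _ 1]) (use s(1) in simp)
  also have "\<dots> = flip U V q (x a)"
    by (rule update_one_tick) (use s(1,2) q(1) other hard_core_path_subset[OF path x0 a(1)] in auto)
  finally have 2: "x s = flip U V q (x a)" .
  have 3: "\<forall>s'\<in>{s..b}. x s' = x s"
  proof (rule hard_core_path_no_ticks_closed[OF path x0])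
    show "0 \<le> s" using s a by auto
    show "\<forall>s'\<in>{s<..b}. \<forall>q\<in>clocks U V. \<not> ticks (n q) s'"
    proof (intro ballI)
      fix s' q' assume "s' \<in> {s<..b}" "q' \<in> clocks U V"
      then show "\<not> ticks (n q') s'"
        using s(1) s(3)[of s'] other[of q' s'] by (cases "q' = q") auto
    qed
  qed
  have "\<forall>s'\<in>{s..b}. x s' = flip U V q (x a)" using 3 unfolding 2 .
  from that[OF s(1) 1 this] show ?thesis .
qed

section \<open>Discretization of the process\<close>

locale hard_core =
  fixes U V :: "'a set" and rate :: "'a \<Rightarrow> real \<Rightarrow> real" and x0 v :: "'a set"
    and M :: "'w measure" and N :: "'a clock \<Rightarrow> real \<Rightarrow> 'w \<Rightarrow> nat" and X :: "real \<Rightarrow> 'w \<Rightarrow> 'a set"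
  assumes finite_UV: "finite U" "finite V" and U_nonempty: "U \<noteq> {}"
    and x0: "x0 \<subseteq> U \<union> V" "x0 \<noteq> v"
    and process: "hard_core_process U V rate x0 M N X"
    and rate_cont: "\<And>i. i \<in> U \<union> V \<Longrightarrow> continuous_on {0..} (rate i)"
    and rate_nonneg: "\<And>i t. i \<in> U \<union> V \<Longrightarrow> 0 \<le> t \<Longrightarrow> 0 \<le> rate i t"
begin

abbreviation "clks \<equiv> clocks U V"

sublocale prob_space M
  using process by (simp add: hard_core_process_def)

lemma finite_clks: "finite clks" and clks_nonempty: "clks \<noteq> {}"
  using finite_UV U_nonempty by (auto simp: clocks_def)

lemma clock_rate_cont:
  assumes "q \<in> clks" shows "continuous_on {0..} (clock_rate rate q)"
proof (cases q)
  case (Deactivation i)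
  have "clock_rate rate q = (\<lambda>t. 1)" using Deactivation by (intro ext) simp
  then show ?thesis by simp
next
  case (Activation i)
  have "clock_rate rate q = rate i" using Activation by (intro ext) simp
  then show ?thesis using rate_cont assms Activation by (auto simp: clocks_def)
qed

lemma clock_rate_nonneg: "q \<in> clks \<Longrightarrow> 0 \<le> t \<Longrightarrow> 0 \<le> clock_rate rate q t"
  using rate_nonneg by (cases q) (auto simp: clocks_def)

lemma clock: "q \<in> clks \<Longrightarrow> poisson_clock M (clock_rate rate q) (N q)"
  using process unfolding hard_core_process_def clocks_def by blast

lemma clock_measurable: "q \<in> clks \<Longrightarrow> 0 \<le> t \<Longrightarrow> N q t \<in> measurable M (count_space UNIV)"
  using clock unfolding poisson_clock_def by blast

lemma X_measurable: "0 \<le> t \<Longrightarrow> X t \<in> measurable M (count_space (Pow (U \<union> V)))"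
  using process unfolding hard_core_process_def by blast

lemma X_event: "0 \<le> t \<Longrightarrow> {\<omega> \<in> space M. X t \<omega> = x} \<in> sets M"
proof (cases "x \<in> Pow (U \<union> V)")
  case True
  assume "0 \<le> t"
  have "X t -` {x} \<inter> space M \<in> sets M"
    by (rule measurable_sets[OF X_measurable[OF \<open>0 \<le> t\<close>]]) (use True in auto)
  then show ?thesis by (simp add: vimage_def Int_def conj_commute)
next
  case False
  assume "0 \<le> t"
  then have "{\<omega> \<in> space M. X t \<omega> = x} = {}"
    using measurable_space[OF X_measurable] False by auto
  then show ?thesis by (simp only: sets.empty_sets)
qed

lemma path: "\<omega> \<in> space M \<Longrightarrow> hard_core_path U V x0 (\<lambda>q t. N q t \<omega>) (\<lambda>t. X t \<omega>)"
  using process unfolding hard_core_process_def by blast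

lemma X_0: "\<omega> \<in> space M \<Longrightarrow> X 0 \<omega> = x0"
  using path by (auto simp: hard_core_path_def)

lemma X_right: "\<omega> \<in> space M \<Longrightarrow> 0 \<le> t \<Longrightarrow> eventually (\<lambda>s. X s \<omega> = X t \<omega>) (at_right t)"
  using path by (auto simp: hard_core_path_def)

lemma X_right_rat:
  assumes "\<omega> \<in> space M" "0 \<le> t" "t < e"
  obtains s where "s \<in> \<rat>" "t < s" "s < e" "X s \<omega> = X t \<omega>"
proof -
  obtain d where d: "t < d" "\<forall>s>t. s < d \<longrightarrow> X s \<omega> = X t \<omega>"
    using X_right[OF assms(1,2)] unfolding eventually_at_right[OF assms(3)] by blast
  obtain s where "s \<in> \<rat>" "t < s" "s < min d e"
    using Rats_dense_in_real[of t "min d e"] d(1) assms(3) by auto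
  then show ?thesis using that[of s] d(2) by auto
qed

section \<open>Survival event and hitting time\<close>

definition alive :: "real \<Rightarrow> 'w set" where
  "alive t = {\<omega> \<in> space M. \<forall>s\<in>{0..t}. X s \<omega> \<noteq> v}"

lemma alive_antimono: "s \<le> t \<Longrightarrow> alive t \<subseteq> alive s"
  by (auto simp: alive_def)

lemma alive_0: "alive 0 = space M"
  using x0 X_0 by (auto simp: alive_def)

text \<open>Right-continuity reduces the uncountable condition to rational times. The endpoint
  \<open>t\<close> is added to them because approximation from the right would leave
  \<open>{0..t}\<close>.\<close>

lemma alive_sets [measurable]: "alive t \<in> sets M"
proof (cases "0 \<le> t")
  case True
  define Q where "Q = insert t (\<rat> \<inter> {0..t})"
  have Q: "countable Q" using countable_rat by (auto simp: Q_def)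
  have "alive t = space M - (\<Union>s\<in>Q. {\<omega> \<in> space M. X s \<omega> = v})"
  proof (intro equalityI subsetI)
    fix \<omega> assume "\<omega> \<in> alive t"
    then show "\<omega> \<in> space M - (\<Union>s\<in>Q. {\<omega> \<in> space M. X s \<omega> = v})"
      using True by (auto simp: alive_def Q_def)
  next
    fix \<omega> assume w: "\<omega> \<in> space M - (\<Union>s\<in>Q. {\<omega> \<in> space M. X s \<omega> = v})"
    have "X s \<omega> \<noteq> v" if s: "s \<in> {0..t}" for s
    proof (cases "s = t")
      case False
      then have "s < t" using s by simp
      then obtain s' where "s' \<in> \<rat>" "s < s'" "s' < t" "X s' \<omega> = X s \<omega>"
        using X_right_rat[of \<omega> s t] w s by auto
      then show ?thesis using w s by (auto simp: Q_def)
    qed (use w in \<open>auto simp: Q_def\<close>)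
    then show "\<omega> \<in> alive t" using w by (auto simp: alive_def)
  qed
  moreover have "(\<Union>s\<in>Q. {\<omega> \<in> space M. X s \<omega> = v}) \<in> sets M"
    using Q X_event True by (intro sets.countable_UN') (auto simp: Q_def)
  ultimately show ?thesis by auto
qed (simp add: alive_def)

text \<open>The inequality is strict because a path that avoids \<open>v\<close> up to time
  \<open>t\<close> keeps its value on some \<open>[t, d)\<close>, so that the infimum is at least
  \<open>d\<close>.\<close>

lemma hitting_time_greater:
  assumes w: "\<omega> \<in> space M" and t: "0 \<le> t"
  shows "ennreal t < hitting_time X v \<omega> \<longleftrightarrow> \<omega> \<in> alive t"
proof
  assume less: "ennreal t < hitting_time X v \<omega>"
  have "X s \<omega> \<noteq> v" if "s \<in> {0..t}" for s
  proof
    assume "X s \<omega> = v"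
    then have "hitting_time X v \<omega> \<le> ennreal s"
      unfolding hitting_time_def using that by (intro INF_lower) auto
    also have "\<dots> \<le> ennreal t" using that by (intro ennreal_leI) auto
    finally show False using less by simp
  qed
  then show "\<omega> \<in> alive t" using w by (auto simp: alive_def)
next
  assume al: "\<omega> \<in> alive t"
  obtain d where d: "t < d" "\<forall>s>t. s < d \<longrightarrow> X s \<omega> = X t \<omega>"
    using X_right[OF w t] unfolding eventually_at_right[of t "t + 1", simplified] by blast
  have "ennreal t < ennreal d" using d t by (simp add: ennreal_lessI)
  also have "\<dots> \<le> hitting_time X v \<omega>"
    unfolding hitting_time_def
  proof (rule INF_greatest)
    fix s assume s: "s \<in> {t. 0 \<le> t \<and> X t \<omega> = v}"
    have "\<not> s < d"
    proof (cases "s \<le> t")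
      case True
      then show ?thesis using s al by (auto simp: alive_def)
    next
      case False
      have "X t \<omega> \<noteq> v" using al t by (auto simp: alive_def)
      have Xs: "X s \<omega> = v" using s by simp
      have "\<not> (t < s \<and> s < d)" using d(2) \<open>X t \<omega> \<noteq> v\<close> unfolding Xs[symmetric] by blast
      then show ?thesis using False by simp
    qed
    then show "ennreal d \<le> ennreal s" by (intro ennreal_leI) simp
  qed
  finally show "ennreal t < hitting_time X v \<omega>" .
qed

lemma hitting_time_measurable [measurable]: "hitting_time X v \<in> borel_measurable M"
proof (rule borel_measurableI_greater)
  fix y :: ennreal
  show "{\<omega> \<in> space M. y < hitting_time X v \<omega>} \<in> sets M"
  proof (cases y)
    case (real t)
    then have "{\<omega> \<in> space M. y < hitting_time X v \<omega>} = alive t"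
      using hitting_time_greater[of _ t] by (auto simp: alive_def)
    then show ?thesis by simp
  qed simp
qed

text \<open>The chain below only reacts to cells \<open>(T j, T (Suc j)]\<close> of the grid that contain exactly one tick.
  Unlike the process, it is an explicit function of independent increments, and it coincides with the
  process as long as no cell contains two ticks.\<close>

definition inc :: "(nat \<Rightarrow> real) \<Rightarrow> 'w \<Rightarrow> 'a clock \<times> nat \<Rightarrow> nat" where
  "inc T \<omega> = (\<lambda>(q, j). N q (T (Suc j)) \<omega> - N q (T j) \<omega>)"

definition single :: "('a clock \<times> nat \<Rightarrow> nat) \<Rightarrow> nat \<Rightarrow> 'a clock \<Rightarrow> bool" where
  "single f j q \<longleftrightarrow> q \<in> clks \<and> f (q, j) = 1 \<and> (\<forall>q'\<in>clks - {q}. f (q', j) = 0)"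

lemma single_unique: "single f j q \<Longrightarrow> single f j q' \<Longrightarrow> q' = q"
  unfolding single_def by (metis DiffI singletonD zero_neq_one)

fun chain :: "('a clock \<times> nat \<Rightarrow> nat) \<Rightarrow> nat \<Rightarrow> 'a set" where
  "chain f 0 = x0"
| "chain f (Suc j) =
     (if chain f j \<noteq> v \<and> (\<exists>q. single f j q) then flip U V (THE q. single f j q) (chain f j)
      else chain f j)"

lemma chain_Suc_single: "single f j q \<Longrightarrow> chain f j \<noteq> v \<Longrightarrow> chain f (Suc j) = flip U V q (chain f j)"
  using single_unique by (auto intro!: arg_cong2[of _ _ _ _ "flip U V"] the_equality)

lemma single_cong:
  assumes "\<And>q. q \<in> clks \<Longrightarrow> f (q, j) = g (q, j)" shows "single f j = single g j"
  using assms by (auto simp: single_def fun_eq_iff)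

lemma chain_cong:
  assumes "\<And>q i. q \<in> clks \<Longrightarrow> i < j \<Longrightarrow> f (q, i) = g (q, i)"
  shows "chain f j = chain g j"
  using assms
proof (induction j)
  case (Suc j)
  have "single f j = single g j" using Suc.prems by (intro single_cong) auto
  moreover have "chain f j = chain g j" using Suc by auto
  ultimately show ?case by (simp only: chain.simps)
qed simp

definition good_cell :: "('a clock \<times> nat \<Rightarrow> nat) \<Rightarrow> nat \<Rightarrow> bool" where
  "good_cell f j \<longleftrightarrow> (\<forall>q\<in>clks. f (q, j) = 0) \<or> (\<exists>q. single f j q)"

text \<open>The chain freezes in \<open>v\<close>, so its state records both the configuration and
  whether the target has been hit. In a good cell the path takes at most two values, so it cannot
  enter and leave \<open>v\<close> between two grid points.\<close>

lemma chain_eq_X: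
  assumes w: "\<omega> \<in> space M" and T: "T 0 = 0" "mono T"
    and good: "\<And>i. i < j \<Longrightarrow> good_cell (inc T \<omega>) i"
  shows "chain (inc T \<omega>) j = (if \<omega> \<in> alive (T j) then X (T j) \<omega> else v)"
  using good
proof (induction j)
  case 0
  then show ?case using T w X_0 alive_0 by simp
next
  case (Suc j)
  let ?f = "inc T \<omega>"
  have T_le: "T j \<le> T (Suc j)" and T_ge: "0 \<le> T j"
    using T monoD[OF T(2), of 0 j] monoD[OF T(2), of j "Suc j"] by auto
  have IH: "chain ?f j = (if \<omega> \<in> alive (T j) then X (T j) \<omega> else v)"
    using Suc by auto
  have counting: "\<forall>q\<in>clks. counting_path (\<lambda>t. N q t \<omega>)"
    using clock w unfolding poisson_clock_def counting_path_def by blast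
  have "hard_core_path U V x0 (\<lambda>q t. N q t \<omega>) (\<lambda>t. X t \<omega>)" by (rule path[OF w])
  note path = this
  show ?case
  proof (cases "\<omega> \<in> alive (T j)")
    case False
    then have "\<omega> \<notin> alive (T (Suc j))" using alive_antimono[OF T_le] by auto
    then show ?thesis using IH False by simp
  next
    case True
    then have nv: "chain ?f j \<noteq> v" and ch: "chain ?f j = X (T j) \<omega>"
      using IH T_ge by (auto simp: alive_def)
    have alive_Suc: "\<omega> \<in> alive (T (Suc j)) \<longleftrightarrow> (\<forall>s\<in>{T j..T (Suc j)}. X s \<omega> \<noteq> v)"
    proof -
      have "s \<in> {0..T (Suc j)} \<longleftrightarrow> s \<in> {0..T j} \<or> s \<in> {T j..T (Suc j)}" for s
        using T_le T_ge by auto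
      then show ?thesis using True unfolding alive_def by blast
    qed
    consider "\<forall>q\<in>clks. ?f (q, j) = 0" | q where "single ?f j q"
      using Suc.prems[of j] by (auto simp: good_cell_def)
    then show ?thesis
    proof cases
      case 1
      have const: "\<forall>s\<in>{T j..T (Suc j)}. X s \<omega> = X (T j) \<omega>"
      proof (rule hard_core_path_no_ticks_closed[OF path x0(1) T_ge], intro ballI)
        fix s q assume "s \<in> {T j<..T (Suc j)}" "q \<in> clks"
        then show "\<not> ticks (\<lambda>t. N q t \<omega>) s"
          using 1 counting T_ge by (intro counting_path_no_tick[of _ "T j" "T (Suc j)"]) (auto simp: inc_def)
      qed
      have "\<not> (\<exists>q. single ?f j q)" using 1 by (auto simp: single_def)
      then have "chain ?f (Suc j) = X (T j) \<omega>" using ch by (simp only: chain.simps simp_thms if_False)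
      moreover have "X (T (Suc j)) \<omega> = X (T j) \<omega>"
        using bspec[OF const, of "T (Suc j)"] T_le by auto
      moreover have "\<omega> \<in> alive (T (Suc j))"
        unfolding alive_Suc
      proof
        fix s assume "s \<in> {T j..T (Suc j)}"
        from bspec[OF const this] show "X s \<omega> \<noteq> v" using nv ch by simp
      qed
      ultimately show ?thesis by simp
    next
      case 2
      then have q: "q \<in> clks" "N q (T (Suc j)) \<omega> - N q (T j) \<omega> = 1"
        "\<forall>q'\<in>clks - {q}. N q' (T (Suc j)) \<omega> - N q' (T j) \<omega> = 0"
        by (auto simp: single_def inc_def)
      obtain s where s: "s \<in> {T j<..T (Suc j)}" "\<forall>s'\<in>{T j..<s}. X s' \<omega> = X (T j) \<omega>"
        "\<forall>s'\<in>{s..T (Suc j)}. X s' \<omega> = flip U V q (X (T j) \<omega>)"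
        by (rule hard_core_path_one_tick[OF path x0(1) T_ge T_le counting q])
      have fl: "chain ?f (Suc j) = flip U V q (X (T j) \<omega>)"
        using chain_Suc_single[OF 2 nv] ch by simp
      have XS: "X (T (Suc j)) \<omega> = flip U V q (X (T j) \<omega>)"
        using bspec[OF s(3), of "T (Suc j)"] s(1) by auto
      have "\<omega> \<in> alive (T (Suc j)) \<longleftrightarrow> flip U V q (X (T j) \<omega>) \<noteq> v"
      proof
        assume "\<omega> \<in> alive (T (Suc j))"
        then show "flip U V q (X (T j) \<omega>) \<noteq> v"
          using XS T_le unfolding alive_Suc by force
      next
        assume n: "flip U V q (X (T j) \<omega>) \<noteq> v"
        show "\<omega> \<in> alive (T (Suc j))"
          unfolding alive_Suc
        proof
          fix s' assume "s' \<in> {T j..T (Suc j)}"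
          then have "X s' \<omega> = X (T j) \<omega> \<or> X s' \<omega> = flip U V q (X (T j) \<omega>)"
            using bspec[OF s(2), of s'] bspec[OF s(3), of s'] by (cases "s' < s") auto
          then show "X s' \<omega> \<noteq> v" using n nv ch by auto
        qed
      qed
      then show ?thesis using fl XS by auto
    qed
  qed
qed

end

section \<open>Joint law of the clock increments on a grid\<close>

lemma measurable_diff_nat:
  fixes f g :: "'a \<Rightarrow> nat"
  assumes "f \<in> measurable M (count_space UNIV)" "g \<in> measurable M (count_space UNIV)"
  shows "(\<lambda>x. f x - g x) \<in> measurable M (count_space UNIV)"
  by (rule measurable_compose_countable[where f = "\<lambda>i x. i - g x", OF _ assms(1)])
    (rule measurable_compose[OF assms(2)], simp)

context hard_core
begin

context
  fixes T :: "nat \<Rightarrow> real"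
  assumes T_0: "T 0 = 0" and T_mono: "mono T"
begin

lemma T_nonneg: "0 \<le> T j"
  using monoD[OF T_mono, of 0 j] T_0 by simp

lemma T_Suc: "T j \<le> T (Suc j)"
  by (rule monoD[OF T_mono]) simp

lemma inc_measurable:
  assumes "q \<in> clks" shows "(\<lambda>\<omega>. inc T \<omega> (q, j)) \<in> measurable M (count_space UNIV)"
  unfolding inc_def using clock_measurable[OF assms] T_nonneg by (auto intro!: measurable_diff_nat)

text \<open>Independence is given in two layers: between the clocks as whole processes, and between
  the successive increments of each clock. Probabilities therefore factor over the clocks and then,
  for each clock, over the cells.\<close>

lemma inc_indep:
  "indep_vars (\<lambda>_. count_space UNIV) (\<lambda>p \<omega>. inc T \<omega> p) (clks \<times> {..<Suc n})"
  unfolding indep_vars_def2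
proof (intro conjI ballI)
  let ?I = "clks \<times> {..<Suc n}"
  let ?F = "\<lambda>p. {(\<lambda>\<omega>. inc T \<omega> p) -` A \<inter> space M |A. A \<in> sets (count_space UNIV)}"
  fix p assume "p \<in> ?I"
  then show "(\<lambda>\<omega>. inc T \<omega> p) \<in> measurable M (count_space UNIV)"
    using inc_measurable by auto
next
  let ?I = "clks \<times> {..<Suc n}"
  let ?F = "\<lambda>p. {(\<lambda>\<omega>. inc T \<omega> p) -` A \<inter> space M |A. A \<in> sets (count_space UNIV)}"
  let ?P = "PiM {0..} (\<lambda>_. count_space UNIV) :: (real \<Rightarrow> nat) measure"
  have "indep_sets ?F ?I \<longleftrightarrow> (\<forall>A\<in>Pi ?I ?F. prob (\<Inter>p\<in>?I. A p) = (\<Prod>p\<in>?I. prob (A p)))"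
  proof (rule indep_sets_finite)
    show "finite ?I" using finite_clks by simp
    show "?I \<noteq> {}" using clks_nonempty by auto
    fix p assume p: "p \<in> ?I"
    show "space M \<in> ?F p" by (auto intro!: exI[of _ UNIV])
    have "(\<lambda>\<omega>. inc T \<omega> p) \<in> measurable M (count_space UNIV)"
      using p inc_measurable by auto
    from measurable_sets[OF this] show "?F p \<subseteq> events" by auto
  qed
  moreover have "\<forall>A\<in>Pi ?I ?F. prob (\<Inter>p\<in>?I. A p) = (\<Prod>p\<in>?I. prob (A p))"
  proof
    fix A assume A: "A \<in> Pi ?I ?F"
    then have "\<forall>p\<in>?I. \<exists>B. A p = (\<lambda>\<omega>. inc T \<omega> p) -` B \<inter> space M" by (auto simp: Pi_iff)
    then obtain B where B: "\<And>p. p \<in> ?I \<Longrightarrow> A p = (\<lambda>\<omega>. inc T \<omega> p) -` B p \<inter> space M"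
      by metis
    \<comment> \<open>A set of paths of clock \<open>q\<close>: prescribing its finitely many
      increments is measurable in the product space, so the independence of whole paths
      applies.\<close>
    define C where "C q = {f \<in> space ?P. \<forall>j\<in>{..<Suc n}. f (T (Suc j)) - f (T j) \<in> B (q, j)}" for q
    have C_sets: "C q \<in> sets ?P" for q
      unfolding C_def
    proof (rule sets.sets_Collect_finite_All)
      fix j :: nat
      have "(\<lambda>f. f (T (Suc j)) - f (T j)) \<in> measurable ?P (count_space UNIV)"
        using T_nonneg by (intro measurable_diff_nat measurable_component_singleton) auto
      from measurable_sets[OF this, of "B (q, j)"]
      show "{f \<in> space ?P. f (T (Suc j)) - f (T j) \<in> B (q, j)} \<in> sets ?P"
        by (simp add: vimage_def Int_def conj_commute)
    qed simp
    let ?Y = "\<lambda>q \<omega>. \<lambda>t\<in>{0..}. N q t \<omega>"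
    have indep: "indep_vars (\<lambda>_. ?P) ?Y clks"
      using process unfolding hard_core_process_def clocks_def by blast
    have Y: "?Y q -` C q \<inter> space M = (\<Inter>j\<in>{..<Suc n}. A (q, j))" if "q \<in> clks" for q
    proof -
      have "A (q, j) = (\<lambda>\<omega>. inc T \<omega> (q, j)) -` B (q, j) \<inter> space M" if "j \<in> {..<Suc n}" for j
        using B \<open>q \<in> clks\<close> that by auto
      then have "(\<Inter>j\<in>{..<Suc n}. A (q, j)) = (\<Inter>j\<in>{..<Suc n}. (\<lambda>\<omega>. inc T \<omega> (q, j)) -` B (q, j) \<inter> space M)"
        by simp
      also have "\<dots> = ?Y q -` C q \<inter> space M"
        using T_nonneg by (auto simp: C_def inc_def space_PiM lessThan_Suc)
      finally show ?thesis ..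
    qed
    have "(\<Inter>p\<in>?I. A p) = (\<Inter>q\<in>clks. ?Y q -` C q \<inter> space M)"
      using Y by auto
    then have "prob (\<Inter>p\<in>?I. A p) = (\<Prod>q\<in>clks. prob (?Y q -` C q \<inter> space M))"
      using indep_varsD_finite[OF indep clks_nonempty finite_clks C_sets] by simp
    also have "\<dots> = (\<Prod>q\<in>clks. \<Prod>j<Suc n. prob (A (q, j)))"
    proof (rule prod.cong[OF refl])
      fix q assume q: "q \<in> clks"
      have "indep_vars (\<lambda>_. count_space UNIV) (\<lambda>j \<omega>. N q (T (Suc j)) \<omega> - N q (T j) \<omega>) {..<Suc n}"
        using clock[OF q] T_0 T_mono unfolding poisson_clock_def by auto
      then have "prob (\<Inter>j\<in>{..<Suc n}. (\<lambda>\<omega>. N q (T (Suc j)) \<omega> - N q (T j) \<omega>) -` B (q, j) \<inter> space M)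
          = (\<Prod>j<Suc n. prob ((\<lambda>\<omega>. N q (T (Suc j)) \<omega> - N q (T j) \<omega>) -` B (q, j) \<inter> space M))"
        by (rule indep_varsD_finite) auto
      moreover have "A (q, j) = (\<lambda>\<omega>. N q (T (Suc j)) \<omega> - N q (T j) \<omega>) -` B (q, j) \<inter> space M"
        if "j \<in> {..<Suc n}" for j
        using B[of "(q, j)"] q that by (auto simp: inc_def)
      ultimately show "prob (?Y q -` C q \<inter> space M) = (\<Prod>j<Suc n. prob (A (q, j)))"
        unfolding Y[OF q] by simp
    qed
    also have "\<dots> = (\<Prod>p\<in>?I. prob (A p))"
      by (simp add: prod.cartesian_product case_prod_unfold del: prod.lessThan_Suc)
    finally show "prob (\<Inter>p\<in>?I. A p) = (\<Prod>p\<in>?I. prob (A p))" .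
  qed
  ultimately show "indep_sets ?F ?I" by simp
qed

definition mean :: "nat \<Rightarrow> 'a clock \<Rightarrow> real" where
  "mean j q = integral {T j..T (Suc j)} (clock_rate rate q)"

definition total_mean :: "nat \<Rightarrow> real" where
  "total_mean j = (\<Sum>q\<in>clks. mean j q)"

lemma mean_nonneg: "q \<in> clks \<Longrightarrow> 0 \<le> mean j q"
  unfolding mean_def
  using T_nonneg[of j] clock_rate_nonneg
  by (intro Henstock_Kurzweil_Integration.integral_nonneg integrable_continuous_real)
    (auto intro: continuous_on_subset[OF clock_rate_cont])

lemma total_mean_nonneg: "0 \<le> total_mean j"
  unfolding total_mean_def by (intro sum_nonneg mean_nonneg)

lemma prob_inc:
  assumes "q \<in> clks"
  shows "prob {\<omega> \<in> space M. inc T \<omega> (q, j) = k} = mean j q ^ k / fact k * exp (- mean j q)"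
  using clock[OF assms] T_nonneg T_Suc unfolding poisson_clock_def inc_def mean_def by auto

lemma prob_inc_cell:
  "prob {\<omega> \<in> space M. \<forall>q\<in>clks. inc T \<omega> (q, j) = b q} =
    (\<Prod>q\<in>clks. mean j q ^ b q / fact (b q) * exp (- mean j q))"
proof -
  let ?J = "clks \<times> {j}"
  have "prob (\<Inter>p\<in>?J. (\<lambda>\<omega>. inc T \<omega> p) -` {b (fst p)} \<inter> space M)
      = (\<Prod>p\<in>?J. prob ((\<lambda>\<omega>. inc T \<omega> p) -` {b (fst p)} \<inter> space M))"
    using clks_nonempty finite_clks by (intro indep_varsD[OF inc_indep[of j]]) auto
  also have "(\<Inter>p\<in>?J. (\<lambda>\<omega>. inc T \<omega> p) -` {b (fst p)} \<inter> space M)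
      = {\<omega> \<in> space M. \<forall>q\<in>clks. inc T \<omega> (q, j) = b q}"
    using clks_nonempty by auto
  also have "(\<Prod>p\<in>?J. prob ((\<lambda>\<omega>. inc T \<omega> p) -` {b (fst p)} \<inter> space M))
      = (\<Prod>q\<in>clks. prob {\<omega> \<in> space M. inc T \<omega> (q, j) = b q})"
    by (rule prod.reindex_cong[of "\<lambda>q. (q, j)"])
      (auto simp: inj_on_def vimage_def Int_def conj_commute)
  also have "\<dots> = (\<Prod>q\<in>clks. mean j q ^ b q / fact (b q) * exp (- mean j q))"
    by (intro prod.cong prob_inc) auto
  finally show ?thesis .
qed

lemma prob_no_tick:
  "prob {\<omega> \<in> space M. \<forall>q\<in>clks. inc T \<omega> (q, j) = 0} = exp (- total_mean j)"
  using prob_inc_cell[of j "\<lambda>_. 0"] finite_clks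
  by (simp add: total_mean_def exp_sum sum_negf[symmetric])

lemma prob_single:
  assumes q: "q \<in> clks"
  shows "prob {\<omega> \<in> space M. single (inc T \<omega>) j q} = mean j q * exp (- total_mean j)"
proof -
  let ?b = "\<lambda>q'. if q' = q then 1 else 0 :: nat"
  have "{\<omega> \<in> space M. single (inc T \<omega>) j q} = {\<omega> \<in> space M. \<forall>q'\<in>clks. inc T \<omega> (q', j) = ?b q'}"
    using q by (auto simp: single_def)
  then have "prob {\<omega> \<in> space M. single (inc T \<omega>) j q}
      = (\<Prod>q'\<in>clks. mean j q' ^ ?b q' / fact (?b q') * exp (- mean j q'))"
    using prob_inc_cell[of j ?b] by simp
  also have "\<dots> = (\<Prod>q'\<in>clks. (if q' = q then mean j q else 1) * exp (- mean j q'))"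
    by (intro prod.cong) auto
  also have "\<dots> = mean j q * exp (- total_mean j)"
    using q finite_clks
    by (simp add: prod.distrib total_mean_def exp_sum sum_negf[symmetric])
  finally show ?thesis .
qed

lemma cell_event: "{\<omega> \<in> space M. \<forall>q\<in>clks. inc T \<omega> (q, j) = b q} \<in> sets M"
proof -
  have "{\<omega> \<in> space M. inc T \<omega> (q, j) = b q} \<in> sets M" if "q \<in> clks" for q
    using measurable_sets[OF inc_measurable[OF that], of "{b q}" j]
    by (simp add: vimage_def Int_def conj_commute)
  then show ?thesis by (intro sets.sets_Collect_finite_All finite_clks)
qed

lemma single_event [measurable]: "{\<omega> \<in> space M. single (inc T \<omega>) j q} \<in> sets M"
proof (cases "q \<in> clks")
  case True
  let ?b = "\<lambda>q'. if q' = q then 1 else 0 :: nat"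
  have "{\<omega> \<in> space M. single (inc T \<omega>) j q} = {\<omega> \<in> space M. \<forall>q'\<in>clks. inc T \<omega> (q', j) = ?b q'}"
    using True by (auto simp: single_def)
  then show ?thesis using cell_event[of j ?b] by simp
qed (simp add: single_def)

lemma good_cell_event [measurable]: "{\<omega> \<in> space M. good_cell (inc T \<omega>) j} \<in> sets M"
proof -
  have "{\<omega> \<in> space M. good_cell (inc T \<omega>) j} = {\<omega> \<in> space M. \<forall>q\<in>clks. inc T \<omega> (q, j) = 0} \<union>
      (\<Union>q\<in>clks. {\<omega> \<in> space M. single (inc T \<omega>) j q})"
    by (auto simp: good_cell_def single_def)
  then show ?thesis
    using sets.Un[OF cell_event[of j "\<lambda>_. 0"] sets.finite_UN[OF finite_clks single_event]] by simp
qed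

text \<open>With total mean \<open>x\<close>, at most one tick has probability
  \<open>(1 + x) * exp (- x)\<close>, which is at least \<open>1 - x ^ 2\<close> because
  \<open>exp (- x) \<ge> 1 - x\<close>. The quadratic order is what makes the sum over a fine grid
  vanish.\<close>

lemma prob_bad_cell:
  "prob {\<omega> \<in> space M. \<not> good_cell (inc T \<omega>) j} \<le> (total_mean j)\<^sup>2"
proof -
  let ?Z = "{\<omega> \<in> space M. \<forall>q\<in>clks. inc T \<omega> (q, j) = 0}"
  let ?S = "\<lambda>q. {\<omega> \<in> space M. single (inc T \<omega>) j q}"
  have "{\<omega> \<in> space M. good_cell (inc T \<omega>) j} = ?Z \<union> (\<Union>q\<in>clks. ?S q)"
    by (auto simp: good_cell_def single_def)
  moreover have "prob (?Z \<union> (\<Union>q\<in>clks. ?S q)) = prob ?Z + prob (\<Union>q\<in>clks. ?S q)"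
    by (intro finite_measure_Union cell_event sets.finite_UN[OF finite_clks single_event])
      (auto simp: single_def)
  moreover have "prob (\<Union>q\<in>clks. ?S q) = (\<Sum>q\<in>clks. prob (?S q))"
    using finite_clks single_unique by (intro finite_measure_finite_Union) (auto simp: disjoint_family_on_def)
  moreover have "(\<Sum>q\<in>clks. prob (?S q)) = total_mean j * exp (- total_mean j)"
    by (simp add: prob_single total_mean_def sum_distrib_right)
  ultimately have good: "prob {\<omega> \<in> space M. good_cell (inc T \<omega>) j} = (1 + total_mean j) * exp (- total_mean j)"
    using prob_no_tick by (simp add: algebra_simps)
  have "(1 + total_mean j) * (1 - total_mean j) \<le> (1 + total_mean j) * exp (- total_mean j)"
    using exp_ge_add_one_self[of "- total_mean j"] total_mean_nonneg by (intro mult_left_mono) auto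
  then have "1 - (total_mean j)\<^sup>2 \<le> prob {\<omega> \<in> space M. good_cell (inc T \<omega>) j}"
    unfolding good by (simp add: algebra_simps power2_eq_square)
  moreover have "prob {\<omega> \<in> space M. \<not> good_cell (inc T \<omega>) j} = 1 - prob {\<omega> \<in> space M. good_cell (inc T \<omega>) j}"
    by (rule prob_neg) simp
  ultimately show ?thesis by simp
qed

lemma prob_bad:
  "prob {\<omega> \<in> space M. \<exists>j<n. \<not> good_cell (inc T \<omega>) j} \<le> (\<Sum>j<n. (total_mean j)\<^sup>2)"
proof -
  have "{\<omega> \<in> space M. \<exists>j<n. \<not> good_cell (inc T \<omega>) j} = (\<Union>j<n. {\<omega> \<in> space M. \<not> good_cell (inc T \<omega>) j})"
    by auto
  moreover have "prob (\<Union>j<n. {\<omega> \<in> space M. \<not> good_cell (inc T \<omega>) j})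
      \<le> (\<Sum>j<n. prob {\<omega> \<in> space M. \<not> good_cell (inc T \<omega>) j})"
    by (intro finite_measure_subadditive_finite) auto
  ultimately show ?thesis
    using sum_mono[of "{..<n}" "\<lambda>j. prob {\<omega> \<in> space M. \<not> good_cell (inc T \<omega>) j}" "\<lambda>j. (total_mean j)\<^sup>2"]
      prob_bad_cell by simp
qed

lemma bad_event: "{\<omega> \<in> space M. \<exists>j<n. \<not> good_cell (inc T \<omega>) j} \<in> sets M"
proof -
  have "{\<omega> \<in> space M. \<exists>j<n. \<not> good_cell (inc T \<omega>) j} = (\<Union>j<n. {\<omega> \<in> space M. \<not> good_cell (inc T \<omega>) j})"
    by auto
  then show ?thesis by auto
qed

lemma PiM_count_space:
  assumes "finite A"
  shows "PiM A (\<lambda>_. count_space (UNIV :: nat set)) = count_space (PiE A (\<lambda>_. UNIV))"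
  by (rule count_space_PiM_finite) (use assms in auto)

text \<open>Markov property of the chain: its state before cell \<open>j\<close> is a function of
  the earlier cells, while \<open>single\<close> reads only cell \<open>j\<close>, so two disjoint
  blocks of independent increments are involved. Each block is a finite family of discrete
  variables, which makes all sets measurable.\<close>

lemma
  shows chain_single_indep: "prob {\<omega> \<in> space M. chain (inc T \<omega>) j = x \<and> single (inc T \<omega>) j q} =
    prob {\<omega> \<in> space M. chain (inc T \<omega>) j = x} * prob {\<omega> \<in> space M. single (inc T \<omega>) j q}"
  and chain_event: "{\<omega> \<in> space M. chain (inc T \<omega>) j = x} \<in> sets M"
proof -
  let ?A = "clks \<times> {..<j}" and ?B = "clks \<times> {j}"
  let ?cs = "\<lambda>A. PiM A (\<lambda>_. count_space UNIV) :: ('a clock \<times> nat \<Rightarrow> nat) measure"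
  have ind: "indep_var (?cs ?A) (\<lambda>\<omega>. restrict (inc T \<omega>) ?A) (?cs ?B) (\<lambda>\<omega>. restrict (inc T \<omega>) ?B)"
    by (rule indep_var_restrict[OF inc_indep[of j]]) auto
  let ?C = "{f \<in> PiE ?A (\<lambda>_. UNIV). chain f j = x}" and ?D = "{f \<in> PiE ?B (\<lambda>_. UNIV). single f j q}"
  have C: "?C \<in> sets (?cs ?A)" and D: "?D \<in> sets (?cs ?B)"
    using finite_clks by (auto simp: PiM_count_space)
  have cA: "chain (restrict (inc T \<omega>) ?A) j = chain (inc T \<omega>) j" for \<omega>
    by (rule chain_cong) auto
  then have C': "(\<lambda>\<omega>. restrict (inc T \<omega>) ?A) -` ?C \<inter> space M = {\<omega> \<in> space M. chain (inc T \<omega>) j = x}"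
    by auto
  have cB: "single (restrict (inc T \<omega>) ?B) j = single (inc T \<omega>) j" for \<omega>
    by (rule single_cong) auto
  then have D': "(\<lambda>\<omega>. restrict (inc T \<omega>) ?B) -` ?D \<inter> space M = {\<omega> \<in> space M. single (inc T \<omega>) j q}"
    by auto
  have CD: "(\<lambda>\<omega>. (restrict (inc T \<omega>) ?A, restrict (inc T \<omega>) ?B)) -` (?C \<times> ?D) \<inter> space M =
     {\<omega> \<in> space M. chain (inc T \<omega>) j = x \<and> single (inc T \<omega>) j q}"
    by (auto simp: cA cB)
  show "prob {\<omega> \<in> space M. chain (inc T \<omega>) j = x \<and> single (inc T \<omega>) j q} =
    prob {\<omega> \<in> space M. chain (inc T \<omega>) j = x} * prob {\<omega> \<in> space M. single (inc T \<omega>) j q}"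
    using indep_varD[OF ind C D] unfolding C' D' CD .
  show "{\<omega> \<in> space M. chain (inc T \<omega>) j = x} \<in> sets M"
    using measurable_sets[OF indep_var_rv1[OF ind] C] unfolding C' .
qed

end

end

section \<open>A Dynkin inequality\<close>

lemma continuous_on_interval_bound:
  fixes f :: "real \<Rightarrow> real"
  assumes "continuous_on {a..b} f"
  obtains B where "0 \<le> B" "\<And>t. t \<in> {a..b} \<Longrightarrow> \<bar>f t\<bar> \<le> B"
proof -
  have "bounded (f ` {a..b})"
    using assms by (intro compact_imp_bounded compact_continuous_image) auto
  then obtain B where "\<forall>t\<in>{a..b}. \<bar>f t\<bar> \<le> B" by (auto simp: bounded_iff)
  then show ?thesis by (intro that[of "max B 0"]) (auto simp: max.coboundedI1)
qed

lemma uniformly_continuous_eventually: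
  fixes f :: "real \<Rightarrow> real"
  assumes "continuous_on {a..b} f" "e > 0"
  shows "eventually (\<lambda>d. \<forall>s\<in>{a..b}. \<forall>t\<in>{a..b}. \<bar>t - s\<bar> \<le> d \<longrightarrow> \<bar>f t - f s\<bar> \<le> e) (at_right 0)"
proof -
  have "uniformly_continuous_on {a..b} f"
    using assms(1) by (intro compact_uniformly_continuous) auto
  then obtain d0 where d0: "d0 > 0" "\<And>s t. s \<in> {a..b} \<Longrightarrow> t \<in> {a..b} \<Longrightarrow> dist t s < d0 \<Longrightarrow> dist (f t) (f s) < e"
    using assms(2) unfolding uniformly_continuous_on_def by metis
  show ?thesis
    unfolding eventually_at_right[OF d0(1)]
    using d0 by (intro exI[of _ d0]) (force simp: dist_real_def)
qed

text \<open>The mean value theorem is applied to \<open>\<phi> s + (\<Sum>q\<in>Q. c q * integral {a..s} (r q))\<close>, where \<open>c q\<close>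
  is the jump \<open>\<psi> q t'\<close> times the probability of no tick.\<close>

lemma cell_drift:
  fixes \<phi> D :: "real \<Rightarrow> real" and \<psi> r :: "'q \<Rightarrow> real \<Rightarrow> real"
  assumes fin: "finite Q"
    and \<phi>: "continuous_on {a..b} \<phi>"
    and D: "\<And>t. t \<in> {a<..<b} \<Longrightarrow> (\<phi> has_real_derivative D t) (at t)"
    and r: "\<And>q. q \<in> Q \<Longrightarrow> continuous_on {a..b} (r q)"
    and r_nonneg: "\<And>q t. q \<in> Q \<Longrightarrow> t \<in> {a..b} \<Longrightarrow> 0 \<le> r q t"
    and \<psi>: "\<And>q. q \<in> Q \<Longrightarrow> continuous_on {a..b} (\<psi> q)"
    and drift: "\<And>t. t \<in> {a<..<b} \<Longrightarrow> D t + (\<Sum>q\<in>Q. r q t * \<psi> q t) \<le> - l"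
    and e: "e > 0"
  shows "eventually (\<lambda>d. \<forall>t t'. a \<le> t \<and> t < t' \<and> t' \<le> b \<and> t' - t \<le> d \<longrightarrow>
     \<phi> t' - \<phi> t + exp (- (\<Sum>q\<in>Q. integral {t..t'} (r q))) * (\<Sum>q\<in>Q. integral {t..t'} (r q) * \<psi> q t')
       \<le> (t' - t) * (e - l)) (at_right 0)"
proof -
  obtain \<Lambda> where \<Lambda>': "0 \<le> \<Lambda>" "\<And>t. t \<in> {a..b} \<Longrightarrow> \<bar>\<Sum>q\<in>Q. r q t\<bar> \<le> \<Lambda>"
    by (rule continuous_on_interval_bound[OF continuous_on_sum[OF r]]) auto
  then have \<Lambda>: "0 \<le> \<Lambda>" "\<And>t. t \<in> {a..b} \<Longrightarrow> (\<Sum>q\<in>Q. r q t) \<le> \<Lambda>"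
    using abs_le_D1 by blast+
  obtain B where B': "0 \<le> B" "\<And>t. t \<in> {a..b} \<Longrightarrow> \<bar>\<Sum>q\<in>Q. \<bar>\<psi> q t\<bar>\<bar> \<le> B"
    by (rule continuous_on_interval_bound[OF continuous_on_sum[OF continuous_on_rabs[OF \<psi>]]]) auto
  then have B: "0 \<le> B" "\<And>t. t \<in> {a..b} \<Longrightarrow> (\<Sum>q\<in>Q. \<bar>\<psi> q t\<bar>) \<le> B"
    using abs_le_D1 by blast+
  \<comment> \<open>Each jump term may be off by \<open>e'\<close>. Weighted with the rates, whose
    sum is at most \<open>\<Lambda>\<close>, this costs at most \<open>e\<close>.\<close>
  define e' where "e' = e / (\<Lambda> + 1)"
  have e': "e' > 0" using e \<Lambda>(1) by (simp add: e'_def)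
  have ev1: "eventually (\<lambda>d. \<forall>q\<in>Q. \<forall>s\<in>{a..b}. \<forall>t\<in>{a..b}. \<bar>t - s\<bar> \<le> d \<longrightarrow> \<bar>\<psi> q t - \<psi> q s\<bar> \<le> e' / 2) (at_right 0)"
    using fin e' by (intro eventually_ball_finite ballI uniformly_continuous_eventually \<psi>) auto
  \<comment> \<open>For such \<open>d\<close> the no-tick factor changes a jump by at most
    \<open>e' / 2\<close>, because \<open>1 - exp (- P) \<le> P \<le> \<Lambda> * d\<close> and
    jumps are bounded by \<open>B\<close>.\<close>
  have ev2: "eventually (\<lambda>d. d < e' / (2 * (\<Lambda> * B + 1))) (at_right 0)"
    using e' \<Lambda>(1) B(1) by (intro eventually_at_right_less[THEN eventually_mono] eventually_at_rightI[of 0 "e' / (2 * (\<Lambda> * B + 1))"]) (auto intro!: divide_pos_pos add_nonneg_pos)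
  show ?thesis
    using ev1 ev2 eventually_at_right_less[of 0]
  proof eventually_elim
    case (elim d)
    show ?case
    proof (intro allI impI)
      fix t t' assume t: "a \<le> t \<and> t < t' \<and> t' \<le> b \<and> t' - t \<le> d"
      define P where "P = (\<Sum>q\<in>Q. integral {t..t'} (r q))"
      define c where "c q = exp (- P) * \<psi> q t'" for q
      define F where "F s = \<phi> s + (\<Sum>q\<in>Q. c q * integral {a..s} (r q))" for s
      have cont_sub: "continuous_on {a..b} (r q)" "r q integrable_on {x..y}"
        if "q \<in> Q" "a \<le> x" "y \<le> b" for q x y
      proof -
        show "continuous_on {a..b} (r q)" by (rule r[OF that(1)])
        have "continuous_on {x..y} (r q)"
          by (rule continuous_on_subset[OF r[OF that(1)]]) (use that in auto)
        then show "r q integrable_on {x..y}" by (rule integrable_continuous_real)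
      qed
      have r_le: "(\<Sum>q\<in>Q. r q s) \<le> \<Lambda>" if "s \<in> {t..t'}" for s
        using \<Lambda>(2)[of s] that t by auto
      have P_nonneg: "0 \<le> P"
        unfolding P_def using t cont_sub r_nonneg
        by (intro sum_nonneg Henstock_Kurzweil_Integration.integral_nonneg) auto
      have "P = integral {t..t'} (\<lambda>s. \<Sum>q\<in>Q. r q s)"
        unfolding P_def using fin cont_sub t by (intro integral_sum[symmetric]) auto
      also have "\<dots> \<le> integral {t..t'} (\<lambda>s. \<Lambda>)"
        using r_le fin cont_sub t by (intro integral_le integrable_sum) auto
      finally have P_le: "P \<le> \<Lambda> * d"
        using t \<Lambda>(1) mult_left_mono[of "t' - t" d \<Lambda>] by (simp add: algebra_simps)
      have integral_split: "integral {a..t'} (r q) - integral {a..t} (r q) = integral {t..t'} (r q)" if "q \<in> Q" for q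
        using Henstock_Kurzweil_Integration.integral_combine[of a t t' "r q"] cont_sub[OF that] t by auto
      have F_diff: "F t' - F t = \<phi> t' - \<phi> t + exp (- P) * (\<Sum>q\<in>Q. integral {t..t'} (r q) * \<psi> q t')"
      proof -
        have "F t' - F t = \<phi> t' - \<phi> t + (\<Sum>q\<in>Q. c q * (integral {a..t'} (r q) - integral {a..t} (r q)))"
          by (simp add: F_def sum_subtractf algebra_simps)
        also have "\<dots> = \<phi> t' - \<phi> t + (\<Sum>q\<in>Q. c q * integral {t..t'} (r q))"
          using integral_split by simp
        finally show ?thesis by (simp add: c_def sum_distrib_left mult_ac)
      qed
      have F': "(F has_real_derivative D s + (\<Sum>q\<in>Q. c q * r q s)) (at s)" if s: "s \<in> {t<..<t'}" for s
        unfolding F_def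
      proof (intro DERIV_add D DERIV_sum DERIV_cmult)
        show "s \<in> {a<..<b}" using s t by auto
        fix q assume "q \<in> Q"
        then have "((\<lambda>u. integral {a..u} (r q)) has_real_derivative r q s) (at s within {a..b})"
          using s t by (intro integral_has_real_derivative r) auto
        moreover have "at s within {a..b} = at s"
          using s t by (intro at_within_interior) auto
        ultimately show "((\<lambda>u. integral {a..u} (r q)) has_real_derivative r q s) (at s)" by simp
      qed
      have F_cont: "continuous_on {t..t'} F"
      proof -
        have "continuous_on {a..b} F"
          unfolding F_def using cont_sub by (intro continuous_intros \<phi> indefinite_integral_continuous_1) auto
        then show ?thesis using t by (auto intro: continuous_on_subset)
      qed
      obtain s where s: "t < s" "s < t'" "F t' - F t = (t' - t) * (D s + (\<Sum>q\<in>Q. c q * r q s))"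
      proof -
        have "\<exists>l z. t < z \<and> z < t' \<and> DERIV F z :> l \<and> F t' - F t = (t' - t) * l"
          using t F' F_cont by (intro MVT) (auto simp: real_differentiable_def)
        then obtain l z where "t < z" "z < t'" "DERIV F z :> l" "F t' - F t = (t' - t) * l" by blast
        moreover then have "l = D z + (\<Sum>q\<in>Q. c q * r q z)"
          using F'[of z] DERIV_unique by auto
        ultimately show ?thesis using that by blast
      qed
      have c_close: "c q - \<psi> q s \<le> e'" if q: "q \<in> Q" for q
      proof -
        have "\<bar>\<psi> q t'\<bar> \<le> (\<Sum>q\<in>Q. \<bar>\<psi> q t'\<bar>)"
          using q fin by (intro member_le_sum) auto
        also have "\<dots> \<le> B" using B(2) t by auto
        finally have chi: "\<bar>\<psi> q t'\<bar> \<le> B" .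
        have "1 - exp (- P) \<le> P" using exp_ge_add_one_self[of "- P"] by simp
        then have 1: "\<bar>(1 - exp (- P)) * \<psi> q t'\<bar> \<le> P * B"
          unfolding abs_mult using chi P_nonneg by (intro mult_mono) auto
        have "P * B \<le> \<Lambda> * d * B" using P_le B(1) by (intro mult_right_mono) auto
        also have "\<dots> \<le> (\<Lambda> * B + 1) * d" using elim(3) by (simp add: algebra_simps)
        also have "\<dots> \<le> e' / 2" 
          using elim(2) \<Lambda>(1) B(1) by (simp add: field_simps add_pos_nonneg add_nonneg_pos)
        finally have 2: "P * B \<le> e' / 2" .
        have "\<bar>\<psi> q t' - \<psi> q s\<bar> \<le> e' / 2"
          using elim(1) q s t by auto
        then have "\<psi> q t' - \<psi> q s \<le> e' / 2" by linarith
        moreover have "exp (- P) * \<psi> q t' - \<psi> q t' \<le> P * B"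
          using order_trans[OF abs_ge_minus_self 1] by (simp add: algebra_simps)
        ultimately show ?thesis using 2 unfolding c_def by linarith
      qed
      have s_in: "s \<in> {a<..<b}" using s t by auto
      have "(\<Sum>q\<in>Q. c q * r q s) - (\<Sum>q\<in>Q. r q s * \<psi> q s) = (\<Sum>q\<in>Q. r q s * (c q - \<psi> q s))"
        by (simp add: sum_subtractf algebra_simps)
      also have "\<dots> \<le> (\<Sum>q\<in>Q. r q s * e')"
        using c_close r_nonneg s_in by (intro sum_mono mult_left_mono) auto
      also have "\<dots> = (\<Sum>q\<in>Q. r q s) * e'" by (simp add: sum_distrib_right)
      also have "\<dots> \<le> \<Lambda> * e'"
        using r_le[of s] s e' by (intro mult_right_mono) auto
      also have "\<dots> \<le> e" using e \<Lambda>(1) by (simp add: e'_def field_simps)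
      finally have "D s + (\<Sum>q\<in>Q. c q * r q s) \<le> e - l"
        using drift[OF s_in] by simp
      then have "F t' - F t \<le> (t' - t) * (e - l)"
        unfolding s(3) using t by (intro mult_left_mono) auto
      then show "\<phi> t' - \<phi> t + exp (- (\<Sum>q\<in>Q. integral {t..t'} (r q))) * (\<Sum>q\<in>Q. integral {t..t'} (r q) * \<psi> q t')
       \<le> (t' - t) * (e - l)"
        unfolding F_diff P_def .
    qed
  qed
qed

section \<open>One-step evolution of the chain\<close>

context hard_core
begin

text \<open>A path that has hit the target counts as zero from then on, even if it has left the
  target again.\<close>

definition killed :: "real \<Rightarrow> ('a set \<Rightarrow> real) \<Rightarrow> real" where
  "killed t f = expectation (\<lambda>\<omega>. indicator (alive t) \<omega> * f (X t \<omega>))"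

lemma chain_in:
  assumes "x0 \<in> R" "\<forall>x\<in>R. \<forall>q\<in>clks. flip U V q x \<in> R"
  shows "chain f j \<in> R"
proof (induction j)
  case (Suc j)
  show ?case
  proof (cases "chain f j \<noteq> v \<and> (\<exists>q. single f j q)")
    case True
    then obtain q where "single f j q" "chain f j \<noteq> v" by auto
    then show ?thesis
      using chain_Suc_single[of f j q] Suc assms(2) by (auto simp: single_def)
  next
    case False
    then show ?thesis using Suc by (simp only: chain.simps if_False)
  qed
qed (use assms in simp)

context
  fixes T :: "nat \<Rightarrow> real" and R :: "'a set set"
  assumes T: "T 0 = 0" "mono T"
    and R: "finite R" "x0 \<in> R" "\<forall>x\<in>R. \<forall>q\<in>clks. flip U V q x \<in> R"
begin

definition occ :: "nat \<Rightarrow> 'a set \<Rightarrow> real" where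
  "occ j x = prob {\<omega> \<in> space M. chain (inc T \<omega>) j = x}"

lemma
  fixes f :: "'a set \<Rightarrow> real"
  shows chain_expectation: "expectation (\<lambda>\<omega>. f (chain (inc T \<omega>) j)) = (\<Sum>x\<in>R. occ j x * f x)"
    and chain_integrable: "integrable M (\<lambda>\<omega>. f (chain (inc T \<omega>) j))"
proof -
  have eq: "f (chain (inc T \<omega>) j) = (\<Sum>x\<in>R. indicat_real {\<omega> \<in> space M. chain (inc T \<omega>) j = x} \<omega> * f x)"
    if "\<omega> \<in> space M" for \<omega>
  proof -
    have "(\<Sum>x\<in>R. indicat_real {\<omega> \<in> space M. chain (inc T \<omega>) j = x} \<omega> * f x) =
        (\<Sum>x\<in>R. if x = chain (inc T \<omega>) j then f x else 0)"
      using that by (intro sum.cong) (auto simp: indicator_def)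
    also have "\<dots> = f (chain (inc T \<omega>) j)"
      using R(1) chain_in[OF R(2,3)] by simp
    finally show ?thesis ..
  qed
  have int: "integrable M (\<lambda>\<omega>. indicat_real {\<omega> \<in> space M. chain (inc T \<omega>) j = x} \<omega> * f x)" for x
    using chain_event[OF T] by (intro integrable_mult_left integrable_real_indicator) (auto simp: emeasure_eq_measure)
  have "expectation (\<lambda>\<omega>. f (chain (inc T \<omega>) j)) =
      expectation (\<lambda>\<omega>. \<Sum>x\<in>R. indicat_real {\<omega> \<in> space M. chain (inc T \<omega>) j = x} \<omega> * f x)"
    using eq by (intro Bochner_Integration.integral_cong) auto
  also have "\<dots> = (\<Sum>x\<in>R. occ j x * f x)"
    using int chain_event[OF T]
    by (subst Bochner_Integration.integral_sum) (auto simp: occ_def)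
  finally show "expectation (\<lambda>\<omega>. f (chain (inc T \<omega>) j)) = (\<Sum>x\<in>R. occ j x * f x)" .
  show "integrable M (\<lambda>\<omega>. f (chain (inc T \<omega>) j))"
    using int eq by (subst Bochner_Integration.integrable_cong[OF refl eq]) auto
qed

lemma occ_nonneg: "0 \<le> occ j x"
  by (simp add: occ_def)

text \<open>Forward equation of the chain, tested against \<open>f\<close>. A jump by clock
  \<open>q\<close> needs exactly one tick in the cell, which has probability
  \<open>mean T j q * exp (- total_mean T j)\<close> independently of the current state. The state
  \<open>v\<close> drops out because the chain is frozen there.\<close>

lemma chain_step:
  fixes f :: "'a set \<Rightarrow> real"
  shows "(\<Sum>x\<in>R. occ (Suc j) x * f x) = (\<Sum>x\<in>R. occ j x * f x) +
    (\<Sum>x\<in>R - {v}. occ j x * (exp (- total_mean T j) * (\<Sum>q\<in>clks. mean T j q * (f (flip U V q x) - f x))))"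
proof -
  let ?A = "\<lambda>x q. {\<omega> \<in> space M. chain (inc T \<omega>) j = x \<and> single (inc T \<omega>) j q}"
  let ?g = "\<lambda>x q. f (flip U V q x) - f x"
  have A_sets: "?A x q \<in> sets M" for x q
  proof -
    have "?A x q = {\<omega> \<in> space M. chain (inc T \<omega>) j = x} \<inter> {\<omega> \<in> space M. single (inc T \<omega>) j q}" by auto
    then show ?thesis using chain_event[OF T] single_event[OF T] by auto
  qed
  have int: "integrable M (\<lambda>\<omega>. indicat_real (?A x q) \<omega> * ?g x q)" for x q
    using A_sets by (intro integrable_mult_left integrable_real_indicator) (auto simp: emeasure_eq_measure)
  have eq: "f (chain (inc T \<omega>) (Suc j)) - f (chain (inc T \<omega>) j) =
      (\<Sum>x\<in>R - {v}. \<Sum>q\<in>clks. indicat_real (?A x q) \<omega> * ?g x q)" if w: "\<omega> \<in> space M" for \<omega>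
  proof -
    let ?f = "inc T \<omega>"
    have inner: "(\<Sum>q\<in>clks. indicat_real (?A x q) \<omega> * ?g x q) =
        (if x = chain ?f j then \<Sum>q\<in>clks. (if single ?f j q then ?g x q else 0) else 0)" for x
      using w by (auto simp: indicator_def intro!: sum.cong)
    have "(\<Sum>x\<in>R - {v}. \<Sum>q\<in>clks. indicat_real (?A x q) \<omega> * ?g x q) =
        (if chain ?f j \<noteq> v then \<Sum>q\<in>clks. (if single ?f j q then ?g (chain ?f j) q else 0) else 0)"
      unfolding inner using R(1) chain_in[OF R(2,3)] by (auto simp: sum.delta)
    also have "\<dots> = f (chain ?f (Suc j)) - f (chain ?f j)"
    proof (cases "chain ?f j \<noteq> v \<and> (\<exists>q. single ?f j q)")
      case True
      then obtain q where q: "single ?f j q" "chain ?f j \<noteq> v" by auto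
      have "(\<Sum>q'\<in>clks. (if single ?f j q' then ?g (chain ?f j) q' else 0)) =
          (\<Sum>q'\<in>clks. (if q' = q then ?g (chain ?f j) q else 0))"
      proof (rule sum.cong[OF refl])
        fix q'
        have "single ?f j q' \<longleftrightarrow> q' = q" using q(1) single_unique by blast
        then show "(if single ?f j q' then ?g (chain ?f j) q' else 0) = (if q' = q then ?g (chain ?f j) q else 0)"
          by simp
      qed
      also have "\<dots> = ?g (chain ?f j) q"
        using finite_clks q(1) by (simp add: single_def)
      finally show ?thesis using q chain_Suc_single[OF q] by simp
    next
      case False
      then have "chain ?f (Suc j) = chain ?f j" by (simp only: chain.simps if_False)
      then show ?thesis using False by (auto intro!: sum.neutral)
    qed
    finally show ?thesis ..
  qed
  have "(\<Sum>x\<in>R. occ (Suc j) x * f x) - (\<Sum>x\<in>R. occ j x * f x) =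
      expectation (\<lambda>\<omega>. f (chain (inc T \<omega>) (Suc j)) - f (chain (inc T \<omega>) j))"
    unfolding chain_expectation[symmetric]
    by (intro Bochner_Integration.integral_diff[symmetric] chain_integrable)
  also have "\<dots> = expectation (\<lambda>\<omega>. \<Sum>x\<in>R - {v}. \<Sum>q\<in>clks. indicat_real (?A x q) \<omega> * ?g x q)"
    using eq by (intro Bochner_Integration.integral_cong) auto
  also have "\<dots> = (\<Sum>x\<in>R - {v}. \<Sum>q\<in>clks. prob (?A x q) * ?g x q)"
    using int A_sets by (simp add: Bochner_Integration.integral_sum integrable_sum)
  also have "\<dots> = (\<Sum>x\<in>R - {v}. \<Sum>q\<in>clks. occ j x * (mean T j q * exp (- total_mean T j)) * ?g x q)"
    by (intro sum.cong refl) (simp add: chain_single_indep[OF T] prob_single[OF T] occ_def)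
  also have "\<dots> = (\<Sum>x\<in>R - {v}. occ j x * (exp (- total_mean T j) * (\<Sum>q\<in>clks. mean T j q * ?g x q)))"
    by (simp add: sum_distrib_left mult_ac)
  finally show ?thesis by simp
qed

lemma occ_sum_alive: "(\<Sum>x\<in>R - {v}. occ j x) = prob {\<omega> \<in> space M. chain (inc T \<omega>) j \<noteq> v}"
proof -
  have "(\<Sum>x\<in>R - {v}. occ j x) = (\<Sum>x\<in>R. occ j x * (if x \<noteq> v then 1 else 0))"
    using R(1) by (intro sum.mono_neutral_cong_left) (simp_all split: if_splits)
  also have "\<dots> = expectation (\<lambda>\<omega>. if chain (inc T \<omega>) j \<noteq> v then 1 else 0)"
    by (rule chain_expectation[symmetric])
  also have "\<dots> = expectation (indicat_real {\<omega> \<in> space M. chain (inc T \<omega>) j \<noteq> v})"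
    by (intro Bochner_Integration.integral_cong) (auto simp: indicator_def)
  also have "\<dots> = prob {\<omega> \<in> space M. chain (inc T \<omega>) j \<noteq> v}"
    by (auto intro!: arg_cong[where f = prob])
  finally show ?thesis .
qed

text \<open>The change of the test function in time and the mean jump form a single drift per state.
  As both functions vanish at \<open>v\<close>, only surviving states contribute, and
  \<open>K\<close> is weighted with the survival probability.\<close>

lemma chain_step_le:
  fixes f f' :: "'a set \<Rightarrow> real"
  assumes v: "f v = 0" "f' v = 0"
    and drift: "\<And>x. x \<in> R - {v} \<Longrightarrow> f' x - f x +
      exp (- total_mean T j) * (\<Sum>q\<in>clks. mean T j q * (f' (flip U V q x) - f' x)) \<le> K"
  shows "(\<Sum>x\<in>R. occ (Suc j) x * f' x) \<le> (\<Sum>x\<in>R. occ j x * f x) + K * prob {\<omega> \<in> space M. chain (inc T \<omega>) j \<noteq> v}"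
proof -
  have 1: "(\<Sum>x\<in>R. occ j x * g x) = (\<Sum>x\<in>R - {v}. occ j x * g x)" if "g v = 0" for g
    using R(1) that by (intro sum.mono_neutral_right) auto
  have "(\<Sum>x\<in>R. occ (Suc j) x * f' x) - (\<Sum>x\<in>R. occ j x * f x) =
    (\<Sum>x\<in>R - {v}. occ j x * (f' x - f x + exp (- total_mean T j) * (\<Sum>q\<in>clks. mean T j q * (f' (flip U V q x) - f' x))))"
    unfolding chain_step 1[of f, OF v(1)] 1[of f', OF v(2)]
    by (simp add: sum.distrib sum_subtractf distrib_left right_diff_distrib)
  also have "\<dots> \<le> (\<Sum>x\<in>R - {v}. occ j x * K)"
    using drift occ_nonneg by (intro sum_mono mult_left_mono) auto
  also have "\<dots> = K * prob {\<omega> \<in> space M. chain (inc T \<omega>) j \<noteq> v}"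
    unfolding occ_sum_alive[symmetric] by (simp add: sum_distrib_left mult.commute)
  finally show ?thesis by simp
qed

end

end

section \<open>Comparison of the process with the chain\<close>

lemma integral_cells:
  fixes T :: "nat \<Rightarrow> real" and f :: "real \<Rightarrow> real"
  assumes "mono T" "\<And>x y. f integrable_on {x..y}"
  shows "(\<Sum>j\<in>{n..<n+m}. integral {T j..T (Suc j)} f) = integral {T n..T (n + m)} f"
proof (induction m)
  case (Suc m)
  have "T n \<le> T (n + m)" "T (n + m) \<le> T (Suc (n + m))"
    using monoD[OF assms(1)] by auto
  then show ?case
    using Suc Henstock_Kurzweil_Integration.integral_combine[of "T n" "T (n+m)" "T (Suc (n + m))" f] assms(2)
    by simp
qed simp

context hard_core
begin

lemma killed_integrable:
  assumes "0 \<le> t" "\<forall>x\<in>Pow (U \<union> V). \<bar>f x\<bar> \<le> B"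
  shows "integrable M (\<lambda>\<omega>. indicator (alive t) \<omega> * f (X t \<omega>) :: real)"
proof (rule integrable_const_bound[where B = "max B 0"])
  have "(\<lambda>\<omega>. f (X t \<omega>)) \<in> borel_measurable M"
    by (rule measurable_compose[OF X_measurable[OF assms(1)]]) simp
  then show "(\<lambda>\<omega>. indicator (alive t) \<omega> * f (X t \<omega>)) \<in> borel_measurable M"
    by simp
  have "X t \<omega> \<subseteq> U \<union> V" if "\<omega> \<in> space M" for \<omega>
    using measurable_space[OF X_measurable[OF assms(1)] that] by auto
  then show "AE \<omega> in M. norm (indicator (alive t) \<omega> * f (X t \<omega>)) \<le> max B 0"
    using assms(2) by (intro AE_I2) (auto simp: indicator_def max.coboundedI1)
qed

lemma killed_0: "killed 0 f = f x0"
proof -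
  have "killed 0 f = expectation (\<lambda>_. f x0)"
    unfolding killed_def alive_0 using X_0
    by (intro Bochner_Integration.integral_cong) auto
  then show ?thesis by (simp add: prob_space)
qed

lemma killed_mono:
  assumes t: "0 \<le> t" and fg: "\<And>x. x \<subseteq> U \<union> V \<Longrightarrow> f x \<le> g x"
    and B: "\<forall>x\<in>Pow (U \<union> V). \<bar>f x\<bar> \<le> B" "\<forall>x\<in>Pow (U \<union> V). \<bar>g x\<bar> \<le> B"
  shows "killed t f \<le> killed t g"
  unfolding killed_def
proof (rule integral_mono)
  show "integrable M (\<lambda>\<omega>. indicator (alive t) \<omega> * f (X t \<omega>))"
    "integrable M (\<lambda>\<omega>. indicator (alive t) \<omega> * g (X t \<omega>))"
    using t killed_integrable[OF t B(1)] killed_integrable[OF t B(2)] by auto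
  fix \<omega> assume "\<omega> \<in> space M"
  then have "X t \<omega> \<subseteq> U \<union> V"
    using measurable_space[OF X_measurable[OF t]] by auto
  then show "indicator (alive t) \<omega> * f (X t \<omega>) \<le> indicator (alive t) \<omega> * g (X t \<omega>)"
    using fg by (auto simp: indicator_def)
qed

lemma killed_const: "killed t (\<lambda>_. c) = prob (alive t) * c"
  unfolding killed_def by simp

lemma killed_uminus: "killed t (\<lambda>x. - f x) = - killed t f"
  unfolding killed_def by simp

text \<open>Monotonicity in time suffices; no continuity of the survival probability has to be
  shown.\<close>

lemma prob_alive_integrable: "(\<lambda>s. prob (alive s)) integrable_on {x..y}"
proof -
  have "(\<lambda>s. - prob (alive s)) integrable_on {x..y}"
    by (rule integrable_on_mono_on) (auto intro!: mono_onI finite_measure_mono alive_antimono)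
  from integrable_neg[OF this] show ?thesis by simp
qed

context
  fixes T :: "nat \<Rightarrow> real" and R :: "'a set set"
  assumes T: "T 0 = 0" "mono T"
    and R: "finite R" "x0 \<in> R" "\<forall>x\<in>R. \<forall>q\<in>clks. flip U V q x \<in> R"
    and R_sub: "R \<subseteq> Pow (U \<union> V)"
begin

lemma killed_close:
  fixes f :: "'a set \<Rightarrow> real"
  assumes v: "f v = 0" and B: "\<forall>x\<in>Pow (U \<union> V). \<bar>f x\<bar> \<le> B"
  shows "\<bar>killed (T j) f - (\<Sum>x\<in>R. occ T j x * f x)\<bar> \<le> 2 * B * prob {\<omega> \<in> space M. \<exists>i<j. \<not> good_cell (inc T \<omega>) i}"
proof -
  define bad where "bad = {\<omega> \<in> space M. \<exists>i<j. \<not> good_cell (inc T \<omega>) i}"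
  have bad_sets: "bad \<in> sets M" unfolding bad_def by (rule bad_event[OF T])
  have T_ge: "0 \<le> T j" using monoD[OF T(2), of 0 j] T(1) by simp
  have B0: "0 \<le> B" using order_trans[OF abs_ge_zero bspec[OF B, of "{}"]] by simp
  have occ: "(\<Sum>x\<in>R. occ T j x * f x) = expectation (\<lambda>\<omega>. f (chain (inc T \<omega>) j))"
    by (rule chain_expectation[OF T R, symmetric])
  note int = chain_integrable[OF T R, of f j]
  note kint = killed_integrable[OF T_ge B]
  have bound: "\<bar>indicator (alive (T j)) \<omega> * f (X (T j) \<omega>) - f (chain (inc T \<omega>) j)\<bar> \<le> 2 * B * indicator bad \<omega>"
    if w: "\<omega> \<in> space M" for \<omega>
  proof (cases "\<omega> \<in> bad")
    case True
    have "X (T j) \<omega> \<subseteq> U \<union> V"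
      using measurable_space[OF X_measurable[OF T_ge] w] by auto
    then have 1: "\<bar>indicator (alive (T j)) \<omega> * f (X (T j) \<omega>)\<bar> \<le> B"
      using B B0 by (auto simp: indicator_def)
    have "chain (inc T \<omega>) j \<subseteq> U \<union> V"
      using chain_in[OF R(2,3)] R_sub by auto
    then have "\<bar>f (chain (inc T \<omega>) j)\<bar> \<le> B" using B by simp
    with 1 have "\<bar>indicator (alive (T j)) \<omega> * f (X (T j) \<omega>) - f (chain (inc T \<omega>) j)\<bar> \<le> 2 * B" by linarith
    then show ?thesis using True by simp
  next
    case False
    then have "chain (inc T \<omega>) j = (if \<omega> \<in> alive (T j) then X (T j) \<omega> else v)"
      using w by (intro chain_eq_X[OF w T]) (auto simp: bad_def)
    then show ?thesis using v False by (auto simp: indicator_def)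
  qed
  have "\<bar>killed (T j) f - (\<Sum>x\<in>R. occ T j x * f x)\<bar> =
      \<bar>expectation (\<lambda>\<omega>. indicator (alive (T j)) \<omega> * f (X (T j) \<omega>) - f (chain (inc T \<omega>) j))\<bar>"
    unfolding killed_def occ using kint int by (subst Bochner_Integration.integral_diff) auto
  also have "\<dots> \<le> expectation (\<lambda>\<omega>. \<bar>indicator (alive (T j)) \<omega> * f (X (T j) \<omega>) - f (chain (inc T \<omega>) j)\<bar>)"
    by (rule integral_abs_bound)
  also have "\<dots> \<le> expectation (\<lambda>\<omega>. 2 * B * indicator bad \<omega>)"
  proof (rule integral_mono[OF _ _ bound])
    show "integrable M (\<lambda>\<omega>. \<bar>indicator (alive (T j)) \<omega> * f (X (T j) \<omega>) - f (chain (inc T \<omega>) j)\<bar>)"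
      using kint int by (intro integrable_abs Bochner_Integration.integrable_diff)
    show "integrable M (\<lambda>\<omega>. 2 * B * indicator bad \<omega>)"
      using bad_sets by (intro integrable_mult_right integrable_real_indicator) (auto simp: emeasure_eq_measure)
  qed
  also have "\<dots> = 2 * B * prob bad"
    using bad_sets by simp
  finally show ?thesis unfolding bad_def .
qed

text \<open>An instance of the comparison above, for the indicator of the configurations other than
  \<open>v\<close>, with bound 1.\<close>

lemma alive_close:
  "prob (alive (T j)) \<le> prob {\<omega> \<in> space M. chain (inc T \<omega>) j \<noteq> v} +
     2 * prob {\<omega> \<in> space M. \<exists>i<j. \<not> good_cell (inc T \<omega>) i}"
proof -
  let ?f = "\<lambda>x. if x = v then 0 else 1 :: real"
  have T_ge: "0 \<le> T j" using monoD[OF T(2), of 0 j] T(1) by simp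
  have "killed (T j) ?f = killed (T j) (\<lambda>_. 1)"
    unfolding killed_def using T_ge by (intro Bochner_Integration.integral_cong) (auto simp: indicator_def alive_def)
  moreover have "(\<Sum>x\<in>R. occ T j x * ?f x) = prob {\<omega> \<in> space M. chain (inc T \<omega>) j \<noteq> v}"
    unfolding occ_sum_alive[OF T R, symmetric] using R(1)
    by (intro sum.mono_neutral_cong_right) (simp_all split: if_splits)
  moreover have "\<bar>killed (T j) ?f - (\<Sum>x\<in>R. occ T j x * ?f x)\<bar> \<le> 2 * 1 * prob {\<omega> \<in> space M. \<exists>i<j. \<not> good_cell (inc T \<omega>) i}"
    by (rule killed_close) auto
  ultimately show ?thesis by (simp add: killed_const abs_le_iff)
qed

end

text \<open>Index \<open>n\<close> is \<open>a\<close> and index \<open>2 * n\<close> is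
  \<open>b\<close>, so both are grid points. The formula continues past \<open>b\<close> because the
  grids are monotone sequences over all natural numbers.\<close>

definition grid :: "real \<Rightarrow> real \<Rightarrow> nat \<Rightarrow> nat \<Rightarrow> real" where
  "grid a b n j = (if j \<le> n then a * real j / real n else a + (b - a) * (real j - real n) / real n)"

lemma grid_step:
  "0 < n \<Longrightarrow> grid a b n (Suc j) - grid a b n j = (if j < n then a / n else (b - a) / n)"
  by (auto simp: grid_def field_simps not_less less_Suc_eq_le dest: le_antisym)

lemma grid_mono: "0 \<le> a \<Longrightarrow> a \<le> b \<Longrightarrow> 0 < n \<Longrightarrow> mono (grid a b n)"
proof (rule mono_iff_le_Suc[THEN iffD2], intro allI)
  fix j assume "0 \<le> a" "a \<le> b" "0 < n"
  then have "0 \<le> grid a b n (Suc j) - grid a b n j"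
    by (auto simp: grid_step)
  then show "grid a b n j \<le> grid a b n (Suc j)" by simp
qed

lemma grid_mesh: "0 \<le> a \<Longrightarrow> a \<le> b \<Longrightarrow> 0 < n \<Longrightarrow> grid a b n (Suc j) - grid a b n j \<le> b / real n"
  by (auto simp: grid_step divide_right_mono)

text \<open>The bound is the discrete one on a grid that refines \<open>[0, a]\<close> and \<open>[a, b]\<close>; in the limit the
  probability that some cell contains two ticks vanishes.\<close>

theorem dynkin:
  fixes h D :: "real \<Rightarrow> 'a set \<Rightarrow> real"
  assumes ab: "0 \<le> a" "a < b" and l: "0 \<le> l"
    and R: "R \<subseteq> Pow (U \<union> V)" "x0 \<in> R" "\<forall>x\<in>R. \<forall>q\<in>clks. flip U V q x \<in> R"
    and v: "\<And>t. h t v = 0"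
    and cont: "\<And>x. x \<subseteq> U \<union> V \<Longrightarrow> continuous_on {a..b} (\<lambda>t. h t x)"
    and D: "\<And>x t. x \<in> R - {v} \<Longrightarrow> t \<in> {a<..<b} \<Longrightarrow> ((\<lambda>t. h t x) has_real_derivative D t x) (at t)"
    and drift: "\<And>x t. x \<in> R - {v} \<Longrightarrow> t \<in> {a<..<b} \<Longrightarrow>
      D t x + (\<Sum>q\<in>clks. clock_rate rate q t * (h t (flip U V q x) - h t x)) \<le> - l"
  shows "killed b (h b) + l * integral {a..b} (\<lambda>s. prob (alive s)) \<le> killed a (h a)"
proof -
  have fin_R: "finite R" using R(1) finite_UV by (auto intro: finite_subset)
  have "continuous_on {a..b} (\<lambda>t. \<Sum>x\<in>Pow (U \<union> V). \<bar>h t x\<bar>)"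
    using cont by (intro continuous_on_sum continuous_on_rabs) auto
  then obtain B where "\<And>t. t \<in> {a..b} \<Longrightarrow> \<bar>\<Sum>x\<in>Pow (U \<union> V). \<bar>h t x\<bar>\<bar> \<le> B"
    by (rule continuous_on_interval_bound) blast
  moreover have "\<bar>h t x\<bar> \<le> \<bar>\<Sum>x\<in>Pow (U \<union> V). \<bar>h t x\<bar>\<bar>" if "x \<subseteq> U \<union> V" for t x
    using member_le_sum[of x "Pow (U \<union> V)" "\<lambda>x. \<bar>h t x\<bar>"] that finite_UV by (simp add: sum_nonneg)
  ultimately have B: "\<And>x t. x \<subseteq> U \<union> V \<Longrightarrow> t \<in> {a..b} \<Longrightarrow> \<bar>h t x\<bar> \<le> B"
    by (meson order_trans)
  have B0: "0 \<le> B" using order_trans[OF abs_ge_zero B[of "{}" a]] ab by simp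
  have "continuous_on {0..b} (\<lambda>t. \<Sum>q\<in>clks. clock_rate rate q t)"
    by (intro continuous_on_sum continuous_on_subset[OF clock_rate_cont]) auto
  then obtain \<Lambda> where "0 \<le> \<Lambda>" "\<And>t. t \<in> {0..b} \<Longrightarrow> \<bar>\<Sum>q\<in>clks. clock_rate rate q t\<bar> \<le> \<Lambda>"
    by (rule continuous_on_interval_bound) blast
  then have \<Lambda>: "0 \<le> \<Lambda>" "\<And>t. t \<in> {0..b} \<Longrightarrow> (\<Sum>q\<in>clks. clock_rate rate q t) \<le> \<Lambda>"
    using abs_le_D1 by blast+
  let ?S = "integral {a..b} (\<lambda>s. prob (alive s))"
  \<comment> \<open>The price of bad cells: \<open>4 * B\<close> for passing between process and
    chain at \<open>a\<close> and at \<open>b\<close>, and \<open>2 * l * (b - a)\<close> for doing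
    so with the survival probabilities under the integral. The other factor, divided by
    \<open>n\<close>, bounds the probability of a bad cell.\<close>
  define C where "C = (4 * B + 2 * l * (b - a)) * (2 * \<Lambda>\<^sup>2 * b\<^sup>2)"
  \<comment> \<open>Here \<open>e\<close> is the error of the discretized drift per unit of time. It
    is sent to zero after \<open>n\<close> has gone to infinity.\<close>
  have main: "eventually (\<lambda>n. killed b (h b) + l * ?S \<le> killed a (h a) + e * (b - a) + C / real n) sequentially"
    if e: "e > 0" for e
  proof -
    let ?P = "\<lambda>d x. \<forall>t t'. a \<le> t \<and> t < t' \<and> t' \<le> b \<and> t' - t \<le> d \<longrightarrow>
      h t' x - h t x + exp (- (\<Sum>q\<in>clks. integral {t..t'} (clock_rate rate q))) *
        (\<Sum>q\<in>clks. integral {t..t'} (clock_rate rate q) * (h t' (flip U V q x) - h t' x)) \<le> (t' - t) * (e - l)"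
    have "eventually (\<lambda>d. \<forall>x\<in>R - {v}. ?P d x) (at_right 0)"
    proof (intro eventually_ball_finite ballI)
      fix x assume x: "x \<in> R - {v}"
      show "eventually (\<lambda>d. ?P d x) (at_right 0)"
      proof (rule cell_drift[where D = "\<lambda>t. D t x"])
        show "continuous_on {a..b} (\<lambda>t. h t x)"
          using x R(1) by (intro cont) auto
        show "continuous_on {a..b} (\<lambda>t. h t (flip U V q x) - h t x)" if "q \<in> clks" for q
          using x R(1) bspec[OF bspec[OF R(3)], of x q] that by (intro continuous_on_diff cont) auto
        show "continuous_on {a..b} (clock_rate rate q)" if "q \<in> clks" for q
          by (rule continuous_on_subset[OF clock_rate_cont[OF that]]) (use ab in auto)
      qed (use x D drift e ab finite_clks clock_rate_nonneg in auto)
    qed (use fin_R in auto)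
    moreover have "filterlim (\<lambda>n. (b - a) / real n) (at_right 0) sequentially"
    proof (rule tendsto_imp_filterlim_at_right[OF lim_const_over_n])
      show "eventually (\<lambda>n. 0 < (b - a) / real n) sequentially"
        using eventually_gt_at_top[of "0::nat"] by eventually_elim (use ab in simp)
    qed
    ultimately have "eventually (\<lambda>n. \<forall>x\<in>R - {v}. ?P ((b - a) / real n) x) sequentially"
      by (rule eventually_compose_filterlim)
    then show ?thesis
      using eventually_gt_at_top[of "0::nat"]
    proof eventually_elim
      case (elim n)
      have n: "0 < n" by (rule elim(2))
      define T where "T = grid a b n"
      have T: "T 0 = 0" "mono T"
        unfolding T_def using n ab by (auto intro!: grid_mono simp: grid_def)
      have Tn: "T n = a" "T (n + n) = b"
        using n by (auto simp: T_def grid_def)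
      let ?d = "(b - a) / real n"
      have T_step: "T (Suc j) - T j = ?d" if "n \<le> j" for j
        using that n by (auto simp: T_def grid_step)
      have T_ab: "a \<le> T j" "T j < T (Suc j)" "T (Suc j) \<le> b" if "n \<le> j" "j < n + n" for j
      proof -
        show "a \<le> T j" using monoD[OF T(2) that(1)] Tn by simp
        show "T (Suc j) \<le> b" using monoD[OF T(2), of "Suc j" "n + n"] that Tn by simp
        have "0 < ?d" using ab n by simp
        then show "T j < T (Suc j)" using T_step[OF that(1)] by linarith
      qed
      define \<beta> where "\<beta> j = prob {\<omega> \<in> space M. \<exists>i<j. \<not> good_cell (inc T \<omega>) i}" for j
      have \<beta>_mono: "\<beta> j \<le> \<beta> (n + n)" if "j \<le> n + n" for j
        unfolding \<beta>_def
        by (rule finite_measure_mono[OF _ bad_event[OF T]]) (use that less_le_trans in blast)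
      have mean_le: "total_mean T j \<le> \<Lambda> * (b / real n)" if "j < n + n" for j
      proof -
        have Tj: "0 \<le> T j" "T j \<le> T (Suc j)" "T (Suc j) \<le> b"
        proof -
          show "0 \<le> T j" using monoD[OF T(2), of 0 j] T(1) by simp
          show "T j \<le> T (Suc j)" using monoD[OF T(2), of j "Suc j"] by simp
          show "T (Suc j) \<le> b" using monoD[OF T(2), of "Suc j" "n + n"] Tn(2) that by simp
        qed
        have int: "clock_rate rate q integrable_on {T j..T (Suc j)}" if "q \<in> clks" for q
          by (rule integrable_continuous_real, rule continuous_on_subset[OF clock_rate_cont[OF that]]) (use Tj in auto)
        have "total_mean T j = integral {T j..T (Suc j)} (\<lambda>t. \<Sum>q\<in>clks. clock_rate rate q t)"
          unfolding total_mean_def[OF T] mean_def[OF T] using int finite_clks by (intro integral_sum[symmetric]) auto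
        also have "\<dots> \<le> integral {T j..T (Suc j)} (\<lambda>_. \<Lambda>)"
          using int finite_clks \<Lambda> Tj by (intro integral_le integrable_sum) auto
        also have "\<dots> = \<Lambda> * (T (Suc j) - T j)" using Tj by simp
        also have "\<dots> \<le> \<Lambda> * (b / real n)"
          using grid_mesh[of a b n j] ab n \<Lambda>(1) unfolding T_def by (intro mult_left_mono) auto
        finally show ?thesis .
      qed
      have "\<beta> (n + n) \<le> (\<Sum>j<n + n. (total_mean T j)\<^sup>2)"
        unfolding \<beta>_def by (rule prob_bad[OF T])
      also have "\<dots> \<le> (\<Sum>j<n + n. (\<Lambda> * (b / real n))\<^sup>2)"
        using mean_le total_mean_nonneg[OF T] by (intro sum_mono power_mono) auto
      also have "\<dots> = 2 * \<Lambda>\<^sup>2 * b\<^sup>2 / real n"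
        using n by (simp add: power2_eq_square field_simps)
      finally have \<beta>_le: "\<beta> (n + n) \<le> 2 * \<Lambda>\<^sup>2 * b\<^sup>2 / real n" .
      note oc = T fin_R R(2,3)
      let ?E = "\<lambda>j. \<Sum>x\<in>R. occ T j x * h (T j) x"
      let ?A = "\<lambda>j. prob {\<omega> \<in> space M. chain (inc T \<omega>) j \<noteq> v}"
      \<comment> \<open>The parts with \<open>e\<close> and with \<open>l\<close> are separated
        later: the first needs an upper bound on the sum of survival probabilities, the second a
        lower bound.\<close>
      have telescope: "?E (n + m) \<le> ?E n + ?d * (e - l) * (\<Sum>j\<in>{n..<n + m}. ?A j)" if "m \<le> n" for m
        using that
      proof (induction m)
        case (Suc m)
        have "?E (Suc (n + m)) \<le> ?E (n + m) + ?d * (e - l) * ?A (n + m)"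
        proof (rule chain_step_le[OF oc, of "h (T (n + m))" "h (T (Suc (n + m)))", OF v v])
          fix x assume x: "x \<in> R - {v}"
          have "T (Suc (n + m)) - T (n + m) = ?d" by (rule T_step) simp
          then show "h (T (Suc (n + m))) x - h (T (n + m)) x + exp (- total_mean T (n + m)) *
              (\<Sum>q\<in>clks. mean T (n + m) q * (h (T (Suc (n + m))) (flip U V q x) - h (T (Suc (n + m))) x)) \<le> ?d * (e - l)"
            using bspec[OF elim(1) x, rule_format, of "T (n + m)" "T (Suc (n + m))"] T_ab[of "n + m"] Suc.prems
            unfolding total_mean_def[OF T] mean_def[OF T] by simp
        qed
        then show ?case using Suc by (simp add: algebra_simps)
      qed simp
      have "?d * (\<Sum>j\<in>{n..<n + n}. ?A j) \<le> ?d * (\<Sum>j\<in>{n..<n + n}. 1)"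
        using ab by (intro mult_left_mono sum_mono) auto
      also have "\<dots> = b - a" using n by simp
      finally have upper: "?d * (\<Sum>j\<in>{n..<n + n}. ?A j) \<le> b - a" .
      have "?S = (\<Sum>j\<in>{n..<n + n}. integral {T j..T (Suc j)} (\<lambda>s. prob (alive s)))"
        using integral_cells[OF T(2) prob_alive_integrable, of n n] Tn by simp
      also have "\<dots> \<le> (\<Sum>j\<in>{n..<n + n}. ?d * (?A j + 2 * \<beta> (n + n)))"
      proof (rule sum_mono)
        fix j assume j: "j \<in> {n..<n + n}"
        \<comment> \<open>Survival probabilities decrease, so the left endpoint of the cell
          dominates; this bounds the survival sum of the chain from below.\<close>
        have "integral {T j..T (Suc j)} (\<lambda>s. prob (alive s)) \<le> integral {T j..T (Suc j)} (\<lambda>_. prob (alive (T j)))"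
          by (intro integral_le prob_alive_integrable) (auto intro!: finite_measure_mono alive_antimono)
        also have "\<dots> = ?d * prob (alive (T j))"
          using T_step[of j] T_ab(2)[of j] j by simp
        also have "\<dots> \<le> ?d * (?A j + 2 * \<beta> (n + n))"
          using alive_close[OF oc R(1), of j] \<beta>_mono[of j] j ab unfolding \<beta>_def
          by (intro mult_left_mono) auto
        finally show "integral {T j..T (Suc j)} (\<lambda>s. prob (alive s)) \<le> ?d * (?A j + 2 * \<beta> (n + n))" .
      qed
      also have "\<dots> = ?d * (\<Sum>j\<in>{n..<n + n}. ?A j) + 2 * (b - a) * \<beta> (n + n)"
        using n by (simp only: sum_distrib_left[symmetric] sum.distrib) (simp add: field_simps)
      finally have "l * ?S \<le> l * (?d * (\<Sum>j\<in>{n..<n + n}. ?A j) + 2 * (b - a) * \<beta> (n + n))"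
        using l by (rule mult_left_mono)
      then have lower: "l * ?S \<le> ?d * l * (\<Sum>j\<in>{n..<n + n}. ?A j) + 2 * l * (b - a) * \<beta> (n + n)"
        by (simp only: distrib_left mult_ac)
      have ka: "?E n \<le> killed a (h a) + 2 * B * \<beta> (n + n)"
      proof -
        have "\<bar>killed (T n) (h (T n)) - ?E n\<bar> \<le> 2 * B * \<beta> n"
          unfolding \<beta>_def using ab Tn by (intro killed_close[OF oc R(1), of "h (T n)", OF v]) (auto intro!: B)
        moreover have "2 * B * \<beta> n \<le> 2 * B * \<beta> (n + n)"
          using B0 \<beta>_mono by (intro mult_left_mono) auto
        ultimately show ?thesis using Tn by (simp add: abs_le_iff)
      qed
      have kb: "killed b (h b) \<le> ?E (n + n) + 2 * B * \<beta> (n + n)"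
      proof -
        have "\<bar>killed (T (n + n)) (h (T (n + n))) - ?E (n + n)\<bar> \<le> 2 * B * \<beta> (n + n)"
          unfolding \<beta>_def using ab Tn by (intro killed_close[OF oc R(1), of "h (T (n + n))", OF v]) (auto intro!: B)
        then show ?thesis using Tn by (simp add: abs_le_iff)
      qed
      have up: "e * (?d * (\<Sum>j\<in>{n..<n + n}. ?A j)) \<le> e * (b - a)"
        using upper e by (intro mult_left_mono) auto
      have tel: "?E (n + n) \<le> ?E n + e * (?d * (\<Sum>j\<in>{n..<n + n}. ?A j)) - ?d * l * (\<Sum>j\<in>{n..<n + n}. ?A j)"
      proof -
        have "d * (e - l) * Z = e * (d * Z) - d * l * Z" for d Z :: real
          by (simp add: algebra_simps)
        from this[of ?d "\<Sum>j\<in>{n..<n + n}. ?A j"] telescope[of n] show ?thesis by linarith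
      qed
      have "(4 * B + 2 * l * (b - a)) * \<beta> (n + n) \<le> (4 * B + 2 * l * (b - a)) * (2 * \<Lambda>\<^sup>2 * b\<^sup>2 / real n)"
        using \<beta>_le B0 l ab by (intro mult_left_mono) auto
      then have fin: "4 * (B * \<beta> (n + n)) + 2 * l * (b - a) * \<beta> (n + n) \<le> C / real n"
        by (simp add: C_def distrib_right)
      show ?case using ka kb up tel lower fin by linarith
    qed
  qed
  have "killed b (h b) + l * ?S \<le> killed a (h a) + e" if e: "e > 0" for e
  proof -
    define e' where "e' = e / (b - a)"
    have "e' > 0" using e ab by (simp add: e'_def)
    have lim: "(\<lambda>n. killed a (h a) + e' * (b - a) + C / real n) \<longlonglongrightarrow> killed a (h a) + e' * (b - a) + 0"
      by (intro tendsto_add tendsto_const lim_const_over_n)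
    have "killed b (h b) + l * ?S \<le> killed a (h a) + e' * (b - a) + 0"
      by (rule tendsto_lowerbound[OF lim main[OF \<open>e' > 0\<close>]]) simp
    then show ?thesis using ab by (simp add: e'_def)
  qed
  then show ?thesis by (rule field_le_epsilon)
qed

end

section \<open>Exit times of a birth-death chain\<close>

text \<open>For \<open>k\<close> nodes that deactivate at rate 1 and activate at constant rate \<open>x\<close>, \<open>exit_step k j x\<close> is
  the mean time to get from \<open>j\<close> to \<open>j - 1\<close> active nodes, and \<open>exit_time k a x\<close> the mean time to get
  from \<open>a\<close> active nodes to none.\<close>

definition exit_coeff :: "nat \<Rightarrow> nat \<Rightarrow> nat \<Rightarrow> real" where
  "exit_coeff k j i = real (k choose (j + i)) / (real j * real (k choose j))"

definition exit_step :: "nat \<Rightarrow> nat \<Rightarrow> real \<Rightarrow> real" where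
  "exit_step k j x = (\<Sum>i<k. exit_coeff k j i * x ^ i)"

definition exit_time :: "nat \<Rightarrow> nat \<Rightarrow> real \<Rightarrow> real" where
  "exit_time k a x = (\<Sum>j=1..a. exit_step k j x)"

text \<open>The coefficient of \<open>x ^ i\<close> in \<open>exit_time k a x\<close>, after
  exchanging the two sums.\<close>

definition exit_tail_coeff :: "nat \<Rightarrow> nat \<Rightarrow> nat \<Rightarrow> real" where
  "exit_tail_coeff k a i = (\<Sum>j=1..a. exit_coeff k j i)"

lemma exit_coeff_nonneg: "0 \<le> exit_coeff k j i"
  by (simp add: exit_coeff_def)

lemma exit_tail_coeff_nonneg: "0 \<le> exit_tail_coeff k a i"
  by (simp add: exit_tail_coeff_def sum_nonneg exit_coeff_nonneg)

lemma exit_step_nonneg: "0 \<le> x \<Longrightarrow> 0 \<le> exit_step k j x"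
  by (simp add: exit_step_def sum_nonneg exit_coeff_nonneg)

lemma exit_step_mono: "0 \<le> x \<Longrightarrow> x \<le> y \<Longrightarrow> exit_step k j x \<le> exit_step k j y"
  unfolding exit_step_def by (intro sum_mono mult_left_mono power_mono exit_coeff_nonneg)

lemma Suc_times_choose: "real (Suc j) * real (k choose Suc j) = (real k - real j) * real (k choose j)" if "j \<le> k"
proof -
  have "Suc j * (k choose Suc j) = (k - j) * (k choose j)"
  proof (cases k)
    case (Suc n)
    then show ?thesis
      using Suc_times_binomial[of j n] binomial_absorb_comp[of k j] by simp
  qed simp
  from arg_cong[OF this, of real] show ?thesis
    using that by (simp add: of_nat_diff del: of_nat_Suc mult_Suc)
qed

text \<open>First-step analysis: at \<open>j\<close> active nodes, deactivations have rate
  \<open>j\<close> and activations rate \<open>(k - j) * x\<close>, and every activation has to be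
  undone before level \<open>j - 1\<close> is reached. The closed form solves this because
  \<open>(j + 1) * (k choose (j + 1)) = (k - j) * (k choose j)\<close>; for \<open>j = k\<close> the
  last term vanishes.\<close>

lemma exit_step_rec:
  assumes j: "1 \<le> j" "j \<le> k"
  shows "real j * exit_step k j x = 1 + (real k - real j) * x * exit_step k (Suc j) x"
proof -
  obtain n where n: "k = Suc n" using j by (cases k) auto
  have c: "real j * exit_coeff k j i = real (k choose (j + i)) / real (k choose j)" for i
    using j by (simp add: exit_coeff_def)
  have c': "(real k - real j) * exit_coeff k (Suc j) i = real (k choose (Suc j + i)) / real (k choose j)" for i
  proof (cases "j = k")
    case False
    then have "real k - real j \<noteq> 0" using j by simp
    then show ?thesis
      unfolding exit_coeff_def Suc_times_choose[OF j(2)] by simp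
  qed simp
  have "real j * exit_step k j x = (\<Sum>i<Suc n. real (k choose (j + i)) / real (k choose j) * x ^ i)"
    unfolding exit_step_def sum_distrib_left n[symmetric] mult.assoc[symmetric] c ..
  also have "\<dots> = 1 + (\<Sum>i<n. real (k choose (Suc j + i)) / real (k choose j) * x ^ Suc i)"
    unfolding sum.lessThan_Suc_shift using j by simp
  \<comment> \<open>The added top term is zero, since \<open>k choose (k + j)\<close> vanishes for
    \<open>j \<ge> 1\<close>.\<close>
  also have "(\<Sum>i<n. real (k choose (Suc j + i)) / real (k choose j) * x ^ Suc i) =
      (\<Sum>i<Suc n. real (k choose (Suc j + i)) / real (k choose j) * x ^ Suc i)"
  proof -
    have "k choose (Suc j + n) = 0" using j n by (intro binomial_eq_0) simp
    then show ?thesis by simp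
  qed
  also have "\<dots> = (\<Sum>i<k. (real k - real j) * exit_coeff k (Suc j) i * x ^ Suc i)"
    unfolding c' n[symmetric] ..
  also have "\<dots> = (real k - real j) * x * exit_step k (Suc j) x"
    by (simp add: exit_step_def sum_distrib_left mult_ac)
  finally show ?thesis .
qed

lemma exit_time_0 [simp]: "exit_time k 0 x = 0"
  by (simp add: exit_time_def)

lemma exit_time_Suc: "exit_time k (Suc a) x = exit_time k a x + exit_step k (Suc a) x"
  by (simp add: exit_time_def)

lemma exit_time_pred: "1 \<le> a \<Longrightarrow> exit_time k (a - 1) x - exit_time k a x = - exit_step k a x"
  using exit_time_Suc[of k "a - 1" x] by simp

lemma exit_time_1: "exit_time k 1 x = exit_step k 1 x"
  by (simp add: exit_time_def)

lemma exit_time_nonneg: "0 \<le> x \<Longrightarrow> 0 \<le> exit_time k a x"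
  by (simp add: exit_time_def sum_nonneg exit_step_nonneg)

lemma exit_time_mono: "0 \<le> x \<Longrightarrow> x \<le> y \<Longrightarrow> exit_time k a x \<le> exit_time k a y"
  unfolding exit_time_def by (intro sum_mono exit_step_mono)

lemma exit_time_mono_level: "0 \<le> x \<Longrightarrow> a \<le> b \<Longrightarrow> exit_time k a x \<le> exit_time k b x"
  unfolding exit_time_def by (intro sum_mono2 exit_step_nonneg) auto

text \<open>Only the step from one active node to none contributes to \<open>x ^ (k - 1)\<close>,
  since \<open>k choose (j + k - 1)\<close> vanishes for \<open>j > 1\<close>. Hence the leading
  term is the same for all starting levels.\<close>

lemma exit_time_expand:
  assumes "1 \<le> a" "1 \<le> k"
  shows "exit_time k a x = x ^ (k - 1) / real k + (\<Sum>i<k - 1. exit_tail_coeff k a i * x ^ i)"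
proof -
  obtain n where n: "k = Suc n" using assms by (cases k) auto
  have "exit_tail_coeff k a n = (\<Sum>j=1..a. if j = 1 then 1 / real k else 0)"
    unfolding exit_tail_coeff_def
    by (intro sum.cong) (auto simp: exit_coeff_def n)
  also have "\<dots> = 1 / real k" using assms by simp
  finally have top: "exit_tail_coeff k a n = 1 / real k" .
  have "exit_time k a x = (\<Sum>i<k. \<Sum>j=1..a. exit_coeff k j i * x ^ i)"
    unfolding exit_time_def exit_step_def by (rule sum.swap)
  also have "\<dots> = (\<Sum>i<k. exit_tail_coeff k a i * x ^ i)"
    by (simp add: exit_tail_coeff_def sum_distrib_right)
  also have "\<dots> = x ^ (k - 1) / real k + (\<Sum>i<k - 1. exit_tail_coeff k a i * x ^ i)"
    using top by (simp add: n)
  finally show ?thesis .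
qed

lemma exit_time_ge: "1 \<le> a \<Longrightarrow> 1 \<le> k \<Longrightarrow> 0 \<le> x \<Longrightarrow> x ^ (k - 1) / real k \<le> exit_time k a x"
  using exit_time_expand[of a k x] exit_tail_coeff_nonneg by (simp add: sum_nonneg)

section \<open>Growth of exit times and their derivatives\<close>

definition exit_time_deriv :: "nat \<Rightarrow> nat \<Rightarrow> real \<Rightarrow> real" where
  "exit_time_deriv k a x = real (k - 1) * x ^ (k - 2) / real k
     + (\<Sum>i<k - 1. exit_tail_coeff k a i * (real i * x ^ (i - 1)))"

lemma has_derivative_exit_time:
  assumes "1 \<le> a" "2 \<le> k"
  shows "(exit_time k a has_real_derivative exit_time_deriv k a x) (at x)"
proof -
  have eq: "exit_time k a = (\<lambda>x. x ^ (k - 1) / real k + (\<Sum>i<k - 1. exit_tail_coeff k a i * x ^ i))"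
    using exit_time_expand assms by (intro ext) auto
  have pow: "((\<lambda>x. x ^ n) has_real_derivative real n * x ^ (n - 1)) (at x)" for n
    using DERIV_pow[of n x] by simp
  have "((\<lambda>x. x ^ (k - 1) / real k) has_real_derivative real (k - 1) * x ^ (k - 2) / real k) (at x)"
    using DERIV_cdivide[OF pow[of "k - 1"], of "real k"] by (simp add: numeral_2_eq_2)
  then show ?thesis
    unfolding eq exit_time_deriv_def by (intro DERIV_add DERIV_sum DERIV_cmult pow)
qed

lemma exit_time_deriv_ge:
  "0 \<le> x \<Longrightarrow> real (k - 1) * x ^ (k - 2) / real k \<le> exit_time_deriv k a x"
  unfolding exit_time_deriv_def using exit_tail_coeff_nonneg by (simp add: sum_nonneg)

lemma tendsto_power_div_at_top:
  assumes "i < n" shows "((\<lambda>x::real. x ^ i / x ^ n) \<longlongrightarrow> 0) at_top"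
proof -
  have "((\<lambda>x::real. inverse (x ^ (n - i))) \<longlongrightarrow> 0) at_top"
    using assms by (intro tendsto_inverse_0_at_top filterlim_pow_at_top filterlim_ident) auto
  then show ?thesis
  proof (rule Lim_transform_eventually)
    show "eventually (\<lambda>x::real. inverse (x ^ (n - i)) = x ^ i / x ^ n) at_top"
      using eventually_gt_at_top[of 0]
      by eventually_elim (use assms in \<open>simp add: power_diff field_simps\<close>)
  qed
qed

lemma exit_time_asymp:
  assumes "1 \<le> a" "2 \<le> k"
  shows "((\<lambda>x. exit_time k a x / x ^ (k - 1)) \<longlongrightarrow> 1 / real k) at_top"
proof -
  have "((\<lambda>x. 1 / real k + (\<Sum>i<k - 1. exit_tail_coeff k a i * (x ^ i / x ^ (k - 1)))) \<longlongrightarrow>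
      1 / real k + (\<Sum>i<k - 1. exit_tail_coeff k a i * 0)) at_top"
    by (intro tendsto_intros tendsto_power_div_at_top) auto
  then have "((\<lambda>x. 1 / real k + (\<Sum>i<k - 1. exit_tail_coeff k a i * (x ^ i / x ^ (k - 1)))) \<longlongrightarrow> 1 / real k) at_top"
    by simp
  then show ?thesis
  proof (rule Lim_transform_eventually)
    show "eventually (\<lambda>x. 1 / real k + (\<Sum>i<k - 1. exit_tail_coeff k a i * (x ^ i / x ^ (k - 1))) =
        exit_time k a x / x ^ (k - 1)) at_top"
      using eventually_gt_at_top[of 0]
    proof eventually_elim
      case (elim x)
      then show ?case
        using assms by (simp add: exit_time_expand add_divide_distrib sum_divide_distrib)
    qed
  qed
qed

text \<open>The lower powers are negligible against \<open>x ^ (k - 2)\<close>, uniformly over the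
  finitely many levels. Since \<open>k - 1 \<ge> 1\<close>, the error may carry that factor too and
  so becomes a perturbation of \<open>1 / k\<close>.\<close>

lemma exit_time_deriv_le:
  assumes "2 \<le> k" "e > 0"
  shows "eventually (\<lambda>x. \<forall>a\<in>{1..k}. exit_time_deriv k a x \<le> real (k - 1) * x ^ (k - 2) * (1 / real k + e)) at_top"
proof (intro eventually_ball_finite ballI)
  fix a
  have "((\<lambda>x. \<Sum>i<k - 1. exit_tail_coeff k a i * real i * (x ^ (i - 1) / x ^ (k - 2))) \<longlongrightarrow>
      (\<Sum>i<k - 1. exit_tail_coeff k a i * real i * 0)) at_top"
  proof (intro tendsto_sum)
    fix i assume "i \<in> {..<k - 1}"
    then show "((\<lambda>x. exit_tail_coeff k a i * real i * (x ^ (i - 1) / x ^ (k - 2))) \<longlongrightarrow> exit_tail_coeff k a i * real i * 0) at_top"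
    proof (cases "i = 0")
      case False
      then have "i - 1 < k - 2" using \<open>i \<in> {..<k - 1}\<close> by simp
      then show ?thesis by (intro tendsto_mult tendsto_const tendsto_power_div_at_top)
    qed simp
  qed
  then have "eventually (\<lambda>x. (\<Sum>i<k - 1. exit_tail_coeff k a i * real i * (x ^ (i - 1) / x ^ (k - 2))) < e) at_top"
    using assms(2) by (intro order_tendstoD) auto
  then show "eventually (\<lambda>x. exit_time_deriv k a x \<le> real (k - 1) * x ^ (k - 2) * (1 / real k + e)) at_top"
    using eventually_gt_at_top[of 0]
  proof eventually_elim
    case (elim x)
    have "(\<Sum>i<k - 1. exit_tail_coeff k a i * (real i * x ^ (i - 1))) =
        x ^ (k - 2) * (\<Sum>i<k - 1. exit_tail_coeff k a i * real i * (x ^ (i - 1) / x ^ (k - 2)))"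
      using elim(2) by (simp add: sum_distrib_left mult.assoc)
    also have "\<dots> \<le> x ^ (k - 2) * e"
      using elim by (intro mult_left_mono) auto
    also have "\<dots> \<le> real (k - 1) * (x ^ (k - 2) * e)"
      using mult_right_mono[of 1 "real (k - 1)" "x ^ (k - 2) * e"] elim(2) assms by simp
    finally show ?case
      unfolding exit_time_deriv_def by (simp add: algebra_simps)
  qed
qed simp

section \<open>Sub- and supersolutions on complete bipartite graphs\<close>

locale complete_bipartite =
  fixes U V :: "'a set" and lam mu :: "real \<Rightarrow> real"
    and M :: "'w measure" and N :: "'a clock \<Rightarrow> real \<Rightarrow> 'w \<Rightarrow> nat" and X :: "real \<Rightarrow> 'w \<Rightarrow> 'a set"
  assumes finite_U: "finite U" and finite_V: "finite V" and nonempty: "U \<noteq> {}" "V \<noteq> {}"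
    and disjoint: "U \<inter> V = {}"
    and process: "hard_core_process U V (\<lambda>i t. if i \<in> U then lam t else mu t) U M N X"
    and lam_cont: "continuous_on {0..} lam" and mu_cont: "continuous_on {0..} mu"
    and lam_nonneg: "\<And>t. 0 \<le> t \<Longrightarrow> 0 \<le> lam t" and mu_nonneg: "\<And>t. 0 \<le> t \<Longrightarrow> 0 \<le> mu t"
begin

abbreviation "rate \<equiv> \<lambda>i t. if i \<in> U then lam t else mu t"

sublocale hard_core U V rate U V M N X
proof
  show "U \<noteq> V" using nonempty disjoint by auto
  fix i
  show "continuous_on {0..} (rate i)" if "i \<in> U \<union> V"
    using lam_cont mu_cont by (cases "i \<in> U") simp_all
  show "0 \<le> rate i t" if "i \<in> U \<union> V" "0 \<le> t" for t
    using lam_nonneg mu_nonneg that by simp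
qed (use finite_U finite_V nonempty process in auto)

text \<open>The empty configuration belongs to the first branch: its value is \<open>f 0\<close>,
  and \<open>g\<close> is evaluated only from 1 on when \<open>x\<close> is a finite set.\<close>

definition lift :: "(nat \<Rightarrow> real) \<Rightarrow> (nat \<Rightarrow> real) \<Rightarrow> 'a set \<Rightarrow> real" where
  "lift f g x = (if x \<inter> V = {} then f (card x) else g (card x))"

text \<open>The backward generator at time \<open>t\<close>; ticks without effect contribute
  zero.\<close>

definition gen :: "real \<Rightarrow> ('a set \<Rightarrow> real) \<Rightarrow> 'a set \<Rightarrow> real" where
  "gen t \<phi> x = (\<Sum>q\<in>clks. clock_rate rate q t * (\<phi> (flip U V q x) - \<phi> x))"

abbreviation "states \<equiv> Pow U \<union> Pow V"

text \<open>A node cannot activate while the other side is active, so drift conditions are needed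
  only for configurations contained in one side.\<close>

lemma flip_states: "\<forall>x\<in>states. \<forall>q\<in>clks. flip U V q x \<in> states"
proof (intro ballI)
  fix x q assume x: "x \<in> states" and q: "q \<in> clks"
  show "flip U V q x \<in> states"
  proof (cases q)
    case (Activation i)
    then show ?thesis
      using x q disjoint by (auto simp: clocks_def neighbors_def)
  qed (use x in auto)
qed

lemma gen_split: "gen t \<phi> x =
    (\<Sum>i\<in>U. \<phi> (x - {i}) - \<phi> x) + (\<Sum>i\<in>V. \<phi> (x - {i}) - \<phi> x)
    + lam t * (\<Sum>i\<in>U. \<phi> (flip U V (Activation i) x) - \<phi> x)
    + mu t * (\<Sum>i\<in>V. \<phi> (flip U V (Activation i) x) - \<phi> x)"
proof -
  let ?F = "\<lambda>q. clock_rate rate q t * (\<phi> (flip U V q x) - \<phi> x)"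
  have "gen t \<phi> x = sum ?F (Deactivation ` (U \<union> V)) + sum ?F (Activation ` (U \<union> V))"
    unfolding gen_def clocks_def using finite_U finite_V by (intro sum.union_disjoint) auto
  also have "sum ?F (Deactivation ` (U \<union> V)) = (\<Sum>i\<in>U \<union> V. ?F (Deactivation i))"
    by (subst sum.reindex) (auto simp: inj_on_def)
  also have "\<dots> = (\<Sum>i\<in>U. \<phi> (x - {i}) - \<phi> x) + (\<Sum>i\<in>V. \<phi> (x - {i}) - \<phi> x)"
    using finite_U finite_V disjoint by (subst sum.union_disjoint) auto
  also have "sum ?F (Activation ` (U \<union> V)) = (\<Sum>i\<in>U \<union> V. ?F (Activation i))"
    by (subst sum.reindex) (auto simp: inj_on_def)
  also have "\<dots> = (\<Sum>i\<in>U. ?F (Activation i)) + (\<Sum>i\<in>V. ?F (Activation i))"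
    using finite_U finite_V disjoint by (subst sum.union_disjoint) auto
  also have "(\<Sum>i\<in>U. ?F (Activation i)) = lam t * (\<Sum>i\<in>U. \<phi> (flip U V (Activation i) x) - \<phi> x)"
    unfolding sum_distrib_left by (intro sum.cong) auto
  also have "(\<Sum>i\<in>V. ?F (Activation i)) = mu t * (\<Sum>i\<in>V. \<phi> (flip U V (Activation i) x) - \<phi> x)"
    unfolding sum_distrib_left using disjoint by (intro sum.cong) auto
  finally show ?thesis by simp
qed

lemma sum_if_mem:
  assumes "finite A" "x \<subseteq> A"
  shows "(\<Sum>i\<in>A. if i \<in> x then c else d) = real (card x) * c + (real (card A) - real (card x)) * d"
proof -
  have "(\<Sum>i\<in>A. if i \<in> x then c else d) = (\<Sum>i\<in>x. c) + (\<Sum>i\<in>A - x. d)"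
    using assms by (subst sum.If_cases) (auto simp: Int_absorb1 Diff_eq)
  moreover have "real (card (A - x)) = real (card A) - real (card x)"
    using assms card_mono[OF assms] by (simp add: card_Diff_subset finite_subset of_nat_diff)
  ultimately show ?thesis by simp
qed

lemma card_bounds:
  assumes "finite A" "x \<subseteq> A" "x \<noteq> {}"
  shows "1 \<le> card x" "card x \<le> card A"
proof -
  have "finite x" using assms(1,2) finite_subset by blast
  then show "1 \<le> card x" using assms(3) by (simp add: Suc_le_eq card_gt_0_iff)
  show "card x \<le> card A" by (rule card_mono) (use assms in auto)
qed

text \<open>An active node of \<open>U\<close> blocks all of \<open>V\<close>, so the number of
  active nodes moves as a birth-death chain.\<close>

lemma gen_lift_U:
  assumes x: "x \<subseteq> U" "x \<noteq> {}"
  shows "gen t (lift f g) x = real (card x) * (f (card x - 1) - f (card x))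
    + (real (card U) - real (card x)) * lam t * (f (card x + 1) - f (card x))"
proof -
  have fin: "finite x" using x finite_U finite_subset by auto
  have xV: "x \<inter> V = {}" using x disjoint by auto
  have 1: "(\<Sum>i\<in>U. lift f g (x - {i}) - lift f g x) = (\<Sum>i\<in>U. if i \<in> x then f (card x - 1) - f (card x) else 0)"
    using xV fin by (intro sum.cong) (auto simp: lift_def Diff_Int_distrib2)
  have 2: "(\<Sum>i\<in>V. lift f g (x - {i}) - lift f g x) = 0"
  proof (intro sum.neutral ballI)
    fix i assume "i \<in> V"
    then have "x - {i} = x" using xV by auto
    then show "lift f g (x - {i}) - lift f g x = 0" by simp
  qed
  have nn: "\<not> (\<exists>j\<in>x. neighbors U V i j)" if "i \<in> U" for i
    using x that disjoint by (auto simp: neighbors_def)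
  have 3: "(\<Sum>i\<in>U. lift f g (flip U V (Activation i) x) - lift f g x) =
      (\<Sum>i\<in>U. if i \<in> x then 0 else f (card x + 1) - f (card x))"
  proof (intro sum.cong refl)
    fix i assume i: "i \<in> U"
    then have "flip U V (Activation i) x = insert i x" using nn by simp
    moreover have "insert i x \<inter> V = {}" using i xV disjoint by auto
    ultimately show "lift f g (flip U V (Activation i) x) - lift f g x = (if i \<in> x then 0 else f (card x + 1) - f (card x))"
      using xV fin by (auto simp: lift_def insert_absorb)
  qed
  have 4: "(\<Sum>i\<in>V. lift f g (flip U V (Activation i) x) - lift f g x) = 0"
  proof (intro sum.neutral ballI)
    fix i assume "i \<in> V"
    then have "\<exists>j\<in>x. neighbors U V i j" using x by (auto simp: neighbors_def)
    then show "lift f g (flip U V (Activation i) x) - lift f g x = 0" by simp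
  qed
  show ?thesis
    unfolding gen_split 1 2 3 4 using x finite_U by (simp add: sum_if_mem)
qed

lemma gen_lift_empty:
  "gen t (lift f g) {} = real (card U) * lam t * (f 1 - f 0) + real (card V) * mu t * (g 1 - f 0)"
proof -
  have 1: "(\<Sum>i\<in>U. lift f g (flip U V (Activation i) {}) - lift f g {}) = (\<Sum>i\<in>U. f 1 - f 0)"
    using disjoint by (intro sum.cong) (auto simp: lift_def)
  have 2: "(\<Sum>i\<in>V. lift f g (flip U V (Activation i) {}) - lift f g {}) = (\<Sum>i\<in>V. g 1 - f 0)"
    by (intro sum.cong) (auto simp: lift_def)
  show ?thesis unfolding gen_split 1 2 by simp
qed

text \<open>The case distinction is the deactivation of the last active node, which leads to the
  empty configuration and hence to \<open>f 0\<close>.\<close>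

lemma gen_lift_V:
  assumes x: "x \<subseteq> V" "x \<noteq> {}"
  shows "gen t (lift f g) x = real (card x) * ((if card x = 1 then f 0 else g (card x - 1)) - g (card x))
    + (real (card V) - real (card x)) * mu t * (g (card x + 1) - g (card x))"
proof -
  have fin: "finite x" using x finite_V finite_subset by auto
  have lx: "lift f g x = g (card x)" using x by (auto simp: lift_def)
  have 1: "(\<Sum>i\<in>V. lift f g (x - {i}) - lift f g x) =
      (\<Sum>i\<in>V. if i \<in> x then (if card x = 1 then f 0 else g (card x - 1)) - g (card x) else 0)"
  proof (intro sum.cong refl)
    fix i
    show "lift f g (x - {i}) - lift f g x =
      (if i \<in> x then (if card x = 1 then f 0 else g (card x - 1)) - g (card x) else 0)"
    proof (cases "i \<in> x")
      case True
      have c: "card (x - {i}) = card x - 1" using True fin by simp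
      have "(x - {i}) \<inter> V = {} \<longleftrightarrow> card x = 1"
      proof -
        have "(x - {i}) \<inter> V = x - {i}" using x by auto
        moreover have "x - {i} = {} \<longleftrightarrow> card (x - {i}) = 0" using fin by simp
        moreover have "card x \<ge> 1" using fin x by (simp add: Suc_le_eq card_gt_0_iff)
        ultimately show ?thesis unfolding c by auto
      qed
      then show ?thesis using True c lx by (simp add: lift_def[of f g "x - {i}"])
    qed simp
  qed
  have 2: "(\<Sum>i\<in>U. lift f g (x - {i}) - lift f g x) = 0"
  proof (intro sum.neutral ballI)
    fix i assume "i \<in> U"
    then have "x - {i} = x" using x disjoint by auto
    then show "lift f g (x - {i}) - lift f g x = 0" by simp
  qed
  have 3: "(\<Sum>i\<in>V. lift f g (flip U V (Activation i) x) - lift f g x) =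
      (\<Sum>i\<in>V. if i \<in> x then 0 else g (card x + 1) - g (card x))"
  proof (intro sum.cong refl)
    fix i assume i: "i \<in> V"
    then have "\<not> (\<exists>j\<in>x. neighbors U V i j)" using x disjoint by (auto simp: neighbors_def)
    then have "flip U V (Activation i) x = insert i x" by simp
    moreover have "insert i x \<inter> V \<noteq> {}" using i by auto
    ultimately show "lift f g (flip U V (Activation i) x) - lift f g x = (if i \<in> x then 0 else g (card x + 1) - g (card x))"
      using lx fin by (auto simp: lift_def[of f g "insert i x"] insert_absorb)
  qed
  have 4: "(\<Sum>i\<in>U. lift f g (flip U V (Activation i) x) - lift f g x) = 0"
  proof (intro sum.neutral ballI)
    fix i assume "i \<in> U"
    then have "\<exists>j\<in>x. neighbors U V i j" using x by (auto simp: neighbors_def)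
    then show "lift f g (flip U V (Activation i) x) - lift f g x = 0" by simp
  qed
  show ?thesis
    unfolding gen_split 1 2 3 4 using x finite_V by (simp add: sum_if_mem)
qed

text \<open>\<open>lift (\<lambda>a. \<Phi> t * exit_time (card U) a (low t)) (\<lambda>_. 0)\<close> is a subsolution of the backward equation.\<close>

lemma prob_alive_lower:
  assumes s: "0 < s"
    and \<Phi>_cont: "continuous_on {0..s} \<Phi>" and \<Phi>_pos: "\<And>t. t \<in> {0..s} \<Longrightarrow> 0 < \<Phi> t"
    and \<Phi>: "\<And>t. t \<in> {0<..<s} \<Longrightarrow> (\<Phi> has_real_derivative \<Phi>' t) (at t)"
    and l_cont: "continuous_on {0..s} low" and l_nonneg: "\<And>t. t \<in> {0..s} \<Longrightarrow> 0 \<le> low t"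
    and l: "\<And>t. t \<in> {0<..<s} \<Longrightarrow> (low has_real_derivative low' t) (at t)"
    and l_le: "\<And>t. t \<in> {0<..<s} \<Longrightarrow> low t \<le> lam t"
    and k: "2 \<le> card U"
    and sub: "\<And>t a. t \<in> {0<..<s} \<Longrightarrow> a \<in> {1..card U} \<Longrightarrow>
      \<Phi> t \<le> \<Phi>' t * exit_time (card U) a (low t) + \<Phi> t * (exit_time_deriv (card U) a (low t) * low' t)"
  shows "\<Phi> 0 * exit_time (card U) (card U) (low 0) \<le> prob (alive s) * (\<Phi> s * exit_time (card U) (card U) (low s))"
proof -
  let ?k = "card U"
  define h where "h t = lift (\<lambda>a. \<Phi> t * exit_time ?k a (low t)) (\<lambda>_. 0)" for t
  define D where "D t x = (if x \<inter> V = {} \<and> x \<noteq> {} then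
      \<Phi>' t * exit_time ?k (card x) (low t) + \<Phi> t * (exit_time_deriv ?k (card x) (low t) * low' t) else 0)" for t x
  have h0: "h t x = 0" if "x \<inter> V \<noteq> {} \<or> x = {}" for t x
    using that by (auto simp: h_def lift_def)
  have exit_deriv: "((\<lambda>t. exit_time ?k a (low t)) has_real_derivative exit_time_deriv ?k a (low t) * low' t) (at t)"
    if "t \<in> {0<..<s}" "1 \<le> a" for t a
    using that k by (intro DERIV_chain2[OF has_derivative_exit_time l])
  have exit_cont: "continuous_on {0..s} (\<lambda>t. exit_time ?k a (low t))" for a
    unfolding exit_time_def exit_step_def using l_cont by (intro continuous_intros)
  \<comment> \<open>The Dynkin inequality for \<open>- h\<close> with \<open>l = 0\<close>: the
    survival expectation of the subsolution \<open>h\<close> does not decrease from time 0 to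
    \<open>s\<close>.\<close>
  have "killed s (\<lambda>x. - h s x) + 0 * integral {0..s} (\<lambda>s. prob (alive s)) \<le> killed 0 (\<lambda>x. - h 0 x)"
  proof (rule dynkin[where h = "\<lambda>t x. - h t x" and D = "\<lambda>t x. - D t x" and R = states])
    show "\<forall>x\<in>states. \<forall>q\<in>clks. flip U V q x \<in> states" by (rule flip_states)
    show "- h t V = 0" for t using h0[of V] nonempty by simp
    show "continuous_on {0..s} (\<lambda>t. - h t x)" for x
      unfolding h_def lift_def using exit_cont \<Phi>_cont
      by (cases "x \<inter> V = {}") (auto intro!: continuous_intros)
    fix x t assume x: "x \<in> states - {V}" and t: "t \<in> {0<..<s}"
    show "((\<lambda>t. - h t x) has_real_derivative - D t x) (at t)"
    proof (cases "x \<inter> V = {} \<and> x \<noteq> {}")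
      case True
      then have xU: "x \<subseteq> U" using x by auto
      then have x1: "1 \<le> card x" using True card_bounds(1)[OF finite_U] by auto
      have "((\<lambda>t. \<Phi> t * exit_time ?k (card x) (low t)) has_real_derivative D t x) (at t)"
        using True DERIV_mult[OF \<Phi>[OF t] exit_deriv[OF t x1]] by (simp add: D_def algebra_simps)
      then show ?thesis
        using True by (auto simp: h_def lift_def intro!: DERIV_minus)
    next
      case False
      then have "(\<lambda>t. - h t x) = (\<lambda>_. 0)" using h0[of x] by auto
      then show ?thesis using False by (auto simp: D_def)
    qed
    have lam0: "0 \<le> lam t" and l0: "0 \<le> low t" using lam_nonneg l_nonneg t by auto
    have "0 \<le> D t x + gen t (h t) x"
    proof (cases "x \<subseteq> U")
      case True
      show ?thesis
      proof (cases "x = {}")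
        case True
        \<comment> \<open>The empty configuration and those in \<open>V\<close> have value 0. The
          only jump from them to a positive value is the return to \<open>U\<close>, which has the
          favourable sign.\<close>
        have "0 \<le> exit_step ?k 1 (low t)" using l0 by (rule exit_step_nonneg)
        then show ?thesis
          using True lam0 \<Phi>_pos[of t] t unfolding h_def gen_lift_empty[of t] True
          by (simp add: D_def exit_time_1[unfolded One_nat_def] less_imp_le)
      next
        case False
        let ?a = "card x"
        have a: "1 \<le> ?a" "?a \<le> ?k"
          using card_bounds[OF finite_U True False] by auto
        have D: "\<Phi> t \<le> D t x"
          using False True disjoint sub[OF t, of ?a] a by (auto simp: D_def)
        have "gen t (h t) x = \<Phi> t * ((real ?k - real ?a) * lam t * exit_step ?k (Suc ?a) (low t) - real ?a * exit_step ?k ?a (low t))"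
          unfolding h_def gen_lift_U[OF True False]
          using exit_time_pred[OF a(1), of ?k "low t"] exit_time_Suc[of ?k ?a "low t"]
          by (simp add: right_diff_distrib[symmetric] mult.left_commute)
        \<comment> \<open>Passing to the smaller rate \<open>low t\<close> lowers only the birth
          term, because \<open>exit_step\<close> is non-negative. The recursion then holds exactly
          at the rate \<open>low t\<close>.\<close>
        also have "\<dots> \<ge> \<Phi> t * ((real ?k - real ?a) * low t * exit_step ?k (Suc ?a) (low t) - real ?a * exit_step ?k ?a (low t))"
          using \<Phi>_pos[of t] t a l_le[OF t] exit_step_nonneg[OF l0]
          by (intro mult_left_mono diff_right_mono mult_right_mono) auto
        finally have "- \<Phi> t \<le> gen t (h t) x"
          using exit_step_rec[OF a, of "low t"] by simp
        then show ?thesis using D by simp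
      qed
    next
      case False
      then have xV: "x \<subseteq> V" "x \<noteq> {}" using x by auto
      have "gen t (h t) x = 0"
        unfolding h_def gen_lift_V[OF xV] by simp
      then show ?thesis using xV by (auto simp: D_def)
    qed
    moreover have "(\<Sum>q\<in>clks. clock_rate rate q t * (- h t (flip U V q x) - - h t x)) = - gen t (h t) x"
      unfolding gen_def by (simp add: sum_negf[symmetric] algebra_simps)
    ultimately show "- D t x + (\<Sum>q\<in>clks. clock_rate rate q t * (- h t (flip U V q x) - - h t x)) \<le> - 0"
      by simp
  qed (use s in auto)
  then have "h 0 U \<le> killed s (h s)"
    by (simp add: killed_uminus killed_0)
  also have "killed s (h s) \<le> killed s (\<lambda>_. \<Phi> s * exit_time ?k ?k (low s))"
  proof (rule killed_mono)
    let ?B = "\<Phi> s * exit_time ?k ?k (low s)"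
    have pos: "0 < \<Phi> s" "0 \<le> low s" using s \<Phi>_pos l_nonneg by auto
    have h: "0 \<le> h s x \<and> h s x \<le> ?B" if "x \<subseteq> U \<union> V" for x
    proof (cases "x \<inter> V = {}")
      case True
      then have "card x \<le> ?k" using that finite_U by (intro card_mono) auto
      then show ?thesis
        using True pos by (auto simp: h_def lift_def intro!: mult_left_mono exit_time_mono_level mult_nonneg_nonneg exit_time_nonneg)
    next
      case False
      then show ?thesis using h0[of x s] pos by (auto intro!: mult_nonneg_nonneg exit_time_nonneg)
    qed
    then show "h s x \<le> ?B" if "x \<subseteq> U \<union> V" for x using that by simp
    show "\<forall>x\<in>Pow (U \<union> V). \<bar>h s x\<bar> \<le> ?B" using h by auto
    show "\<forall>x\<in>Pow (U \<union> V). \<bar>?B\<bar> \<le> ?B" using h[of "{}"] by auto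
  qed (use s in auto)
  finally show ?thesis
    using disjoint by (simp add: h_def lift_def killed_const)
qed

text \<open>The supersolution is \<open>A * exit_time (card U) a (lam t)\<close> plus a term that decreases from \<open>2 * B\<close> to
  \<open>0\<close> while the nodes of \<open>V\<close> take over. Its drift compensates the risk of a return to \<open>U\<close>.\<close>

lemma integral_alive_upper:
  fixes A B L \<mu> :: real
  assumes ab: "0 \<le> a" "a < b" and A: "0 \<le> A"
    and B: "2 ^ card V \<le> B"
    and mu: "2 * real (card V) + 2 \<le> \<mu>" "\<And>t. t \<in> {a..b} \<Longrightarrow> \<mu> \<le> mu t"
    and L: "\<And>t. t \<in> {a..b} \<Longrightarrow> lam t \<le> L"
    and empty: "real (card U) * L * (A * exit_step (card U) 1 L) + 1 \<le> \<mu> * B / 2"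
    and lam': "\<And>t. t \<in> {a<..<b} \<Longrightarrow> (lam has_real_derivative lam' t) (at t)"
      "\<And>t. t \<in> {a<..<b} \<Longrightarrow> lam' t \<le> 0"
    and k: "2 \<le> card U"
    and super: "\<And>t. t \<in> {a<..<b} \<Longrightarrow>
      1 \<le> A * (1 - real (card U - 1) * lam t ^ (card U - 2) / real (card U) * lam' t)"
  shows "integral {a..b} (\<lambda>s. prob (alive s)) \<le> A * exit_time (card U) (card U) L + 2 * B"
proof -
  let ?k = "card U" and ?m = "card V"
  \<comment> \<open>From \<open>n\<close> active nodes of \<open>V\<close>, an activation gains at
    least \<open>B / 2 ^ (n + 1)\<close> and a deactivation loses \<open>B / 2 ^ n\<close>, so an
    activation rate above twice the number of nodes outweighs the deactivations. At
    \<open>n = 0\<close> the formula joins the value \<open>2 * B\<close> of the empty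
    configuration.\<close>
  define g where "g n = (if n < ?m then B * (1 + 1 / 2 ^ n) else 0)" for n :: nat
  define f where "f t n = A * exit_time ?k n (lam t) + 2 * B" for t n
  define h where "h t = lift (f t) g" for t
  define D where "D t x = (if x \<inter> V = {} \<and> x \<noteq> {} then A * (exit_time_deriv ?k (card x) (lam t) * lam' t) else 0)" for t x
  have B_pos: "0 < B" using B by (rule less_le_trans[rotated]) simp
  have m: "1 \<le> ?m" using nonempty finite_V by (simp add: Suc_le_eq card_gt_0_iff)
  have lam0: "0 \<le> lam t" if "t \<in> {a..b}" for t using lam_nonneg that ab by simp
  have lam_cont': "continuous_on {a..b} lam"
    by (rule continuous_on_subset[OF lam_cont]) (use ab in auto)
  have g_le: "g n \<le> B * (1 + 1 / 2 ^ n)" and g_nonneg: "0 \<le> g n" for n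
    using B_pos by (auto simp: g_def intro!: mult_nonneg_nonneg add_nonneg_nonneg)
  have g_le2: "g n \<le> 2 * B" for n
  proof -
    have "B * (1 + 1 / 2 ^ n) \<le> B * (1 + 1)"
      using B_pos by (intro mult_left_mono add_left_mono) (auto simp: divide_simps)
    then show ?thesis using g_le[of n] by simp
  qed
  have bound: "0 \<le> h t x \<and> h t x \<le> A * exit_time ?k ?k L + 2 * B" if "x \<subseteq> U \<union> V" "t \<in> {a..b}" for x t
  proof (cases "x \<inter> V = {}")
    case True
    then have "card x \<le> ?k" using that finite_U by (intro card_mono) auto
    then have "exit_time ?k (card x) (lam t) \<le> exit_time ?k ?k L"
      using lam0 L that by (meson exit_time_mono exit_time_mono_level order_trans)
    then show ?thesis
      using True A B_pos lam0[OF that(2)]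
      by (auto simp: h_def lift_def f_def intro!: mult_left_mono add_nonneg_nonneg mult_nonneg_nonneg exit_time_nonneg)
  next
    case False
    have "0 \<le> exit_time ?k ?k L" using lam0 L that by (intro exit_time_nonneg) (meson order_trans)
    then have "0 \<le> A * exit_time ?k ?k L" using A by simp
    then have "g (card x) \<le> A * exit_time ?k ?k L + 2 * B" using g_le2[of "card x"] by linarith
    then show ?thesis using False g_nonneg by (simp add: h_def lift_def)
  qed
  have "killed b (h b) + 1 * integral {a..b} (\<lambda>s. prob (alive s)) \<le> killed a (h a)"
  proof (rule dynkin[where h = h and D = D and R = states])
    show "\<forall>x\<in>states. \<forall>q\<in>clks. flip U V q x \<in> states" by (rule flip_states)
    show "h t V = 0" for t using nonempty by (simp add: h_def lift_def g_def)
    show "continuous_on {a..b} (\<lambda>t. h t x)" for x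
    proof (cases "x \<inter> V = {}")
      case True
      have "continuous_on {a..b} (\<lambda>t. f t (card x))"
        unfolding f_def exit_time_def exit_step_def using lam_cont' by (intro continuous_intros)
      then show ?thesis using True by (simp add: h_def lift_def)
    qed (simp add: h_def lift_def)
    fix x t assume x: "x \<in> states - {V}" and t: "t \<in> {a<..<b}"
    have t': "t \<in> {a..b}" using t by simp
    note lam0 = lam0[OF t'] and L = L[OF t'] and mu = mu(1) mu(2)[OF t']
    show "((\<lambda>t. h t x) has_real_derivative D t x) (at t)"
    proof (cases "x \<inter> V = {} \<and> x \<noteq> {}")
      case True
      then have "x \<subseteq> U" using x by auto
      then have x1: "1 \<le> card x" using True card_bounds(1)[OF finite_U] by auto
      have "((\<lambda>t. f t (card x)) has_real_derivative A * (exit_time_deriv ?k (card x) (lam t) * lam' t) + 0) (at t)"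
        unfolding f_def
        by (intro DERIV_add DERIV_cmult DERIV_const DERIV_chain2[OF has_derivative_exit_time lam'(1)[OF t]] x1 k)
      then show ?thesis using True by (simp add: h_def lift_def D_def)
    next
      case False
      then show ?thesis by (cases "x \<inter> V = {}") (simp_all add: h_def lift_def D_def f_def)
    qed
    have "D t x + gen t (h t) x \<le> - 1"
    proof (cases "x \<subseteq> U")
      case True
      show ?thesis
      proof (cases "x = {}")
        case True
        have "exit_step ?k 1 (lam t) \<le> exit_step ?k 1 L"
          using lam0 L by (intro exit_step_mono)
        then have "real ?k * lam t * (A * exit_step ?k 1 (lam t)) \<le> real ?k * L * (A * exit_step ?k 1 L)"
          using A lam0 L by (intro mult_mono mult_nonneg_nonneg exit_step_nonneg) auto
        moreover have "real ?m * mu t * (g 1 - 2 * B) \<le> - (\<mu> * B / 2)"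
        proof -
          \<comment> \<open>The first activation in \<open>V\<close> gains at least
            \<open>B / 2\<close>. At a rate of at least \<open>\<mu>\<close>, this has to outweigh
            the return to \<open>U\<close>, which is the hypothesis \<open>empty\<close>.\<close>
          have "g 1 - 2 * B \<le> - (B / 2)" using g_le[of 1] by simp
          then have "real ?m * mu t * (g 1 - 2 * B) \<le> real ?m * mu t * (- (B / 2))"
            using mu by (intro mult_left_mono mult_nonneg_nonneg) auto
          also have "\<dots> \<le> 1 * \<mu> * (- (B / 2))"
            using mu m B_pos by (intro mult_right_mono_neg mult_mono) auto
          finally show ?thesis by simp
        qed
        moreover have "gen t (h t) {} = real ?k * lam t * (A * exit_step ?k 1 (lam t)) + real ?m * mu t * (g 1 - 2 * B)"
          unfolding h_def gen_lift_empty f_def by (simp add: exit_time_1[unfolded One_nat_def])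
        ultimately show ?thesis using True empty by (simp add: D_def)
      next
        case False
        let ?a = "card x"
        have a: "1 \<le> ?a" "?a \<le> ?k"
          using card_bounds[OF finite_U True False] by auto
        have "D t x = A * (exit_time_deriv ?k ?a (lam t) * lam' t)"
          using False True disjoint by (auto simp: D_def)
        \<comment> \<open>As \<open>lam' t \<le> 0\<close>, a lower bound on the derivative of the
          exit time bounds the drift from above; its leading term is enough.\<close>
        also have "\<dots> \<le> A * (real (?k - 1) * lam t ^ (?k - 2) / real ?k * lam' t)"
          using A lam'(2)[OF t] lam0 by (intro mult_left_mono mult_right_mono_neg exit_time_deriv_ge)
        finally have D: "D t x \<le> A * (real (?k - 1) * lam t ^ (?k - 2) / real ?k * lam' t)" .
        have "gen t (h t) x = A * ((real ?k - real ?a) * lam t * exit_step ?k (Suc ?a) (lam t) - real ?a * exit_step ?k ?a (lam t))"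
          unfolding h_def gen_lift_U[OF True False] f_def
          using exit_time_pred[OF a(1), of ?k "lam t"] exit_time_Suc[of ?k ?a "lam t"]
          by (simp add: right_diff_distrib[symmetric] mult.left_commute)
        also have "\<dots> = - A"
          using exit_step_rec[OF a, of "lam t"] by simp
        finally show ?thesis using D super[OF t] by (simp add: right_diff_distrib)
      qed
    next
      case False
      then have xV: "x \<subseteq> V" "x \<noteq> {}" using x by auto
      let ?b = "card x"
      have b: "1 \<le> ?b" "?b < ?m"
        using card_bounds(1)[OF finite_V xV] psubset_card_mono[OF finite_V, of x] x xV by auto
      have p: "(if ?b = 1 then f t 0 else g (?b - 1)) = B * (1 + 2 / 2 ^ ?b)"
      proof (cases "?b = 1")
        case False
        then have "2 \<le> ?b" using b by simp
        then have "?b = Suc (Suc (?b - 2))" by simp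
        then obtain n where "?b = Suc (Suc n)" by blast
        then show ?thesis using b by (simp add: g_def)
      qed (simp add: f_def)
      have gb: "g ?b = B * (1 + 1 / 2 ^ ?b)" using b by (simp add: g_def)
      have "g (?b + 1) - g ?b \<le> - (B / 2 ^ ?b / 2)"
      proof -
        have "B * (1 + 1 / 2 ^ (?b + 1)) = B * (1 + 1 / 2 ^ ?b) - B / 2 ^ ?b / 2"
          by (simp add: distrib_left)
        then show ?thesis using g_le[of "?b + 1"] unfolding gb by linarith
      qed
      then have "(real ?m - real ?b) * mu t * (g (?b + 1) - g ?b) \<le> (real ?m - real ?b) * mu t * (- (B / 2 ^ ?b / 2))"
        using mu b by (intro mult_left_mono mult_nonneg_nonneg) auto
      also have "\<dots> \<le> 1 * \<mu> * (- (B / 2 ^ ?b / 2))"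
        using mu b B_pos by (intro mult_right_mono_neg mult_mono) auto
      finally have up: "(real ?m - real ?b) * mu t * (g (?b + 1) - g ?b) \<le> - (\<mu> / 2 * (B / 2 ^ ?b))" by simp
      \<comment> \<open>The drift in \<open>V\<close> is at most \<open>- B / 2 ^ ?b\<close>; this
        bound with \<open>2 ^ card V \<le> B\<close> brings it below \<open>- 1\<close>.\<close>
      have "(2::real) ^ ?b \<le> B" by (rule order_trans[OF power_increasing B]) (use b in auto)
      then have ge1: "1 \<le> B / 2 ^ ?b" by simp
      have "gen t (h t) x = real ?b * (B / 2 ^ ?b) + (real ?m - real ?b) * mu t * (g (?b + 1) - g ?b)"
        unfolding h_def gen_lift_V[OF xV] p gb by (simp add: field_simps)
      also have "\<dots> \<le> (real ?b - \<mu> / 2) * (B / 2 ^ ?b)"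
        using up unfolding left_diff_distrib[of "real ?b"] by linarith
      also have "\<dots> \<le> (- 1) * (B / 2 ^ ?b)"
        by (rule mult_right_mono) (use mu b ge1 in linarith)+
      finally have "gen t (h t) x \<le> - 1" using ge1 by linarith
      moreover have "D t x = 0" using xV by (auto simp: D_def)
      ultimately show ?thesis by simp
    qed
    then show "D t x + (\<Sum>q\<in>clks. clock_rate rate q t * (h t (flip U V q x) - h t x)) \<le> - 1"
      unfolding gen_def .
  qed (use ab in auto)
  moreover have const: "0 \<le> A * exit_time ?k ?k L + 2 * B"
    using bound[of "{}" a] ab by (meson atLeastAtMost_iff empty_subsetI less_imp_le order_refl order_trans)
  moreover have "killed b (\<lambda>_. 0) \<le> killed b (h b)"
    using bound[of _ b] const ab by (intro killed_mono[where B = "A * exit_time ?k ?k L + 2 * B"]) (auto intro: order_trans)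
  moreover have "killed a (h a) \<le> killed a (\<lambda>_. A * exit_time ?k ?k L + 2 * B)"
    using bound[of _ a] const ab by (intro killed_mono[where B = "A * exit_time ?k ?k L + 2 * B"]) auto
  moreover have "prob (alive a) * (A * exit_time ?k ?k L + 2 * B) \<le> 1 * (A * exit_time ?k ?k L + 2 * B)"
    using const by (intro mult_right_mono) auto
  ultimately show ?thesis by (simp add: killed_const)
qed

end

section \<open>Convergence of tails and means\<close>

lemma less_divide_ennreal_iff:
  assumes "0 < s" "0 \<le> y"
  shows "ennreal y < z / ennreal s \<longleftrightarrow> ennreal (y * s) < z"
proof (cases z)
  case (real r)
  then show ?thesis using assms by (simp add: divide_ennreal ennreal_less_iff field_simps)
next
  case top
  then show ?thesis using assms by (simp add: ennreal_top_divide)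
qed

text \<open>Every \<open>z\<close>, finite or not, is the length of the set of all
  \<open>x \<ge> 0\<close> below \<open>z\<close>. Fubini's theorem exchanges this length with the
  expectation.\<close>

lemma (in prob_space) layer_cake:
  assumes f [measurable]: "f \<in> borel_measurable M"
  shows "(\<integral>\<^sup>+\<omega>. f \<omega> \<partial>M) = (\<integral>\<^sup>+x. ennreal (prob {\<omega> \<in> space M. ennreal x < f \<omega>}) * indicator {0..} x \<partial>lborel)"
proof -
  interpret L: pair_sigma_finite lborel M
    by standard
  have cake: "z = (\<integral>\<^sup>+x. indicator {x. ennreal x < z} x * indicator {0..} x \<partial>lborel)" for z :: ennreal
  proof (cases z)
    case (real r)
    have "(\<lambda>x. indicator {x. ennreal x < z} x * indicator {0..} x :: ennreal) = indicator {0..<r}"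
      using real by (auto simp: indicator_def fun_eq_iff ennreal_less_iff)
    then show ?thesis using real by simp
  next
    case top
    have "(\<lambda>x. indicator {x. ennreal x < z} x * indicator {0..} x :: ennreal) = indicator {0..}"
      using top by (auto simp: indicator_def fun_eq_iff)
    moreover have "emeasure lborel {0::real..} = top"
    proof -
      have "ennreal (real n) \<le> emeasure lborel {0::real..}" for n
      proof -
        have "emeasure lborel {0..real n} \<le> emeasure lborel {0::real..}"
          by (intro emeasure_mono) auto
        then show ?thesis by simp
      qed
      then have "(SUP n. ennreal (real n)) \<le> emeasure lborel {0::real..}"
        by (intro SUP_least)
      then show ?thesis by (simp add: ennreal_SUP_of_nat_eq_top ennreal_of_nat_eq_real_of_nat[symmetric] top_unique)
    qed
    ultimately show ?thesis using top by simp
  qed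
  have "(\<integral>\<^sup>+\<omega>. f \<omega> \<partial>M) = (\<integral>\<^sup>+\<omega>. \<integral>\<^sup>+x. indicator {x. ennreal x < f \<omega>} x * indicator {0..} x \<partial>lborel \<partial>M)"
    by (subst cake) simp
  also have "\<dots> = (\<integral>\<^sup>+x. \<integral>\<^sup>+\<omega>. indicator {x. ennreal x < f \<omega>} x * indicator {0..} x \<partial>M \<partial>lborel)"
  proof (rule L.Fubini'[of "\<lambda>x \<omega>. indicator {x. ennreal x < f \<omega>} x * indicator {0..} x"])
    have "(\<lambda>z. if ennreal (fst z) < f (snd z) \<and> 0 \<le> fst z then 1 else 0 :: ennreal) \<in> borel_measurable (lborel \<Otimes>\<^sub>M M)"
      by measurable
    moreover have "(\<lambda>(x, \<omega>). indicator {x. ennreal x < f \<omega>} x * indicator {0..} x) =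
        (\<lambda>z. if ennreal (fst z) < f (snd z) \<and> 0 \<le> fst z then 1 else 0 :: ennreal)"
      by (auto simp: indicator_def fun_eq_iff)
    ultimately show "(\<lambda>(x, \<omega>). indicator {x. ennreal x < f \<omega>} x * indicator {0..} x :: ennreal) \<in> borel_measurable (lborel \<Otimes>\<^sub>M M)"
      by simp
  qed
  also have "\<dots> = (\<integral>\<^sup>+x. ennreal (prob {\<omega> \<in> space M. ennreal x < f \<omega>}) * indicator {0..} x \<partial>lborel)"
  proof (rule nn_integral_cong)
    fix x :: real
    have "(\<integral>\<^sup>+\<omega>. indicator {x. ennreal x < f \<omega>} x * indicator {0..} x \<partial>M)
        = (\<integral>\<^sup>+\<omega>. indicator {0..} x * indicator {\<omega> \<in> space M. ennreal x < f \<omega>} \<omega> \<partial>M)"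
      by (intro nn_integral_cong) (auto simp: indicator_def)
    also have "\<dots> = ennreal (prob {\<omega> \<in> space M. ennreal x < f \<omega>}) * indicator {0..} x"
      by (simp add: nn_integral_cmult_indicator emeasure_eq_measure mult.commute)
    finally show "(\<integral>\<^sup>+\<omega>. indicator {x. ennreal x < f \<omega>} x * indicator {0..} x \<partial>M)
        = ennreal (prob {\<omega> \<in> space M. ennreal x < f \<omega>}) * indicator {0..} x" .
  qed
  finally show ?thesis .
qed

text \<open>Lower bounds on the tails and an upper bound on the mean that match force convergence of both:
  mass that the tail has in excess of the limit would show up in the mean, by Fatou's lemma.\<close>

locale tail_limit =
  fixes M :: "nat \<Rightarrow> 'w measure" and Z :: "nat \<Rightarrow> 'w \<Rightarrow> ennreal" and s :: "nat \<Rightarrow> real" and p :: "real \<Rightarrow> real"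
  assumes prob_space_M: "\<And>n. prob_space (M n)"
    and Z_measurable: "\<And>n. Z n \<in> borel_measurable (M n)"
    and s_pos: "\<And>n. 0 < s n"
    and p_measurable: "p \<in> borel_measurable borel"
    and p_antimono: "\<And>x y. 0 \<le> x \<Longrightarrow> x \<le> y \<Longrightarrow> p y \<le> p x"
    and p_nonneg: "\<And>x. 0 \<le> x \<Longrightarrow> 0 \<le> p x" and p_0: "p 0 = 1"
    and p_integral: "(\<integral>\<^sup>+x. ennreal (p x) * indicator {0..} x \<partial>lborel) = 1"
    and lower: "\<And>x e. 0 \<le> x \<Longrightarrow> 0 < e \<Longrightarrow>
      eventually (\<lambda>n. p x - e < measure (M n) {\<omega> \<in> space (M n). ennreal (x * s n) < Z n \<omega>}) sequentially"
    and upper: "\<And>e. 0 < e \<Longrightarrow> eventually (\<lambda>n. (\<integral>\<^sup>+\<omega>. Z n \<omega> \<partial>M n) \<le> ennreal ((1 + e) * s n)) sequentially"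
begin

definition tail :: "nat \<Rightarrow> real \<Rightarrow> real" where
  "tail n x = measure (M n) {\<omega> \<in> space (M n). ennreal (x * s n) < Z n \<omega>}"

definition E :: "nat \<Rightarrow> real" where
  "E n = enn2real (\<integral>\<^sup>+\<omega>. Z n \<omega> \<partial>M n)"

lemma tail_antimono: "x \<le> y \<Longrightarrow> tail n y \<le> tail n x"
proof -
  assume xy: "x \<le> y"
  interpret prob_space "M n" by (rule prob_space_M)
  have "ennreal (x * s n) \<le> ennreal (y * s n)"
    using xy s_pos[of n] by (intro ennreal_leI mult_right_mono) auto
  moreover have "{\<omega> \<in> space (M n). ennreal (x * s n) < Z n \<omega>} \<in> sets (M n)"
    using Z_measurable[of n] by measurable
  ultimately show ?thesis
    unfolding tail_def by (intro finite_measure_mono) (auto dest: le_less_trans)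
qed

lemma tail_le_1: "tail n x \<le> 1"
  unfolding tail_def using prob_space.prob_le_1[OF prob_space_M] .

lemma tail_nonneg: "0 \<le> tail n x"
  by (simp add: tail_def)

lemma tail_measurable [measurable]: "tail n \<in> borel_measurable borel"
proof -
  have "mono (\<lambda>x. - tail n x)" by (intro monoI) (simp add: tail_antimono)
  then have "(\<lambda>x. - tail n x) \<in> borel_measurable borel" by (rule borel_measurable_mono)
  then have "(\<lambda>x. - (- tail n x)) \<in> borel_measurable borel" by measurable
  then show ?thesis by simp
qed

lemma scaled_mean: "(\<integral>\<^sup>+\<omega>. Z n \<omega> \<partial>M n) = ennreal (s n) * (\<integral>\<^sup>+x. ennreal (tail n x) * indicator {0..} x \<partial>lborel)"
proof -
  interpret prob_space "M n" by (rule prob_space_M)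
  have Z: "(\<lambda>\<omega>. Z n \<omega> / ennreal (s n)) \<in> borel_measurable (M n)"
    using Z_measurable[of n] by measurable
  have "(\<integral>\<^sup>+\<omega>. Z n \<omega> / ennreal (s n) \<partial>M n) =
      (\<integral>\<^sup>+x. ennreal (prob {\<omega> \<in> space (M n). ennreal x < Z n \<omega> / ennreal (s n)}) * indicator {0..} x \<partial>lborel)"
    by (rule layer_cake[OF Z])
  also have "\<dots> = (\<integral>\<^sup>+x. ennreal (tail n x) * indicator {0..} x \<partial>lborel)"
  proof (rule nn_integral_cong)
    fix x :: real
    have "prob {\<omega> \<in> space (M n). ennreal x < Z n \<omega> / ennreal (s n)} = tail n x" if "0 \<le> x"
      unfolding tail_def less_divide_ennreal_iff[OF s_pos that] ..
    then show "ennreal (prob {\<omega> \<in> space (M n). ennreal x < Z n \<omega> / ennreal (s n)}) * indicator {0..} x =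
        ennreal (tail n x) * indicator {0..} x"
      by (auto simp: indicator_def)
  qed
  finally have 1: "(\<integral>\<^sup>+\<omega>. Z n \<omega> / ennreal (s n) \<partial>M n) = (\<integral>\<^sup>+x. ennreal (tail n x) * indicator {0..} x \<partial>lborel)" .
  have "(\<integral>\<^sup>+\<omega>. Z n \<omega> \<partial>M n) = (\<integral>\<^sup>+\<omega>. ennreal (s n) * (Z n \<omega> / ennreal (s n)) \<partial>M n)"
  proof (rule nn_integral_cong)
    fix \<omega>
    show "Z n \<omega> = ennreal (s n) * (Z n \<omega> / ennreal (s n))"
      using s_pos[of n] mult_divide_eq_ennreal[of "ennreal (s n)" "Z n \<omega>"]
      by (simp add: ennreal_times_divide mult.commute)
  qed
  also have "\<dots> = ennreal (s n) * (\<integral>\<^sup>+\<omega>. Z n \<omega> / ennreal (s n) \<partial>M n)"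
    using Z by (rule nn_integral_cmult)
  finally show ?thesis unfolding 1 .
qed

text \<open>The lower bounds say that \<open>p\<close> is at most the pointwise liminf of the tails
  on \<open>{0..}\<close>, so Fatou's lemma applies on every Borel subset; a number strictly below
  the liminf is eventually exceeded.\<close>

lemma fatou:
  assumes "A \<in> sets borel" "A \<subseteq> {0..}" and q: "ennreal q < (\<integral>\<^sup>+x. ennreal (p x) * indicator A x \<partial>lborel)"
  shows "eventually (\<lambda>n. ennreal q < (\<integral>\<^sup>+x. ennreal (tail n x) * indicator A x \<partial>lborel)) sequentially"
proof (rule less_LiminfD)
  have [measurable]: "A \<in> sets borel" by fact
  have "ennreal (p x) * indicator A x \<le> liminf (\<lambda>n. ennreal (tail n x) * indicator A x)" for x
  proof (cases "x \<in> A")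
    case True
    then have x: "0 \<le> x" using assms(2) by auto
    have "ennreal (p x) \<le> liminf (\<lambda>n. ennreal (tail n x))"
      unfolding le_Liminf_iff
    proof (intro allI impI)
      fix y assume y: "y < ennreal (p x)"
      then obtain y' where y': "y = ennreal y'" "0 \<le> y'" by (cases y) (auto simp: top_unique)
      have "y' < p x" using y y' by (simp add: ennreal_less_iff)
      then have "eventually (\<lambda>n. p x - (p x - y') < tail n x) sequentially"
        unfolding tail_def by (intro lower[OF x]) simp
      then show "eventually (\<lambda>n. y < ennreal (tail n x)) sequentially"
        using y' by (auto elim!: eventually_mono simp: ennreal_less_iff)
    qed
    then show ?thesis using True by simp
  qed simp
  then have "(\<integral>\<^sup>+x. ennreal (p x) * indicator A x \<partial>lborel) \<le> (\<integral>\<^sup>+x. liminf (\<lambda>n. ennreal (tail n x) * indicator A x) \<partial>lborel)"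
    by (intro nn_integral_mono)
  also have "\<dots> \<le> liminf (\<lambda>n. \<integral>\<^sup>+x. ennreal (tail n x) * indicator A x \<partial>lborel)"
    by (intro nn_integral_liminf) measurable
  finally show "ennreal q < liminf (\<lambda>n. \<integral>\<^sup>+x. ennreal (tail n x) * indicator A x \<partial>lborel)"
    by (rule less_le_trans[OF q])
qed

lemma mean_finite: "eventually (\<lambda>n. (\<integral>\<^sup>+\<omega>. Z n \<omega> \<partial>M n) = ennreal (E n)) sequentially"
  using upper[of 1, simplified]
proof eventually_elim
  case (elim n)
  then have "(\<integral>\<^sup>+\<omega>. Z n \<omega> \<partial>M n) < top" by (auto intro: le_less_trans)
  then show ?case by (simp add: E_def)
qed

text \<open>The lower half is Fatou's lemma on the whole half-line, where \<open>p\<close> has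
  integral 1; the upper half is the assumed bound.\<close>

lemma mean_close:
  assumes e: "0 < e"
  shows "eventually (\<lambda>n. (1 - e) * s n < E n \<and> E n \<le> (1 + e) * s n) sequentially"
proof -
  have "eventually (\<lambda>n. ennreal (1 - e) < (\<integral>\<^sup>+x. ennreal (tail n x) * indicator {0..} x \<partial>lborel)) sequentially"
    using e by (intro fatou) (auto simp: p_integral ennreal_less_iff ennreal_less_one_iff)
  then show ?thesis
    using mean_finite upper[OF e]
  proof eventually_elim
    case (elim n)
    have "E n \<le> (1 + e) * s n"
      using elim(2,3) s_pos[of n] e by simp
    moreover have "(1 - e) * s n < E n"
    proof (cases "1 - e \<ge> 0")
      case True
      have "ennreal (s n) * ennreal (1 - e) < ennreal (E n)"
        unfolding elim(2)[symmetric] scaled_mean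
        using elim(1) s_pos[of n] by (intro ennreal_mult_strict_left_mono) auto
      then show ?thesis
        using True s_pos[of n] by (simp add: ennreal_mult[symmetric] ennreal_less_iff mult.commute)
    next
      case False
      then have "(1 - e) * s n < 0" using s_pos[of n] by (simp add: mult_neg_pos)
      also have "0 \<le> E n" by (simp add: E_def)
      finally show ?thesis .
    qed
    ultimately show ?case by simp
  qed
qed

lemma mean_tendsto: "(\<lambda>n. E n / s n) \<longlonglongrightarrow> 1"
proof (rule LIMSEQ_I)
  fix e :: real assume e: "0 < e"
  have "eventually (\<lambda>n. norm (E n / s n - 1) < e) sequentially"
    using mean_close[OF half_gt_zero[OF e]]
  proof eventually_elim
    case (elim n)
    then have "1 - e / 2 < E n / s n" "E n / s n \<le> 1 + e / 2"
      using s_pos[of n] by (auto simp: field_simps)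
    then show ?case using e by (auto simp: abs_less_iff)
  qed
  then show "\<exists>no. \<forall>n\<ge>no. norm (E n / s n - 1) < e"
    by (simp add: eventually_sequentially)
qed

text \<open>Off \<open>[y, x)\<close> the tails carry almost the mass of \<open>p\<close>, by
  Fatou's lemma, and in total hardly more than 1. So \<open>[y, x)\<close> carries hardly more than
  \<open>p y * (x - y)\<close>, but by monotonicity at least
  \<open>tail n x * (x - y)\<close>.\<close>

lemma tail_upper:
  assumes xy: "0 \<le> y" "y < x" and e: "0 < e"
  shows "eventually (\<lambda>n. tail n x < p y + e) sequentially"
proof -
  define d where "d = x - y"
  have d: "0 < d" using xy by (simp add: d_def)
  define A where "A = {0..} - {y..<x}"
  have A [measurable]: "A \<in> sets borel" and A_sub: "A \<subseteq> {0..}" by (auto simp: A_def)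
  define P where "P = (\<integral>\<^sup>+x. ennreal (p x) * indicator A x \<partial>lborel)"
  have split: "(\<integral>\<^sup>+x. f x * indicator {0..} x \<partial>lborel) =
      (\<integral>\<^sup>+x. f x * indicator A x \<partial>lborel) + (\<integral>\<^sup>+z. f z * indicator {y..<x} z \<partial>lborel)"
    if [measurable]: "f \<in> borel_measurable borel" for f :: "real \<Rightarrow> ennreal"
  proof -
    have "(\<integral>\<^sup>+x. f x * indicator {0..} x \<partial>lborel) = (\<integral>\<^sup>+z. f z * indicator A z + f z * indicator {y..<x} z \<partial>lborel)"
      using xy by (intro nn_integral_cong) (auto simp: A_def indicator_def)
    also have "\<dots> = (\<integral>\<^sup>+x. f x * indicator A x \<partial>lborel) + (\<integral>\<^sup>+z. f z * indicator {y..<x} z \<partial>lborel)"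
      using nn_integral_add[of "\<lambda>z. f z * indicator A z" lborel "\<lambda>z. f z * indicator {y..<x} z"] by simp
    finally show ?thesis .
  qed
  have "(\<integral>\<^sup>+z. ennreal (p z) * indicator {y..<x} z \<partial>lborel) \<le> (\<integral>\<^sup>+z. ennreal (p y) * indicator {y..<x} z \<partial>lborel)"
    using xy by (intro nn_integral_mono) (auto simp: indicator_def intro!: ennreal_leI p_antimono)
  also have "\<dots> = ennreal (p y * d)"
    using xy p_nonneg[of y] by (simp add: nn_integral_cmult_indicator d_def ennreal_mult')
  finally have "1 \<le> P + ennreal (p y * d)"
    unfolding p_integral[symmetric] P_def using split[of "\<lambda>x. ennreal (p x)"] p_measurable by (simp add: add_left_mono)
  moreover have "P \<le> 1"
    unfolding p_integral[symmetric] P_def using A_sub by (intro nn_integral_mono) (auto simp: indicator_def)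
  ultimately obtain P' where P': "P = ennreal P'" "0 \<le> P'" "1 \<le> P' + p y * d"
  proof -
    assume a: "1 \<le> P + ennreal (p y * d)" "P \<le> 1"
    then obtain P' where P': "P = ennreal P'" "0 \<le> P'" by (cases P) (auto simp: top_unique)
    have "1 \<le> ennreal (P' + p y * d)"
      using a P' p_nonneg[OF xy(1)] d by simp
    then have "1 \<le> P' + p y * d" by (simp add: ennreal_ge_1)
    then show thesis using that P' by blast
  qed
  \<comment> \<open>Since \<open>enn2real\<close> maps infinity to 0, that case is kept apart; it is
    excluded once the total mass is known to be finite.\<close>
  have "eventually (\<lambda>n. P' - d * e / 4 < enn2real (\<integral>\<^sup>+x. ennreal (tail n x) * indicator A x \<partial>lborel) \<or>
     (\<integral>\<^sup>+x. ennreal (tail n x) * indicator A x \<partial>lborel) = top) sequentially"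
  proof (cases "P' - d * e / 4 < 0")
    case True
    then show ?thesis by (intro always_eventually) (meson enn2real_nonneg less_le_trans)
  next
    case False
    then have "ennreal (P' - d * e / 4) < P"
      unfolding P'(1) using d e by (subst ennreal_less_iff) auto
    then have "eventually (\<lambda>n. ennreal (P' - d * e / 4) < (\<integral>\<^sup>+x. ennreal (tail n x) * indicator A x \<partial>lborel)) sequentially"
      unfolding P_def by (rule fatou[OF A A_sub])
    then show ?thesis
    proof eventually_elim
      case (elim n)
      then show ?case
        using False by (cases "\<integral>\<^sup>+x. ennreal (tail n x) * indicator A x \<partial>lborel") (auto simp: ennreal_less_iff)
    qed
  qed
  moreover have "eventually (\<lambda>n. (\<integral>\<^sup>+\<omega>. Z n \<omega> \<partial>M n) \<le> ennreal ((1 + d * e / 4) * s n)) sequentially"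
    using d e by (intro upper) simp
  ultimately show ?thesis
  proof eventually_elim
    case (elim n)
    let ?I = "\<integral>\<^sup>+x. ennreal (tail n x) * indicator A x \<partial>lborel"
    have "ennreal (s n) * (\<integral>\<^sup>+x. ennreal (tail n x) * indicator {0..} x \<partial>lborel) \<le> ennreal (s n) * ennreal (1 + d * e / 4)"
    proof -
      have "ennreal ((1 + d * e / 4) * s n) = ennreal (s n) * ennreal (1 + d * e / 4)"
        using s_pos[of n] d e by (subst ennreal_mult[symmetric]) (auto simp: mult.commute)
      then show ?thesis using elim(2) unfolding scaled_mean by simp
    qed
    then have le: "(\<integral>\<^sup>+x. ennreal (tail n x) * indicator {0..} x \<partial>lborel) \<le> ennreal (1 + d * e / 4)"
      using s_pos[of n] by (subst (asm) ennreal_mult_le_mult_iff) auto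
    have "ennreal (tail n x * d) = (\<integral>\<^sup>+z. ennreal (tail n x) * indicator {y..<x} z \<partial>lborel)"
      using xy tail_nonneg[of n x] by (simp add: nn_integral_cmult_indicator d_def ennreal_mult')
    also have "\<dots> \<le> (\<integral>\<^sup>+z. ennreal (tail n z) * indicator {y..<x} z \<partial>lborel)"
      by (intro nn_integral_mono) (auto simp: indicator_def intro!: ennreal_leI tail_antimono)
    finally have "?I + ennreal (tail n x * d) \<le> (\<integral>\<^sup>+x. ennreal (tail n x) * indicator {0..} x \<partial>lborel)"
      using split[of "\<lambda>x. ennreal (tail n x)"] by (simp add: add_left_mono)
    then have sum: "?I + ennreal (tail n x * d) \<le> ennreal (1 + d * e / 4)"
      using le by (rule order_trans)
    then have "?I \<noteq> top" by (auto simp: top_unique)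
    then obtain I where I: "?I = ennreal I" "0 \<le> I" by (cases ?I) auto
    have "P' - d * e / 4 < I" using elim(1) I by auto
    moreover have "I + tail n x * d \<le> 1 + d * e / 4"
    proof -
      have "ennreal (I + tail n x * d) \<le> ennreal (1 + d * e / 4)"
        using sum I tail_nonneg[of n x] d by (subst ennreal_plus) auto
      moreover have "0 \<le> 1 + d * e / 4" using d e by simp
      ultimately show ?thesis by (subst (asm) ennreal_le_iff)
    qed
    \<comment> \<open>The two allowances of \<open>d * e / 4\<close>, from Fatou's lemma and from
      the mean, add up to \<open>d * e / 2\<close>.\<close>
    ultimately have "tail n x * d < (p y + e / 2) * d"
      using P'(3) by (simp add: algebra_simps)
    then have "tail n x < p y + e / 2" using d by simp
    then show ?case using e by simp
  qed
qed

text \<open>Dividing by the mean instead of the scale moves the argument to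
  \<open>x * (E n / s n)\<close>, and continuity of \<open>p\<close> at \<open>x\<close> absorbs the
  factor that tends to 1. At \<open>x = 0\<close> the argument does not move.\<close>

theorem ratio_tendsto:
  assumes x: "0 \<le> x" and cont: "x = 0 \<or> isCont p x"
  shows "(\<lambda>n. measure (M n) {\<omega> \<in> space (M n). ennreal x < Z n \<omega> / (\<integral>\<^sup>+\<omega>. Z n \<omega> \<partial>M n)}) \<longlonglongrightarrow> p x"
proof -
  let ?m = "\<lambda>n. measure (M n) {\<omega> \<in> space (M n). ennreal x < Z n \<omega> / (\<integral>\<^sup>+\<omega>. Z n \<omega> \<partial>M n)}"
  have m_eq: "eventually (\<lambda>n. ?m n = tail n (x * (E n / s n))) sequentially"
    using mean_finite mean_close[of "1/2", simplified]
  proof eventually_elim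
    case (elim n)
    have "0 < E n" using elim(2) s_pos[of n] by linarith
    then have "{\<omega> \<in> space (M n). ennreal x < Z n \<omega> / (\<integral>\<^sup>+\<omega>. Z n \<omega> \<partial>M n)} =
        {\<omega> \<in> space (M n). ennreal (x * E n) < Z n \<omega>}"
      using x by (simp add: elim(1) less_divide_ennreal_iff)
    then show ?case using s_pos[of n] by (simp add: tail_def)
  qed
  have close: "eventually (\<lambda>n. \<bar>E n / s n - 1\<bar> < d) sequentially" if "0 < d" for d
    using tendstoD[OF mean_tendsto that] by (simp add: dist_real_def)
  have up: "eventually (\<lambda>n. ?m n < p x + e) sequentially" if e: "0 < e" for e
  proof (cases "x = 0")
    case True
    show ?thesis using m_eq by eventually_elim (use True e p_0 tail_le_1 in \<open>simp add: le_less_trans[OF tail_le_1]\<close>)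
  next
    case False
    then have x: "0 < x" using x by simp
    obtain \<delta> where \<delta>: "0 < \<delta>" "\<And>y. \<bar>y - x\<bar> < \<delta> \<Longrightarrow> \<bar>p y - p x\<bar> < e / 2"
      using cont False e unfolding continuous_at_eps_delta by (metis half_gt_zero dist_real_def)
    define y where "y = max (x / 2) (x - \<delta> / 2)"
    have y: "0 \<le> y" "y < x" "\<bar>y - x\<bar> < \<delta>" using x \<delta>(1) by (auto simp: y_def max_def)
    have "eventually (\<lambda>n. tail n ((x + y) / 2) < p y + e / 2) sequentially"
      using y e by (intro tail_upper) auto
    moreover have "eventually (\<lambda>n. \<bar>E n / s n - 1\<bar> < (x - y) / (2 * x)) sequentially"
      using x y by (intro close) simp
    ultimately show ?thesis
      using m_eq
    proof eventually_elim
      case (elim n)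
      have "1 - (x - y) / (2 * x) \<le> E n / s n" using elim(2) by (simp add: abs_less_iff)
      then have "x * (1 - (x - y) / (2 * x)) \<le> x * (E n / s n)" using x by (intro mult_left_mono) auto
      also have "x * (1 - (x - y) / (2 * x)) = (x + y) / 2" using x by (simp add: field_simps)
      finally have "tail n (x * (E n / s n)) \<le> tail n ((x + y) / 2)" by (rule tail_antimono)
      moreover have "p y - p x < e / 2" using \<delta>(2)[OF y(3)] by linarith
      ultimately show ?case using elim by linarith
    qed
  qed
  have low: "eventually (\<lambda>n. p x - e < ?m n) sequentially" if e: "0 < e" for e
  proof (cases "x = 0")
    case True
    have "eventually (\<lambda>n. p 0 - e < tail n 0) sequentially"
      unfolding tail_def using lower[OF _ e, of 0] by simp
    with m_eq show ?thesis by eventually_elim (use True in simp)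
  next
    case False
    then have x: "0 < x" using x by simp
    obtain \<delta> where \<delta>: "0 < \<delta>" "\<And>y. \<bar>y - x\<bar> < \<delta> \<Longrightarrow> \<bar>p y - p x\<bar> < e / 2"
      using cont False e unfolding continuous_at_eps_delta by (metis half_gt_zero dist_real_def)
    define y where "y = x + \<delta> / 2"
    have y: "x < y" "\<bar>y - x\<bar> < \<delta>" using \<delta>(1) by (auto simp: y_def)
    have "eventually (\<lambda>n. p y - e / 2 < tail n y) sequentially"
      unfolding tail_def using x y e by (intro lower) auto
    moreover have "eventually (\<lambda>n. \<bar>E n / s n - 1\<bar> < (y - x) / x) sequentially"
      using x y by (intro close) simp
    ultimately show ?thesis
      using m_eq
    proof eventually_elim
      case (elim n)
      have "E n / s n \<le> 1 + (y - x) / x" using elim(2) by (simp add: abs_less_iff)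
      then have "x * (E n / s n) \<le> x * (1 + (y - x) / x)" using x by (intro mult_left_mono) auto
      also have "x * (1 + (y - x) / x) = y" using x by (simp add: field_simps)
      finally have "tail n y \<le> tail n (x * (E n / s n))" by (rule tail_antimono)
      moreover have "p x - p y < e / 2" using \<delta>(2)[OF y(2)] by linarith
      ultimately show ?case using elim by linarith
    qed
  qed
  show ?thesis
  proof (rule order_tendstoI)
    fix a assume "a < p x"
    then show "eventually (\<lambda>n. a < ?m n) sequentially" using low[of "p x - a"] by simp
  next
    fix a assume "p x < a"
    then show "eventually (\<lambda>n. ?m n < a) sequentially" using up[of "a - p x"] by simp
  qed
qed

end

text \<open>Limits in a real parameter are tested along sequences. Replacing \<open>R n\<close> by
  \<open>max 1 (R n)\<close> makes the parameter positive for every \<open>n\<close> and eventually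
  changes nothing.\<close>

theorem tail_limit_at_top:
  fixes M :: "real \<Rightarrow> 'w measure" and Z :: "real \<Rightarrow> 'w \<Rightarrow> ennreal" and s p :: "real \<Rightarrow> real"
  assumes M: "\<And>r. 0 < r \<Longrightarrow> prob_space (M r)"
    and Z: "\<And>r. 0 < r \<Longrightarrow> Z r \<in> borel_measurable (M r)"
    and s: "\<And>r. 0 < r \<Longrightarrow> 0 < s r"
    and p: "p \<in> borel_measurable borel" "\<And>x y. 0 \<le> x \<Longrightarrow> x \<le> y \<Longrightarrow> p y \<le> p x"
      "\<And>x. 0 \<le> x \<Longrightarrow> 0 \<le> p x" "p 0 = 1"
      "(\<integral>\<^sup>+x. ennreal (p x) * indicator {0..} x \<partial>lborel) = 1"
    and lower: "\<And>x e. 0 \<le> x \<Longrightarrow> 0 < e \<Longrightarrow>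
      eventually (\<lambda>r. p x - e < measure (M r) {\<omega> \<in> space (M r). ennreal (x * s r) < Z r \<omega>}) at_top"
    and upper: "\<And>e. 0 < e \<Longrightarrow> eventually (\<lambda>r. (\<integral>\<^sup>+\<omega>. Z r \<omega> \<partial>M r) \<le> ennreal ((1 + e) * s r)) at_top"
  shows "((\<lambda>r. enn2real (\<integral>\<^sup>+\<omega>. Z r \<omega> \<partial>M r) / s r) \<longlongrightarrow> 1) at_top"
    and "0 \<le> x \<Longrightarrow> x = 0 \<or> isCont p x \<Longrightarrow>
      ((\<lambda>r. measure (M r) {\<omega> \<in> space (M r). ennreal x < Z r \<omega> / (\<integral>\<^sup>+\<omega>. Z r \<omega> \<partial>M r)}) \<longlongrightarrow> p x) at_top"
proof -
  have seq: "tail_limit (\<lambda>n. M (max 1 (R n))) (\<lambda>n. Z (max 1 (R n))) (\<lambda>n. s (max 1 (R n))) p"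
    if R: "filterlim R at_top sequentially" for R :: "nat \<Rightarrow> real"
  proof (rule tail_limit.intro)
    have R': "filterlim (\<lambda>n. max 1 (R n)) at_top sequentially"
      by (rule filterlim_at_top_mono[OF R]) auto
    show "eventually (\<lambda>n. p x - e < measure (M (max 1 (R n)))
        {\<omega> \<in> space (M (max 1 (R n))). ennreal (x * s (max 1 (R n))) < Z (max 1 (R n)) \<omega>}) sequentially"
      if "0 \<le> x" "0 < e" for x e
      by (rule eventually_compose_filterlim[OF lower[OF that] R'])
    show "eventually (\<lambda>n. (\<integral>\<^sup>+\<omega>. Z (max 1 (R n)) \<omega> \<partial>M (max 1 (R n))) \<le> ennreal ((1 + e) * s (max 1 (R n)))) sequentially"
      if "0 < e" for e
      by (rule eventually_compose_filterlim[OF upper[OF that] R'])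
    fix n
    have n: "0 < max 1 (R n)" by simp
    show "prob_space (M (max 1 (R n)))" by (rule M[OF n])
    show "Z (max 1 (R n)) \<in> borel_measurable (M (max 1 (R n)))" by (rule Z[OF n])
    show "0 < s (max 1 (R n))" by (rule s[OF n])
  qed (fact p)+
  have eq: "eventually (\<lambda>n. max 1 (R n) = R n) sequentially"
    if R: "filterlim R at_top sequentially" for R :: "nat \<Rightarrow> real"
    using R[unfolded filterlim_at_top, rule_format, of 1] by eventually_elim simp
  show "((\<lambda>r. enn2real (\<integral>\<^sup>+\<omega>. Z r \<omega> \<partial>M r) / s r) \<longlongrightarrow> 1) at_top"
  proof (rule tendsto_at_topI_sequentially)
    fix R :: "nat \<Rightarrow> real" assume R: "filterlim R at_top sequentially"
    interpret tail_limit "\<lambda>n. M (max 1 (R n))" "\<lambda>n. Z (max 1 (R n))" "\<lambda>n. s (max 1 (R n))" p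
      by (rule seq[OF R])
    show "(\<lambda>n. enn2real (\<integral>\<^sup>+\<omega>. Z (R n) \<omega> \<partial>M (R n)) / s (R n)) \<longlonglongrightarrow> 1"
      by (rule Lim_transform_eventually[OF mean_tendsto])
        (use eq[OF R] in eventually_elim, simp add: E_def)
  qed
  show "((\<lambda>r. measure (M r) {\<omega> \<in> space (M r). ennreal x < Z r \<omega> / (\<integral>\<^sup>+\<omega>. Z r \<omega> \<partial>M r)}) \<longlongrightarrow> p x) at_top"
    if x: "0 \<le> x" "x = 0 \<or> isCont p x"
  proof (rule tendsto_at_topI_sequentially)
    fix R :: "nat \<Rightarrow> real" assume R: "filterlim R at_top sequentially"
    interpret tail_limit "\<lambda>n. M (max 1 (R n))" "\<lambda>n. Z (max 1 (R n))" "\<lambda>n. s (max 1 (R n))" p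
      by (rule seq[OF R])
    show "(\<lambda>n. measure (M (R n)) {\<omega> \<in> space (M (R n)). ennreal x < Z (R n) \<omega> / (\<integral>\<^sup>+\<omega>. Z (R n) \<omega> \<partial>M (R n))}) \<longlonglongrightarrow> p x"
      by (rule Lim_transform_eventually[OF ratio_tendsto[OF x]])
        (use eq[OF R] in eventually_elim, simp)
  qed
qed

section \<open>The mean as an integral of survival probabilities\<close>

context hard_core
begin

lemma prob_alive:
  "0 \<le> t \<Longrightarrow> prob (alive t) = prob {\<omega> \<in> space M. ennreal t < hitting_time X v \<omega>}"
  using hitting_time_greater alive_sets[THEN sets.sets_into_space]
  by (intro arg_cong[where f = prob]) blast

lemma prob_alive_measurable: "(\<lambda>s. prob (alive s)) \<in> borel_measurable borel"
proof -
  have "mono (\<lambda>s. - prob (alive s))"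
    by (intro monoI) (simp add: finite_measure_mono alive_antimono)
  then have "(\<lambda>s. - (- prob (alive s))) \<in> borel_measurable borel"
    by (intro borel_measurable_uminus borel_measurable_mono)
  then show ?thesis by simp
qed

text \<open>Layer-cake formula and monotone convergence over \<open>[0, n]\<close>. The integrals
  increase with \<open>b\<close>, so a bound for large \<open>b\<close> is enough.\<close>

lemma expected_hitting_time_le:
  assumes ab: "0 \<le> a" and le: "\<And>b. a < b \<Longrightarrow> integral {0..b} (\<lambda>s. prob (alive s)) \<le> C"
  shows "expected_hitting_time M X v \<le> ennreal C"
proof -
  have "expected_hitting_time M X v =
      (\<integral>\<^sup>+x. ennreal (prob {\<omega> \<in> space M. ennreal x < hitting_time X v \<omega>}) * indicator {0..} x \<partial>lborel)"
    unfolding expected_hitting_time_def by (rule layer_cake) simp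
  also have "\<dots> = (\<integral>\<^sup>+x. (SUP n::nat. ennreal (prob (alive x)) * indicator {0..real n} x) \<partial>lborel)"
  proof (rule nn_integral_cong)
    fix x :: real
    show "ennreal (prob {\<omega> \<in> space M. ennreal x < hitting_time X v \<omega>}) * indicator {0..} x =
        (SUP n::nat. ennreal (prob (alive x)) * indicator {0..real n} x)"
    proof (cases "0 \<le> x")
      case True
      obtain n :: nat where n: "x \<le> real n" using real_arch_simple by auto
      have "(SUP n::nat. ennreal (prob (alive x)) * indicator {0..real n} x) = ennreal (prob (alive x))"
      proof (rule antisym)
        show "(SUP n::nat. ennreal (prob (alive x)) * indicator {0..real n} x) \<le> ennreal (prob (alive x))"
          by (intro SUP_least) (auto simp: indicator_def)
        show "ennreal (prob (alive x)) \<le> (SUP n::nat. ennreal (prob (alive x)) * indicator {0..real n} x)"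
          using n True by (intro SUP_upper2[of n]) auto
      qed
      then show ?thesis using True prob_alive[OF True] by simp
    qed simp
  qed
  also have "\<dots> = (SUP n::nat. \<integral>\<^sup>+x. ennreal (prob (alive x)) * indicator {0..real n} x \<partial>lborel)"
  proof (rule nn_integral_monotone_convergence_SUP)
    show "incseq (\<lambda>n x. ennreal (prob (alive x)) * indicator {0..real n} x)"
      by (auto simp: incseq_def le_fun_def indicator_def)
    show "(\<lambda>x. ennreal (prob (alive x)) * indicator {0..real n} x) \<in> borel_measurable lborel" for n :: nat
      using prob_alive_measurable by measurable
  qed
  also have "\<dots> \<le> ennreal C"
  proof (rule SUP_least)
    fix n :: nat
    obtain m :: nat where m: "max a (real n) < real m" using reals_Archimedean2 by blast
    have "(\<integral>\<^sup>+x. ennreal (prob (alive x)) * indicator {0..real n} x \<partial>lborel) \<le>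
        (\<integral>\<^sup>+x. ennreal (prob (alive x) * indicator {0..real m} x) \<partial>lborel)"
      using m by (intro nn_integral_mono) (auto simp: indicator_def)
    also have "\<dots> = ennreal (integral {0..real m} (\<lambda>s. prob (alive s)))"
    proof (rule nn_integral_has_integral_lborel)
      show "(\<lambda>x. prob (alive x) * indicator {0..real m} x) \<in> borel_measurable borel"
        using prob_alive_measurable by measurable
      have "((\<lambda>x. if x \<in> {0..real m} then prob (alive x) else 0) has_integral integral {0..real m} (\<lambda>s. prob (alive s))) UNIV"
        unfolding has_integral_restrict_UNIV using prob_alive_integrable by (rule integrable_integral)
      moreover have "(\<lambda>x. if x \<in> {0..real m} then prob (alive x) else 0) = (\<lambda>x. prob (alive x) * indicator {0..real m} x)"
        by (auto simp: indicator_def)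
      ultimately show "((\<lambda>x. prob (alive x) * indicator {0..real m} x) has_integral integral {0..real m} (\<lambda>s. prob (alive s))) UNIV"
        by simp
    qed simp
    also have "\<dots> \<le> ennreal C" using m by (intro ennreal_leI le) simp
    finally show "(\<integral>\<^sup>+x. ennreal (prob (alive x)) * indicator {0..real n} x \<partial>lborel) \<le> ennreal C" .
  qed
  finally show ?thesis .
qed

lemma prob_alive_integral_split:
  "0 \<le> a \<Longrightarrow> a \<le> b \<Longrightarrow> integral {0..b} (\<lambda>s. prob (alive s)) =
    integral {0..a} (\<lambda>s. prob (alive s)) + integral {a..b} (\<lambda>s. prob (alive s))"
  using Henstock_Kurzweil_Integration.integral_combine[OF _ _ prob_alive_integrable] by metis

lemma prob_alive_integral_le: "0 \<le> a \<Longrightarrow> integral {0..a} (\<lambda>s. prob (alive s)) \<le> a"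
  using integral_le[OF prob_alive_integrable integrable_const_ivl, of 0 a 1] by simp

end

section \<open>The external model\<close>

locale external_model =
  fixes U V :: "'a set"
    and c \<rho>U \<rho>V \<gamma>U \<gamma>V \<beta> G :: real
    and gU gV :: "real \<Rightarrow> real"
    and M :: "real \<Rightarrow> 'w measure"
    and N :: "real \<Rightarrow> 'a clock \<Rightarrow> real \<Rightarrow> 'w \<Rightarrow> nat"
    and X :: "real \<Rightarrow> real \<Rightarrow> 'w \<Rightarrow> 'a set"
  assumes finite_U: "finite U" and finite_V: "finite V" and U_nonempty: "U \<noteq> {}" and V_nonempty: "V \<noteq> {}"
    and disjoint: "U \<inter> V = {}" and card_U: "card U \<ge> 2"
    and c_gt_U: "c > \<rho>U" and \<rho>U: "\<rho>U > 0" and c_gt_V: "c > \<rho>V" and \<rho>V: "\<rho>V > 0"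
    and \<gamma>_le: "\<gamma>U \<ge> \<gamma>V" and \<gamma>V: "\<gamma>V > 0"
    and gU_act: "gU \<in> activation_functions" and gV_act: "gV \<in> activation_functions"
    and dominates: "filterlim (\<lambda>x. gV x / gU x) at_top at_top"
    and \<beta>: "\<beta> > 0" and G: "G > 0"
    and gU_eq: "\<And>x. gU x = (if x > 0 then G * x powr \<beta> else 0)"
    and external_process: "\<And>r. r > 0 \<Longrightarrow>
           hard_core_process U V (external_rate U gU gV c \<rho>U \<rho>V \<gamma>U \<gamma>V r) U (M r) (N r) (X r)"
begin

abbreviation "k \<equiv> card U"
abbreviation "m \<equiv> card V"

definition d :: real where "d = c - \<rho>U"
definition \<alpha> :: real where "\<alpha> = \<beta> * (real k - 1)"
definition \<kappa> :: real where "\<kappa> = real k * G powr (- (real k - 1))"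
definition lam :: "real \<Rightarrow> real \<Rightarrow> real" where "lam r t = gU (\<gamma>U * r - d * t)"
definition mu :: "real \<Rightarrow> real \<Rightarrow> real" where "mu r t = gV (\<gamma>V * r + \<rho>V * t)"
text \<open>Here time is unscaled, whereas the function of the same name in
  \<open>tail_limit\<close> measures time in units of the scale.\<close>

definition tail :: "real \<Rightarrow> real \<Rightarrow> real" where
  "tail r t = measure (M r) {\<omega> \<in> space (M r). ennreal t < hitting_time (X r) V \<omega>}"

lemma d_pos: "0 < d" and \<gamma>U_pos: "0 < \<gamma>U" and \<alpha>_pos: "0 < \<alpha>" and \<kappa>_pos: "0 < \<kappa>"
  using c_gt_U \<gamma>_le \<gamma>V \<beta> card_U G by (auto simp: d_def \<alpha>_def \<kappa>_def)

lemma gU_pos: "0 < y \<Longrightarrow> 0 < gU y" and gU_nonneg: "0 \<le> gU y"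
  using G by (auto simp: gU_eq)

lemma gU_mono: "x \<le> y \<Longrightarrow> gU x \<le> gU y"
  using gU_act by (auto simp: activation_functions_def monoD)

lemma gV_mono: "x \<le> y \<Longrightarrow> gV x \<le> gV y"
  using gV_act by (auto simp: activation_functions_def monoD)

lemma bipartite:
  assumes r: "0 < r"
  shows "complete_bipartite U V (lam r) (mu r) (M r) (N r) (X r)"
proof
  have "external_rate U gU gV c \<rho>U \<rho>V \<gamma>U \<gamma>V r = (\<lambda>i t. if i \<in> U then lam r t else mu r t)"
    by (auto simp: external_rate_def lam_def mu_def d_def fun_eq_iff)
  then show "hard_core_process U V (\<lambda>i t. if i \<in> U then lam r t else mu r t) U (M r) (N r) (X r)"
    using external_process[OF r] by simp
  have "continuous_on UNIV gU" "continuous_on UNIV gV"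
    using gU_act gV_act by (auto simp: activation_functions_def)
  note cont = this
  show "continuous_on {0..} (lam r)"
    unfolding lam_def[abs_def] by (rule continuous_on_compose2[OF cont(1)]) (auto intro!: continuous_intros)
  show "continuous_on {0..} (mu r)"
    unfolding mu_def[abs_def] by (rule continuous_on_compose2[OF cont(2)]) (auto intro!: continuous_intros)
  show "0 \<le> lam r t" "0 \<le> mu r t" for t
    using gU_act gV_act by (auto simp: activation_functions_def lam_def mu_def)
qed (use finite_U finite_V U_nonempty V_nonempty disjoint in auto)

section \<open>Power laws and tail bounds at a fixed parameter\<close>

lemma real_k: "real (k - 1) = real k - 1"
  using card_U by (simp add: of_nat_diff)

lemma \<kappa>_eq: "\<kappa> = real k / G powr (real k - 1)"
  unfolding \<kappa>_def powr_minus_divide by simp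

lemma gU_power: "0 < y \<Longrightarrow> gU y ^ (k - 1) / real k = y powr \<alpha> / \<kappa>"
proof -
  assume y: "0 < y"
  have "gU y ^ (k - 1) = (G * y powr \<beta>) powr real (k - 1)"
    using y G by (simp add: gU_eq powr_realpow)
  also have "\<dots> = G powr (real k - 1) * y powr \<alpha>"
    unfolding real_k using y G by (simp add: powr_mult powr_powr \<alpha>_def)
  finally show ?thesis using G by (simp add: \<kappa>_eq mult.commute)
qed

text \<open>The positive argument of \<open>gU\<close> stays positive in a neighbourhood, where the
  power formula can be differentiated; at 0 a power need not be differentiable.\<close>

lemma lam_deriv:
  assumes "d * t < \<gamma>U * r"
  shows "(lam r has_real_derivative - (G * (\<beta> * (\<gamma>U * r - d * t) powr (\<beta> - 1) * d))) (at t)"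
proof -
  have "((\<lambda>t. G * (\<gamma>U * r - d * t) powr \<beta>) has_real_derivative
      G * (\<beta> * (\<gamma>U * r - d * t) powr (\<beta> - 1) * (0 - d * 1))) (at t)"
    using assms by (auto intro!: derivative_eq_intros simp: powr_diff)
  moreover have "open {t. d * t < \<gamma>U * r}"
    by (intro open_Collect_less continuous_intros)
  ultimately have "(lam r has_real_derivative G * (\<beta> * (\<gamma>U * r - d * t) powr (\<beta> - 1) * (0 - d * 1))) (at t)"
    by (rule has_field_derivative_transform_within_open) (use assms in \<open>auto simp: lam_def gU_eq\<close>)
  then show ?thesis by simp
qed

text \<open>For \<open>\<alpha> = 1\<close> the power \<open>gU y ^ (k - 1)\<close> equals
  \<open>k * y / \<kappa>\<close>, so along \<open>y = \<gamma>U * r - d * t\<close> it decreases at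
  the constant speed \<open>d * k / \<kappa>\<close>. The left side is this speed by the chain
  rule.\<close>

lemma lam_power_deriv:
  assumes "\<alpha> = 1" "0 < y"
  shows "real (k - 1) * gU y ^ (k - 2) * (G * (\<beta> * y powr (\<beta> - 1) * d)) = d * real k / \<kappa>"
proof -
  have k2: "real (k - 2) = real k - 2" using card_U by (simp add: of_nat_diff)
  have "gU y ^ (k - 2) = (G * y powr \<beta>) powr real (k - 2)"
    using assms G by (simp add: gU_eq powr_realpow)
  also have "\<dots> = G powr (real k - 2) * y powr (\<beta> * (real k - 2))"
    using assms G by (simp add: powr_mult powr_powr k2)
  finally have "gU y ^ (k - 2) * (G * y powr (\<beta> - 1)) =
      (G powr (real k - 2) * G powr 1) * (y powr (\<beta> * (real k - 2)) * y powr (\<beta> - 1))"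
    using G by (simp add: mult_ac)
  also have "\<dots> = G powr (real k - 1) * y powr (\<alpha> - 1)"
    unfolding powr_add[symmetric] \<alpha>_def by (simp add: algebra_simps)
  also have "\<dots> = real k / \<kappa>"
    using assms G card_U by (simp add: \<kappa>_eq)
  finally have 1: "gU y ^ (k - 2) * (G * y powr (\<beta> - 1)) = real k / \<kappa>" .
  have "real (k - 1) * gU y ^ (k - 2) * (G * (\<beta> * y powr (\<beta> - 1) * d)) =
      \<alpha> * d * (gU y ^ (k - 2) * (G * y powr (\<beta> - 1)))"
    unfolding \<alpha>_def real_k by (simp add: mult_ac)
  then show ?thesis using 1 assms by simp
qed

text \<open>The rate is frozen at its smallest value on \<open>[0, s]\<close>, the one at time
  \<open>s\<close>. The exit time \<open>e\<close> from one active node is the smallest among the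
  non-empty levels, so the factor \<open>exp (t / e)\<close> grows fast enough at all of
  them.\<close>

lemma tail_lower_exp:
  assumes r: "0 < r" and s: "0 < s" "d * s < \<gamma>U * r"
  shows "exp (- (s * \<kappa> / (\<gamma>U * r - d * s) powr \<alpha>)) \<le> tail r s"
proof -
  interpret complete_bipartite U V "lam r" "mu r" "M r" "N r" "X r"
    by (rule bipartite[OF r])
  define L where "L = lam r s"
  have L: "0 < L" using s by (simp add: L_def lam_def gU_pos)
  define e where "e = exit_time k 1 L"
  have e_ge: "(\<gamma>U * r - d * s) powr \<alpha> / \<kappa> \<le> e"
    using exit_time_ge[of 1 k L] gU_power[of "\<gamma>U * r - d * s"] L s card_U
    by (simp add: e_def L_def lam_def)
  have pos: "0 < (\<gamma>U * r - d * s) powr \<alpha> / \<kappa>" using s \<kappa>_pos by simp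
  then have e: "0 < e" using e_ge by linarith
  have T: "e \<le> exit_time k a L" if "1 \<le> a" for a
    unfolding e_def using L that by (intro exit_time_mono_level) auto
  have "exp (0 / e) * exit_time k k L \<le> prob (alive s) * (exp (s / e) * exit_time k k L)"
  proof (rule prob_alive_lower[where \<Phi>' = "\<lambda>t. exp (t / e) / e" and low' = "\<lambda>_. 0"])
    show "((\<lambda>t. exp (t / e)) has_real_derivative exp (t / e) / e) (at t)" for t
      using e by (auto intro!: derivative_eq_intros)
    show "L \<le> lam r t" if "t \<in> {0<..<s}" for t
      unfolding L_def lam_def using that d_pos by (intro gU_mono) simp
    show "exp (t / e) \<le> exp (t / e) / e * exit_time k a L + exp (t / e) * (exit_time_deriv k a L * 0)"
      if "a \<in> {1..k}" for t a
      using T[of a] that e by (simp add: field_simps)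
  qed (use s L e card_U in \<open>auto intro!: continuous_intros\<close>)
  moreover have "0 < exit_time k k L" using T[of k] e card_U by linarith
  ultimately have "1 \<le> prob (alive s) * exp (s / e)" by (simp add: mult.assoc[symmetric])
  then have "exp (- (s / e)) \<le> prob (alive s)" by (simp add: exp_minus field_simps)
  moreover have "s / e \<le> s / ((\<gamma>U * r - d * s) powr \<alpha> / \<kappa>)"
    by (rule divide_left_mono[OF e_ge less_imp_le[OF s(1)] mult_pos_pos[OF e pos]])
  ultimately have "exp (- (s / ((\<gamma>U * r - d * s) powr \<alpha> / \<kappa>))) \<le> prob (alive s)"
    by (meson exp_le_cancel_iff neg_le_iff_le order_trans)
  then show ?thesis using prob_alive[of s] s by (simp add: tail_def)
qed

text \<open>For \<open>\<alpha> = 1\<close> the rate changes on the scale of \<tau> and cannot be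
  frozen. The growth of \<open>y powr (- p)\<close>, with \<open>y = \<gamma>U * r - d * t\<close>,
  has to offset the unit decrease by the generator and the decline of the exit time. To leading
  order this means \<open>p * d / \<kappa> = 1 + d / \<kappa>\<close>; the extra
  \<open>e * k\<close> in \<open>p\<close> pays for the lower powers.\<close>

lemma tail_lower_power:
  assumes r: "0 < r" and s: "0 < s" "d * s < \<gamma>U * r" and \<alpha>: "\<alpha> = 1"
    and p: "p = \<kappa> / d + 1 + e * real k"
    and e0: "0 \<le> e" and e: "\<And>x a. lam r s \<le> x \<Longrightarrow> a \<in> {1..k} \<Longrightarrow>
      exit_time_deriv k a x \<le> real (k - 1) * x ^ (k - 2) * (1 / real k + e)"
  shows "(\<gamma>U * r) powr (- p) * exit_time k k (lam r 0) \<le>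
    tail r s * ((\<gamma>U * r - d * s) powr (- p) * exit_time k k (lam r s))"
proof -
  interpret complete_bipartite U V "lam r" "mu r" "M r" "N r" "X r"
    by (rule bipartite[OF r])
  let ?y = "\<lambda>t. \<gamma>U * r - d * t"
  have y: "0 < ?y t" if "t \<le> s" for t
    using mult_left_mono[OF that, of d] d_pos s by linarith
  have "?y 0 powr (- p) * exit_time k k (lam r 0) \<le> prob (alive s) * (?y s powr (- p) * exit_time k k (lam r s))"
  proof (rule prob_alive_lower[where \<Phi>' = "\<lambda>t. p * ?y t powr (- p - 1) * d"
        and low' = "\<lambda>t. - (G * (\<beta> * ?y t powr (\<beta> - 1) * d))"])
    have y_ne: "\<forall>t\<in>{0..s}. ?y t \<noteq> 0" using y by force
    show "continuous_on {0..s} (\<lambda>t. ?y t powr (- p))"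
      using y_ne by (intro continuous_intros) auto
    show "0 < ?y t powr (- p)" if "t \<in> {0..s}" for t using y[of t] that by simp
    show "continuous_on {0..s} (lam r)"
      by (rule continuous_on_subset[OF lam_cont]) auto
    show "0 \<le> lam r t" for t by (simp add: lam_def gU_nonneg)
    fix t assume t: "t \<in> {0<..<s}"
    have yt: "0 < ?y t" using y t by simp
    have "((\<lambda>t. ?y t powr (- p)) has_real_derivative - p * ?y t powr (- p - 1) * (0 - d * 1)) (at t)"
      using yt by (auto intro!: derivative_eq_intros simp: powr_diff)
    then show "((\<lambda>t. ?y t powr (- p)) has_real_derivative p * ?y t powr (- p - 1) * d) (at t)"
      by simp
    show "(lam r has_real_derivative - (G * (\<beta> * ?y t powr (\<beta> - 1) * d))) (at t)"
      using yt by (intro lam_deriv) simp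
    fix a assume a: "a \<in> {1..k}"
    let ?D = "G * (\<beta> * ?y t powr (\<beta> - 1) * d)"
    have "exit_time_deriv k a (lam r t) \<le> real (k - 1) * lam r t ^ (k - 2) * (1 / real k + e)"
      using t d_pos a by (intro e) (auto simp: lam_def intro!: gU_mono)
    then have "exit_time_deriv k a (lam r t) * ?D \<le> real (k - 1) * lam r t ^ (k - 2) * (1 / real k + e) * ?D"
      using G \<beta> d_pos by (intro mult_right_mono) auto
    also have "\<dots> = (1 / real k + e) * (real (k - 1) * gU (?y t) ^ (k - 2) * ?D)"
      by (simp add: lam_def mult_ac)
    also have "\<dots> = (1 / real k + e) * (d * real k / \<kappa>)"
      unfolding lam_power_deriv[OF \<alpha> yt] ..
    also have "\<dots> = d / \<kappa> + e * real k * d / \<kappa>"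
    proof -
      have "1 / real k * (d * real k / \<kappa>) = d / \<kappa>" using card_U by simp
      moreover have "e * (d * real k / \<kappa>) = e * real k * d / \<kappa>" by (simp add: mult_ac)
      ultimately show ?thesis by (simp only: distrib_right)
    qed
    finally have 1: "exit_time_deriv k a (lam r t) * ?D \<le> d / \<kappa> + e * real k * d / \<kappa>" .
    have "?y t / \<kappa> \<le> exit_time k a (lam r t)"
      using exit_time_ge[of a k "lam r t"] gU_power[OF yt] a \<alpha> yt card_U gU_nonneg by (simp add: lam_def)
    moreover have "0 \<le> p * ?y t powr (- p - 1) * d"
      using e0 d_pos \<kappa>_pos by (simp add: p)
    ultimately have "p * ?y t powr (- p - 1) * d * (?y t / \<kappa>) \<le> p * ?y t powr (- p - 1) * d * exit_time k a (lam r t)"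
      by (rule mult_left_mono)
    moreover have "p * ?y t powr (- p - 1) * d * (?y t / \<kappa>) = ?y t powr (- p) * (p * d / \<kappa>)"
      using yt by (simp add: powr_diff)
    moreover have "p * d / \<kappa> = 1 + (d / \<kappa> + e * real k * d / \<kappa>)"
      using d_pos \<kappa>_pos by (simp add: p field_simps)
    ultimately have 2: "?y t powr (- p) * (1 + (d / \<kappa> + e * real k * d / \<kappa>)) \<le> p * ?y t powr (- p - 1) * d * exit_time k a (lam r t)"
      by simp
    have "?y t powr (- p) * (exit_time_deriv k a (lam r t) * ?D) \<le> ?y t powr (- p) * (d / \<kappa> + e * real k * d / \<kappa>)"
      using 1 by (intro mult_left_mono) auto
    then show "?y t powr (- p) \<le> p * ?y t powr (- p - 1) * d * exit_time k a (lam r t) +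
        ?y t powr (- p) * (exit_time_deriv k a (lam r t) * - ?D)"
      using 2 by (simp add: distrib_left)
  qed (use s card_U in auto)
  then show ?thesis using prob_alive[of s] s by (simp add: tail_def)
qed

section \<open>Upper bounds on the mean at a fixed parameter\<close>

lemma expected_upper:
  assumes r: "0 < r" and mu: "2 * real m + 2 \<le> gV (\<gamma>V * r)"
    and before: "integral {0..\<gamma>U * r / d} (\<lambda>s. measure (M r) (hard_core.alive V (M r) (X r) s)) \<le> C"
  shows "expected_hitting_time (M r) (X r) V \<le> ennreal (C + (exit_time k k 0 + 2 * 2 ^ m))"
proof -
  interpret complete_bipartite U V "lam r" "mu r" "M r" "N r" "X r"
    by (rule bipartite[OF r])
  let ?T = "\<gamma>U * r / d"
  have T: "0 \<le> ?T" using r d_pos \<gamma>U_pos by simp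
  have lam0: "lam r t = 0" if "?T \<le> t" for t
    using that d_pos by (simp add: lam_def gU_eq field_simps)
  show ?thesis
  proof (rule expected_hitting_time_le[OF T])
    fix b assume b: "?T < b"
    \<comment> \<open>From \<open>?T\<close> on, the activation rate of \<open>U\<close> is zero, so
      the choice \<open>A = 1\<close>, \<open>L = 0\<close>, \<open>B = 2 ^ m\<close> bounds the
      remaining mean by a constant that does not depend on \<open>r\<close>.\<close>
    have "integral {?T..b} (\<lambda>s. prob (alive s)) \<le> 1 * exit_time k k 0 + 2 * 2 ^ m"
    proof (rule integral_alive_upper[where \<mu> = "gV (\<gamma>V * r)" and lam' = "\<lambda>_. 0"])
      show "gV (\<gamma>V * r) \<le> mu r t" if "t \<in> {?T..b}" for t
      proof -
        have "0 \<le> t" using that T by auto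
        then show ?thesis unfolding mu_def using \<rho>V by (intro gV_mono) simp
      qed
      show "lam r t \<le> 0" if "t \<in> {?T..b}" for t using lam0 that by simp
      show "real k * 0 * (1 * exit_step k 1 0) + 1 \<le> gV (\<gamma>V * r) * 2 ^ m / 2"
        using mult_mono[of 2 "gV (\<gamma>V * r)" 1 "2 ^ m :: real"] mu by simp
      show "(lam r has_real_derivative 0) (at t)" if "t \<in> {?T<..<b}" for t
        by (rule has_field_derivative_transform_within_open[of "\<lambda>_. 0" _ _ "{?T<..<b}"]) (use that lam0 in auto)
    qed (use T b mu card_U in auto)
    then show "integral {0..b} (\<lambda>s. prob (alive s)) \<le> C + (exit_time k k 0 + 2 * 2 ^ m)"
      using prob_alive_integral_split[OF T, of b] b before by simp
  qed
qed

text \<open>Bounding the survival probability by 1 up to the time at which the rate vanishes loses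
  nothing to leading order when \<open>\<alpha> > 1\<close>.\<close>

lemma expected_upper_trivial:
  assumes r: "0 < r" and mu: "2 * real m + 2 \<le> gV (\<gamma>V * r)"
  shows "expected_hitting_time (M r) (X r) V \<le> ennreal (\<gamma>U * r / d + (exit_time k k 0 + 2 * 2 ^ m))"
proof (rule expected_upper[OF r mu])
  interpret complete_bipartite U V "lam r" "mu r" "M r" "N r" "X r"
    by (rule bipartite[OF r])
  show "integral {0..\<gamma>U * r / d} (\<lambda>s. prob (alive s)) \<le> \<gamma>U * r / d"
    using r d_pos \<gamma>U_pos by (intro prob_alive_integral_le) simp
qed

text \<open>\<open>A = 1\<close> ignores the decline of the rate, which is sharp for
  \<open>\<alpha> < 1\<close>. For \<open>\<alpha> = 1\<close> the decline contributes the drift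
  \<open>d / \<kappa>\<close>, and \<open>A * (1 + d / \<kappa>) = 1\<close> gives the other choice.
  \<open>B\<close> is the amount needed inside \<open>V\<close> plus an amount that settles the
  empty configuration.\<close>

lemma expected_upper_exit:
  assumes r: "0 < r" and mu: "2 * real m + 2 \<le> gV (\<gamma>V * r)"
    and A: "A = 1 \<or> \<alpha> = 1 \<and> A = \<kappa> / (\<kappa> + d)"
    and B: "B = 2 ^ m + 2 * (real k * lam r 0 * (A * exit_step k 1 (lam r 0)) + 1) / gV (\<gamma>V * r)"
  shows "expected_hitting_time (M r) (X r) V \<le>
    ennreal (A * exit_time k k (lam r 0) + 2 * B + (exit_time k k 0 + 2 * 2 ^ m))"
proof (rule expected_upper[OF r mu])
  interpret complete_bipartite U V "lam r" "mu r" "M r" "N r" "X r"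
    by (rule bipartite[OF r])
  let ?T = "\<gamma>U * r / d"
  have T: "0 < ?T" using r d_pos \<gamma>U_pos by simp
  have A0: "0 < A" using A \<kappa>_pos d_pos by auto
  have mu0: "0 < gV (\<gamma>V * r)" using mu by linarith
  have lam00: "0 \<le> lam r t" for t by (simp add: lam_def gU_nonneg)
  have y: "0 < \<gamma>U * r - d * t" if "t < ?T" for t using that d_pos by (simp add: field_simps)
  let ?D = "\<lambda>t. G * (\<beta> * (\<gamma>U * r - d * t) powr (\<beta> - 1) * d)"
  have D: "0 \<le> ?D t" for t using G \<beta> d_pos by simp
  have pos: "0 \<le> real k * lam r 0 * (A * exit_step k 1 (lam r 0))"
    using A0 lam00 by (intro mult_nonneg_nonneg exit_step_nonneg) auto
  show "integral {0..?T} (\<lambda>s. prob (alive s)) \<le> A * exit_time k k (lam r 0) + 2 * B"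
  proof (rule integral_alive_upper[where \<mu> = "gV (\<gamma>V * r)" and lam' = "\<lambda>t. - ?D t"])
    show "2 ^ m \<le> B" using B pos mu0 by simp
    show "gV (\<gamma>V * r) \<le> mu r t" if "t \<in> {0..?T}" for t
      unfolding mu_def using \<rho>V that by (intro gV_mono) simp
    show "lam r t \<le> lam r 0" if "t \<in> {0..?T}" for t
      unfolding lam_def using that d_pos by (intro gU_mono) simp
    show "real k * lam r 0 * (A * exit_step k 1 (lam r 0)) + 1 \<le> gV (\<gamma>V * r) * B / 2"
      using mu0 unfolding B by (simp add: field_simps)
    show "(lam r has_real_derivative - ?D t) (at t)" if "t \<in> {0<..<?T}" for t
      using y[of t] that by (intro lam_deriv) simp
    show "1 \<le> A * (1 - real (k - 1) * lam r t ^ (k - 2) / real k * - ?D t)" if t: "t \<in> {0<..<?T}" for t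
      using A
    proof
      assume "A = 1"
      then show ?thesis using D[of t] lam00 by simp
    next
      assume a: "\<alpha> = 1 \<and> A = \<kappa> / (\<kappa> + d)"
      have "real (k - 1) * lam r t ^ (k - 2) / real k * ?D t = (real (k - 1) * gU (\<gamma>U * r - d * t) ^ (k - 2) * ?D t) / real k"
        by (simp add: lam_def)
      also have "\<dots> = d / \<kappa>"
        using lam_power_deriv[of "\<gamma>U * r - d * t"] a y[of t] t card_U by simp
      finally have "A * (1 - real (k - 1) * lam r t ^ (k - 2) / real k * - ?D t) = A * (1 + d / \<kappa>)" by simp
      also have "\<dots> = 1" using a \<kappa>_pos d_pos by (simp add: field_simps)
      finally show ?thesis by simp
    qed
  qed (use T A0 mu D card_U in auto)
qed

end

section \<open>Asymptotics of the bounds\<close>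

context external_model
begin

lemma filterlim_mult_at_top: "0 < a \<Longrightarrow> filterlim (\<lambda>r. a * r :: real) at_top at_top"
  by (intro filterlim_tendsto_pos_mult_at_top[OF tendsto_const] filterlim_ident)

lemma gU_at_top: "filterlim gU at_top at_top" and gV_at_top: "filterlim gV at_top at_top"
  using gU_act gV_act by (auto simp: activation_functions_def)

lemma gV_start_at_top: "filterlim (\<lambda>r. gV (\<gamma>V * r)) at_top at_top"
  by (rule filterlim_compose[OF gV_at_top filterlim_mult_at_top[OF \<gamma>V]])

lemma lam_start_at_top: "filterlim (\<lambda>r. lam r 0) at_top at_top"
  unfolding lam_def using filterlim_compose[OF gU_at_top filterlim_mult_at_top[OF \<gamma>U_pos]] by simp

text \<open>The domination compares both functions at the same argument; the power law of
  \<open>gU\<close> converts \<open>\<gamma>U * r\<close> into \<open>\<gamma>V * r\<close> at the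
  cost of a constant factor.\<close>

lemma rate_ratio: "((\<lambda>r. lam r 0 / gV (\<gamma>V * r)) \<longlongrightarrow> 0) at_top"
proof -
  have "filterlim (\<lambda>r. gV (\<gamma>V * r) / gU (\<gamma>V * r)) at_top at_top"
    by (rule filterlim_compose[OF dominates filterlim_mult_at_top[OF \<gamma>V]])
  then have "((\<lambda>r. (\<gamma>U / \<gamma>V) powr \<beta> * inverse (gV (\<gamma>V * r) / gU (\<gamma>V * r))) \<longlongrightarrow> (\<gamma>U / \<gamma>V) powr \<beta> * 0) at_top"
    by (intro tendsto_mult tendsto_const tendsto_inverse_0_at_top)
  then have "((\<lambda>r. (\<gamma>U / \<gamma>V) powr \<beta> * inverse (gV (\<gamma>V * r) / gU (\<gamma>V * r))) \<longlongrightarrow> 0) at_top" by simp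
  then show ?thesis
  proof (rule Lim_transform_eventually)
    show "eventually (\<lambda>r. (\<gamma>U / \<gamma>V) powr \<beta> * inverse (gV (\<gamma>V * r) / gU (\<gamma>V * r)) = lam r 0 / gV (\<gamma>V * r)) at_top"
      using eventually_gt_at_top[of 0]
    proof eventually_elim
      case (elim r)
      have "lam r 0 = G * (\<gamma>U / \<gamma>V * (\<gamma>V * r)) powr \<beta>"
        using elim \<gamma>U_pos \<gamma>V by (simp add: lam_def gU_eq)
      also have "\<dots> = (\<gamma>U / \<gamma>V) powr \<beta> * gU (\<gamma>V * r)"
        using elim \<gamma>U_pos \<gamma>V by (subst powr_mult) (auto simp: gU_eq)
      finally show ?case by simp
    qed
  qed
qed

text \<open>After division by \<open>lam r 0 ^ (k - 1)\<close> only the exit time survives. The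
  delicate term, from the return to \<open>U\<close>, has the size of an exit time multiplied by the
  ratio of the rates, which tends to 0.\<close>

lemma mean_upper:
  assumes A: "A = 1 \<or> \<alpha> = 1 \<and> A = \<kappa> / (\<kappa> + d)" and e: "0 < e"
  shows "eventually (\<lambda>r. expected_hitting_time (M r) (X r) V \<le> ennreal ((1 + e) * (A * ((\<gamma>U * r) powr \<alpha> / \<kappa>)))) at_top"
proof -
  have A0: "0 < A" using A \<kappa>_pos d_pos by auto
  let ?l = "\<lambda>r. lam r 0" and ?\<mu> = "\<lambda>r. gV (\<gamma>V * r)"
  let ?p = "\<lambda>r. ?l r ^ (k - 1)"
  let ?Q = "exit_time k k 0 + 2 * 2 ^ m"
  let ?B = "\<lambda>r. 2 ^ m + 2 * (real k * ?l r * (A * exit_step k 1 (?l r)) + 1) / ?\<mu> r"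
  have p: "((\<lambda>r. 1 / ?p r) \<longlongrightarrow> 0) at_top"
    using card_U by (intro tendsto_divide_0[OF tendsto_const] filterlim_at_top_imp_at_infinity
        filterlim_pow_at_top lam_start_at_top) auto
  have \<mu>: "((\<lambda>r. 1 / ?\<mu> r) \<longlongrightarrow> 0) at_top"
    by (intro tendsto_divide_0[OF tendsto_const] filterlim_at_top_imp_at_infinity gV_start_at_top)
  have T: "((\<lambda>r. exit_time k a (?l r) / ?p r) \<longlongrightarrow> 1 / real k) at_top" if "1 \<le> a" for a
    using filterlim_compose[OF exit_time_asymp[OF that card_U] lam_start_at_top] .
  have "((\<lambda>r. A * (exit_time k k (?l r) / ?p r) + 2 * 2 ^ m * (1 / ?p r)
      + 4 * (real k * A) * (?l r / ?\<mu> r) * (exit_time k 1 (?l r) / ?p r)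
      + 4 * (1 / ?\<mu> r) * (1 / ?p r) + ?Q * (1 / ?p r)) \<longlongrightarrow>
      A * (1 / real k) + 2 * 2 ^ m * 0 + 4 * (real k * A) * 0 * (1 / real k) + 4 * 0 * 0 + ?Q * 0) at_top"
    using card_U by (intro tendsto_intros p \<mu> T rate_ratio) auto
  then have "((\<lambda>r. A * (exit_time k k (?l r) / ?p r) + 2 * 2 ^ m * (1 / ?p r)
      + 4 * (real k * A) * (?l r / ?\<mu> r) * (exit_time k 1 (?l r) / ?p r)
      + 4 * (1 / ?\<mu> r) * (1 / ?p r) + ?Q * (1 / ?p r)) \<longlongrightarrow> A / real k) at_top"
    by simp
  moreover have "A / real k < (1 + e) * (A / real k)"
    using mult_strict_right_mono[of 1 "1 + e" "A / real k"] A0 e U_nonempty finite_U by (simp add: card_gt_0_iff)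
  ultimately have "eventually (\<lambda>r. A * (exit_time k k (?l r) / ?p r) + 2 * 2 ^ m * (1 / ?p r)
      + 4 * (real k * A) * (?l r / ?\<mu> r) * (exit_time k 1 (?l r) / ?p r)
      + 4 * (1 / ?\<mu> r) * (1 / ?p r) + ?Q * (1 / ?p r) < (1 + e) * (A / real k)) at_top"
    by (rule order_tendstoD(2))
  moreover have "eventually (\<lambda>r. 2 * real m + 2 \<le> ?\<mu> r) at_top"
    using gV_start_at_top unfolding filterlim_at_top by blast
  ultimately show ?thesis
    using eventually_gt_at_top[of 0]
  proof eventually_elim
    case (elim r)
    have lpos: "0 < ?p r" using elim(3) \<gamma>U_pos by (simp add: lam_def gU_pos)
    have "A * exit_time k k (?l r) + 2 * ?B r + ?Q =
        ?p r * (A * (exit_time k k (?l r) / ?p r) + 2 * 2 ^ m * (1 / ?p r)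
      + 4 * (real k * A) * (?l r / ?\<mu> r) * (exit_time k 1 (?l r) / ?p r)
      + 4 * (1 / ?\<mu> r) * (1 / ?p r) + ?Q * (1 / ?p r))"
    proof -
      have "A * t + 2 * (b + 2 * (n * l * (A * x) + 1) / \<mu>) + Q =
          P * (A * (t / P) + 2 * b * (1 / P) + 4 * (n * A) * (l / \<mu>) * (x / P) + 4 * (1 / \<mu>) * (1 / P) + Q * (1 / P))"
        if "0 < P" "0 < \<mu>" for t b n l x \<mu> Q P :: real
        using that by (simp add: field_simps)
      moreover have "0 < ?\<mu> r" using elim(2) by linarith
      ultimately show ?thesis unfolding exit_time_1 using lpos by blast
    qed
    also have "\<dots> \<le> ?p r * ((1 + e) * (A / real k))"
      using elim(1) lpos by (intro mult_left_mono) auto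
    also have "\<dots> = (1 + e) * (A * (gU (\<gamma>U * r) ^ (k - 1) / real k))"
      by (simp add: lam_def mult_ac)
    also have "\<dots> = (1 + e) * (A * ((\<gamma>U * r) powr \<alpha> / \<kappa>))"
      using gU_power[of "\<gamma>U * r"] elim(3) \<gamma>U_pos by simp
    finally have "A * exit_time k k (?l r) + 2 * ?B r + ?Q \<le> (1 + e) * (A * ((\<gamma>U * r) powr \<alpha> / \<kappa>))" .
    moreover have "expected_hitting_time (M r) (X r) V \<le> ennreal (A * exit_time k k (?l r) + 2 * ?B r + ?Q)"
      by (rule expected_upper_exit[OF elim(3,2) A refl])
    ultimately show ?case by (meson ennreal_leI order_trans)
  qed
qed

lemma mean_upper_trivial:
  assumes e: "0 < e"
  shows "eventually (\<lambda>r. expected_hitting_time (M r) (X r) V \<le> ennreal ((1 + e) * (\<gamma>U * r / d))) at_top"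
proof -
  let ?Q = "exit_time k k 0 + 2 * 2 ^ m"
  have "eventually (\<lambda>r. ?Q \<le> e * \<gamma>U / d * r) at_top"
    using filterlim_mult_at_top[of "e * \<gamma>U / d"] e \<gamma>U_pos d_pos unfolding filterlim_at_top by simp
  moreover have "eventually (\<lambda>r. 2 * real m + 2 \<le> gV (\<gamma>V * r)) at_top"
    using gV_start_at_top unfolding filterlim_at_top by blast
  ultimately show ?thesis
    using eventually_gt_at_top[of 0]
  proof eventually_elim
    case (elim r)
    have "\<gamma>U * r / d + ?Q \<le> (1 + e) * (\<gamma>U * r / d)"
    proof -
      have "(1 + e) * (\<gamma>U * r / d) = \<gamma>U * r / d + e * \<gamma>U / d * r"
      proof -
        have "e * (\<gamma>U * r / d) = e * \<gamma>U / d * r" by simp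
        then show ?thesis by (simp only: distrib_right mult_1)
      qed
      then show ?thesis using elim(1) by linarith
    qed
    with expected_upper_trivial[OF elim(3,2)] show ?case by (meson ennreal_leI order_trans)
  qed
qed

lemma tail_0: "0 < r \<Longrightarrow> tail r 0 = 1"
proof -
  assume r: "0 < r"
  interpret complete_bipartite U V "lam r" "mu r" "M r" "N r" "X r"
    by (rule bipartite[OF r])
  show ?thesis using prob_alive[of 0] alive_0 prob_space by (simp add: tail_def)
qed

lemma tail_nonneg: "0 \<le> tail r t"
  by (simp add: tail_def)

lemma eventually_tail_0: "0 < e \<Longrightarrow> q \<le> 1 \<Longrightarrow> eventually (\<lambda>r. q - e < tail r (0 * s r)) at_top"
  using eventually_gt_at_top[of 0] by eventually_elim (simp add: tail_0)

text \<open>With \<open>y0 = \<gamma>U * r\<close>, time \<open>x\<close> in units of the scale uses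
  up the fraction \<open>d * x / \<kappa> * y0 powr (\<alpha> - 1)\<close> of \<open>y0\<close>.
  This vanishes, so freezing the rate at its final value costs nothing in the limit.\<close>

lemma tail_lower_subcritical:
  assumes \<alpha>: "\<alpha> < 1" and x: "0 < x" and e: "0 < e"
  shows "eventually (\<lambda>r. exp (- x) - e < tail r (x * ((\<gamma>U * r) powr \<alpha> / \<kappa>))) at_top"
proof -
  let ?s = "\<lambda>r. x * ((\<gamma>U * r) powr \<alpha> / \<kappa>)"
  let ?q = "\<lambda>r. 1 - d * x / \<kappa> * (\<gamma>U * r) powr (\<alpha> - 1)"
  have "((\<lambda>y. y powr (\<alpha> - 1)) \<longlongrightarrow> 0) at_top"
    using \<alpha> by (intro tendsto_neg_powr filterlim_ident) auto
  then have "((\<lambda>r. (\<gamma>U * r) powr (\<alpha> - 1)) \<longlongrightarrow> 0) at_top"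
    by (rule filterlim_compose[OF _ filterlim_mult_at_top[OF \<gamma>U_pos]])
  then have "(?q \<longlongrightarrow> 1 - d * x / \<kappa> * 0) at_top"
    by (intro tendsto_intros)
  then have q: "(?q \<longlongrightarrow> 1) at_top" by simp
  then have "((\<lambda>r. exp (- (x / ?q r powr \<alpha>))) \<longlongrightarrow> exp (- (x / 1 powr \<alpha>))) at_top"
    by (intro tendsto_intros) auto
  then have "((\<lambda>r. exp (- (x / ?q r powr \<alpha>))) \<longlongrightarrow> exp (- x)) at_top" by simp
  then have "eventually (\<lambda>r. exp (- x) - e < exp (- (x / ?q r powr \<alpha>))) at_top"
    using e by (intro order_tendstoD) auto
  moreover have "eventually (\<lambda>r. 0 < ?q r) at_top"
    by (rule order_tendstoD[OF q]) simp
  ultimately show ?thesis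
    using eventually_gt_at_top[of 0]
  proof eventually_elim
    case (elim r)
    have y: "0 < \<gamma>U * r" using elim(3) \<gamma>U_pos by simp
    have yq: "\<gamma>U * r - d * ?s r = \<gamma>U * r * ?q r"
      using y by (simp add: powr_diff right_diff_distrib mult_ac)
    have "0 < ?s r" using x y \<kappa>_pos by (intro mult_pos_pos divide_pos_pos) auto
    moreover have "d * ?s r < \<gamma>U * r" using mult_pos_pos[OF y elim(2)] yq by linarith
    ultimately have main: "exp (- (?s r * \<kappa> / (\<gamma>U * r - d * ?s r) powr \<alpha>)) \<le> tail r (?s r)"
      by (rule tail_lower_exp[OF elim(3)])
    have eq: "?s r * \<kappa> / (\<gamma>U * r - d * ?s r) powr \<alpha> = x / ?q r powr \<alpha>"
    proof -
      have "(\<gamma>U * r - d * ?s r) powr \<alpha> = (\<gamma>U * r) powr \<alpha> * ?q r powr \<alpha>"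
        unfolding yq by (rule powr_mult)
      then show ?thesis using y \<gamma>U_pos elim(3) \<kappa>_pos by simp
    qed
    show ?case by (rule less_le_trans[OF elim(1) main[unfolded eq]])
  qed
qed

text \<open>With \<open>y0 = \<gamma>U * r\<close>, the fraction \<open>1 - x\<close> of
  \<open>y0\<close> remains, so the exit time is still of order \<open>y0 powr \<alpha>\<close>, far
  above the elapsed time of order \<open>y0\<close>.\<close>

lemma tail_lower_supercritical:
  assumes \<alpha>: "1 < \<alpha>" and x: "0 < x" "x < 1" and e: "0 < e"
  shows "eventually (\<lambda>r. 1 - e < tail r (x * (\<gamma>U * r / d))) at_top"
proof -
  let ?K = "x * \<kappa> / (d * (1 - x) powr \<alpha>)"
  have "((\<lambda>y. y powr (1 - \<alpha>)) \<longlongrightarrow> 0) at_top"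
    using \<alpha> by (intro tendsto_neg_powr filterlim_ident) auto
  then have "((\<lambda>r. (\<gamma>U * r) powr (1 - \<alpha>)) \<longlongrightarrow> 0) at_top"
    by (rule filterlim_compose[OF _ filterlim_mult_at_top[OF \<gamma>U_pos]])
  then have "((\<lambda>r. exp (- (?K * (\<gamma>U * r) powr (1 - \<alpha>)))) \<longlongrightarrow> exp (- (?K * 0))) at_top"
    by (intro tendsto_intros)
  then have "eventually (\<lambda>r. 1 - e < exp (- (?K * (\<gamma>U * r) powr (1 - \<alpha>)))) at_top"
    using e by (intro order_tendstoD) auto
  then show ?thesis
    using eventually_gt_at_top[of 0]
  proof eventually_elim
    case (elim r)
    have y: "0 < \<gamma>U * r" using elim(2) \<gamma>U_pos by simp
    let ?s = "x * (\<gamma>U * r / d)"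
    have yq: "\<gamma>U * r - d * ?s = \<gamma>U * r * (1 - x)"
      using d_pos by (simp add: field_simps)
    have "0 < ?s" using x y d_pos by simp
    moreover have "d * ?s < \<gamma>U * r" using x mult_pos_pos[OF y, of "1 - x"] yq by linarith
    ultimately have main: "exp (- (?s * \<kappa> / (\<gamma>U * r - d * ?s) powr \<alpha>)) \<le> tail r ?s"
      by (rule tail_lower_exp[OF elim(2)])
    have eq: "?s * \<kappa> / (\<gamma>U * r - d * ?s) powr \<alpha> = ?K * (\<gamma>U * r) powr (1 - \<alpha>)"
    proof -
      have "(\<gamma>U * r - d * ?s) powr \<alpha> = (\<gamma>U * r) powr \<alpha> * (1 - x) powr \<alpha>"
        unfolding yq by (rule powr_mult)
      then show ?thesis using y x by (simp add: powr_diff field_simps)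
    qed
    show ?case by (rule less_le_trans[OF elim(1) main[unfolded eq]])
  qed
qed

text \<open>\<open>w\<close> is the fraction of \<open>\<gamma>U * r\<close> that remains. The power
  bound gives \<open>w powr p\<close> times the ratio of the initial to the final exit time, about
  \<open>1 / w\<close>, so the exponent becomes \<open>p - 1\<close>, that is
  \<open>\<kappa> / d\<close> up to a small error.\<close>

lemma tail_lower_critical:
  assumes \<alpha>: "\<alpha> = 1" and w: "0 < w" "w < 1" and e: "0 < e"
  shows "eventually (\<lambda>r. w powr (\<kappa> / d) - e < tail r ((1 - w) * (\<gamma>U * r / d))) at_top"
proof -
  \<comment> \<open>The error \<open>\<epsilon>\<close> is fixed first, by continuity in the
    exponent; the rate is then made large enough for the derivative bound with this
    \<open>\<epsilon>\<close>.\<close>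
  have "((\<lambda>\<epsilon>. w powr (\<kappa> / d + \<epsilon> * real k)) \<longlongrightarrow> w powr (\<kappa> / d + 0 * real k)) (at_right 0)"
    using w by (intro tendsto_intros) auto
  then have "eventually (\<lambda>\<epsilon>. w powr (\<kappa> / d) - e < w powr (\<kappa> / d + \<epsilon> * real k)) (at_right 0)"
    using e by (intro order_tendstoD) auto
  then have "eventually (\<lambda>\<epsilon>. w powr (\<kappa> / d) - e < w powr (\<kappa> / d + \<epsilon> * real k) \<and> 0 < \<epsilon>) (at_right 0)"
    using eventually_at_right_less by (rule eventually_conj)
  then obtain \<epsilon> where \<epsilon>: "w powr (\<kappa> / d) - e < w powr (\<kappa> / d + \<epsilon> * real k)" "0 < \<epsilon>"
    using eventually_happens trivial_limit_at_right_real by blast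
  define p where "p = \<kappa> / d + 1 + \<epsilon> * real k"
  obtain L where L: "\<And>x. L \<le> x \<Longrightarrow> \<forall>a\<in>{1..k}. exit_time_deriv k a x \<le> real (k - 1) * x ^ (k - 2) * (1 / real k + \<epsilon>)"
    using exit_time_deriv_le[OF card_U \<epsilon>(2)] unfolding eventually_at_top_linorder by blast
  let ?l = "\<lambda>r. gU (\<gamma>U * w * r)"
  have l: "filterlim ?l at_top at_top"
    using w \<gamma>U_pos by (intro filterlim_compose[OF gU_at_top filterlim_mult_at_top]) simp
  have "((\<lambda>r. exit_time k k (?l r) / ?l r ^ (k - 1)) \<longlongrightarrow> 1 / real k) at_top"
    using card_U by (intro filterlim_compose[OF exit_time_asymp l]) auto
  then have "((\<lambda>r. w powr (p - 1) * (1 / real k / (exit_time k k (?l r) / ?l r ^ (k - 1)))) \<longlongrightarrow>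
      w powr (p - 1) * (1 / real k / (1 / real k))) at_top"
    using card_U by (intro tendsto_mult[OF tendsto_const tendsto_divide[OF tendsto_const]]) auto
  then have "((\<lambda>r. w powr (p - 1) * (1 / real k / (exit_time k k (?l r) / ?l r ^ (k - 1)))) \<longlongrightarrow> w powr (p - 1)) at_top"
    using card_U by simp
  then have "eventually (\<lambda>r. w powr (\<kappa> / d) - e < w powr (p - 1) * (1 / real k / (exit_time k k (?l r) / ?l r ^ (k - 1)))) at_top"
    using \<epsilon>(1) by (intro order_tendstoD(1)[of _ "w powr (p - 1)"]) (auto simp: p_def)
  \<comment> \<open>\<open>?l r\<close> is the rate at the final time. As the rate does not
    increase, it is at least \<open>L\<close> at all earlier times.\<close>
  moreover have "eventually (\<lambda>r. L \<le> ?l r) at_top"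
    using l unfolding filterlim_at_top by blast
  ultimately show ?thesis
    using eventually_gt_at_top[of 0]
  proof eventually_elim
    case (elim r)
    have y: "0 < \<gamma>U * r" using elim(3) \<gamma>U_pos by simp
    let ?s = "(1 - w) * (\<gamma>U * r / d)"
    have yq: "\<gamma>U * r - d * ?s = \<gamma>U * r * w" using d_pos by (simp add: field_simps)
    have ls: "lam r ?s = ?l r" unfolding lam_def yq by (simp add: mult_ac)
    have yw: "0 < \<gamma>U * r * w" using y w by simp
    have s: "0 < ?s" using w y d_pos by simp
    have "d * ?s < \<gamma>U * r" using yw yq by linarith
    then have main: "(\<gamma>U * r) powr (- p) * exit_time k k (lam r 0) \<le>
        tail r ?s * ((\<gamma>U * r * w) powr (- p) * exit_time k k (?l r))"
      unfolding yq[symmetric] ls[symmetric]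
      by (rule tail_lower_power[OF elim(3) s _ \<alpha> p_def]) (use \<epsilon>(2) L elim(2) ls in auto)
    let ?T = "exit_time k k (?l r)"
    have lw: "?l r ^ (k - 1) / real k = \<gamma>U * r * w / \<kappa>"
      using gU_power[OF yw] \<alpha> yw by (simp add: mult_ac)
    have T: "\<gamma>U * r * w / \<kappa> \<le> ?T"
      using exit_time_ge[of k k "?l r"] card_U gU_nonneg unfolding lw by simp
    have Tpos: "0 < ?T" using T divide_pos_pos[OF yw \<kappa>_pos] by linarith
    have "\<gamma>U * r / \<kappa> \<le> exit_time k k (lam r 0)"
      using exit_time_ge[of k k "lam r 0"] card_U gU_nonneg gU_power[OF y] y \<alpha> by (simp add: lam_def)
    then have "(\<gamma>U * r) powr (- p) * (\<gamma>U * r / \<kappa>) \<le> (\<gamma>U * r) powr (- p) * exit_time k k (lam r 0)"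
      by (intro mult_left_mono) auto
    also note main
    also have "(\<gamma>U * r * w) powr (- p) = (\<gamma>U * r) powr (- p) * w powr (- p)"
      by (rule powr_mult)
    finally have "(\<gamma>U * r) powr (- p) * (\<gamma>U * r / \<kappa>) \<le> (\<gamma>U * r) powr (- p) * (tail r ?s * (w powr (- p) * ?T))"
      by (simp only: mult_ac)
    then have 1: "\<gamma>U * r / \<kappa> \<le> tail r ?s * (w powr (- p) * ?T)"
      using y by (subst (asm) mult_le_cancel_left_pos) auto
    have "w powr (p - 1) * (1 / real k / (?T / ?l r ^ (k - 1))) = w powr (p - 1) * ((?l r ^ (k - 1) / real k) / ?T)"
      by simp
    also have "\<dots> = w powr (p - 1) * w * (\<gamma>U * r / \<kappa>) / ?T"
      unfolding lw by simp
    also have "w powr (p - 1) * w = w powr p"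
      using w by (simp add: powr_diff)
    also have "w powr p * (\<gamma>U * r / \<kappa>) / ?T \<le> w powr p * (tail r ?s * (w powr (- p) * ?T)) / ?T"
      using 1 Tpos by (intro divide_right_mono mult_left_mono) auto
    also have "\<dots> = tail r ?s"
      using w Tpos by (simp add: powr_minus)
    finally show ?case using elim(1) by linarith
  qed
qed

end

section \<open>Mass of the limit tails\<close>

lemma integral_exp_tail: "(\<integral>\<^sup>+x. ennreal (exp (- x)) * indicator {0..} x \<partial>lborel) = 1"
proof -
  have "(\<integral>\<^sup>+x. ennreal (exp (- x)) * indicator {0..} x \<partial>lborel) = ennreal (0 - (- exp (- 0)))"
  proof (rule nn_integral_FTC_atLeast)
    show "((\<lambda>x. - exp (- x)) has_real_derivative exp (- x)) (at x)" for x :: real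
      by (auto intro!: derivative_eq_intros)
    have "((\<lambda>x::real. - exp (- x)) \<longlongrightarrow> - 0) at_top"
      by (intro tendsto_minus filterlim_compose[OF exp_at_bot filterlim_uminus_at_bot_at_top])
    then show "((\<lambda>x::real. - exp (- x)) \<longlongrightarrow> 0) at_top" by simp
  qed auto
  then show ?thesis by simp
qed

lemma integral_unit_step_tail:
  "(\<integral>\<^sup>+x. ennreal (if x < 1 then 1 else 0) * indicator {0::real..} x \<partial>lborel) = 1"
proof -
  have "(\<integral>\<^sup>+x. ennreal (if x < 1 then 1 else 0) * indicator {0::real..} x \<partial>lborel) = (\<integral>\<^sup>+x. indicator {0..<1::real} x \<partial>lborel)"
    by (intro nn_integral_cong) (auto simp: indicator_def)
  then show ?thesis by simp
qed

text \<open>\<open>C * (q + 1) = 1\<close> normalizes the mean of the limit law to 1. Truncation at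
  0 together with \<open>0 powr q = 0\<close> yields the zero branch of the limit tail without a
  case distinction.\<close>

lemma integral_power_tail:
  fixes C q :: real
  assumes C: "0 < C" and q: "0 < q" and Cq: "C * (q + 1) = 1"
  shows "(\<integral>\<^sup>+x. ennreal (max 0 (1 - C * x) powr q) * indicator {0..} x \<partial>lborel) = 1"
proof -
  let ?f = "\<lambda>x. max 0 (1 - C * x) powr q"
  have f0: "?f x = 0" if "1 / C \<le> x" for x
    using that C by (simp add: max_def field_simps)
  have "(\<integral>\<^sup>+x. ennreal (?f x) * indicator {0..} x \<partial>lborel) = (\<integral>\<^sup>+x. ennreal (?f x * indicator {0..1 / C} x) \<partial>lborel)"
    using f0 by (intro nn_integral_cong) (auto simp: indicator_def)
  also have "\<dots> = ennreal 1"
  proof (rule nn_integral_has_integral_lborel)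
    show "(\<lambda>x. ?f x * indicator {0..1 / C} x) \<in> borel_measurable borel" by measurable
    \<comment> \<open>The power rule is used where the base is positive, that is in the interior;
      continuity covers the endpoint \<open>1 / C\<close>.\<close>
    have "(?f has_integral - ((1 - C * (1 / C)) powr (q + 1)) - - ((1 - C * 0) powr (q + 1))) {0..1 / C}"
    proof (rule fundamental_theorem_of_calculus_interior)
      show "0 \<le> 1 / C" using C by simp
      show "continuous_on {0..1 / C} (\<lambda>x. - ((1 - C * x) powr (q + 1)))"
        using C q by (intro continuous_intros continuous_on_powr') (auto simp: field_simps)
      fix x assume x: "x \<in> {0<..<1 / C}"
      then have pos: "0 < 1 - C * x" using C by (simp add: field_simps)
      have "((\<lambda>x. - ((1 - C * x) powr (q + 1))) has_real_derivative - ((q + 1) * (1 - C * x) powr (q + 1 - 1) * (0 - C * 1))) (at x)"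
        using pos by (intro DERIV_minus derivative_eq_intros DERIV_powr) auto
      also have "- ((q + 1) * (1 - C * x) powr (q + 1 - 1) * (0 - C * 1)) = (C * (q + 1)) * (1 - C * x) powr q"
        by simp
      also have "\<dots> = ?f x" using pos by (simp add: Cq)
      finally show "((\<lambda>x. - ((1 - C * x) powr (q + 1))) has_vector_derivative ?f x) (at x)"
        by (simp add: has_real_derivative_iff_has_vector_derivative)
    qed
    then have "(?f has_integral 1) {0..1 / C}" using C by simp
    then have "((\<lambda>x. if x \<in> {0..1 / C} then ?f x else 0) has_integral 1) UNIV"
      unfolding has_integral_restrict_UNIV .
    moreover have "(\<lambda>x. if x \<in> {0..1 / C} then ?f x else 0) = (\<lambda>x. ?f x * indicator {0..1 / C} x)"
      by (auto simp: indicator_def)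
    ultimately show "((\<lambda>x. ?f x * indicator {0..1 / C} x) has_integral 1) UNIV" by simp
  qed simp
  finally show ?thesis by simp
qed

section \<open>The three regimes\<close>

context external_model
begin

definition scale :: "real \<Rightarrow> real" where
  "scale r = prefactor k \<beta> G c \<rho>U \<gamma>U * r powr min 1 \<alpha>"

text \<open>Continuity as a condition serves all regimes at once: on the half-line,
  \<open>limit_tail\<close> jumps only at 1 in the case \<open>\<alpha> > 1\<close>.\<close>

definition conv :: "(real \<Rightarrow> real) \<Rightarrow> bool" where
  "conv p \<longleftrightarrow> (\<lambda>r. enn2real (expected_hitting_time (M r) (X r) V)) \<sim>[at_top] scale \<and>
    (\<forall>x. 0 \<le> x \<and> (x = 0 \<or> isCont p x) \<longrightarrow>
      ((\<lambda>r. measure (M r) {\<omega> \<in> space (M r).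
          hitting_time (X r) V \<omega> / expected_hitting_time (M r) (X r) V > ennreal x}) \<longlongrightarrow> p x) at_top)"

text \<open>Each regime supplies a simpler form \<open>s\<close> of the scale and its two bounds.
  The tail bound is asked only for \<open>x > 0\<close>, since the start differs from the target and
  the tail at time 0 is 1.\<close>

lemma convI:
  assumes s: "\<And>r. 0 < r \<Longrightarrow> scale r = s r" "\<And>r. 0 < r \<Longrightarrow> 0 < s r"
    and p: "p \<in> borel_measurable borel" "\<And>x y. 0 \<le> x \<Longrightarrow> x \<le> y \<Longrightarrow> p y \<le> p x"
      "\<And>x. 0 \<le> x \<Longrightarrow> 0 \<le> p x" "p 0 = 1"
      "(\<integral>\<^sup>+x. ennreal (p x) * indicator {0..} x \<partial>lborel) = 1"
    and lower: "\<And>x e. 0 < x \<Longrightarrow> 0 < e \<Longrightarrow> eventually (\<lambda>r. p x - e < tail r (x * s r)) at_top"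
    and upper: "\<And>e. 0 < e \<Longrightarrow> eventually (\<lambda>r. expected_hitting_time (M r) (X r) V \<le> ennreal ((1 + e) * s r)) at_top"
  shows "conv p"
proof -
  have prob: "prob_space (M r)" and Z: "hitting_time (X r) V \<in> borel_measurable (M r)" if r: "0 < r" for r
  proof -
    interpret complete_bipartite U V "lam r" "mu r" "M r" "N r" "X r"
      by (rule bipartite[OF r])
    show "prob_space (M r)" by (rule prob_space_axioms)
    show "hitting_time (X r) V \<in> borel_measurable (M r)" by (rule hitting_time_measurable)
  qed
  have lower': "eventually (\<lambda>r. p x - e < measure (M r) {\<omega> \<in> space (M r). ennreal (x * s r) < hitting_time (X r) V \<omega>}) at_top"
    if "0 \<le> x" "0 < e" for x e
  proof (cases "x = 0")
    case True
    then show ?thesis using eventually_tail_0[OF that(2), of 1 s] p(4) by (simp add: tail_def)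
  next
    case False
    then show ?thesis using lower[of x e] that by (simp add: tail_def)
  qed
  note lim = tail_limit_at_top[of M "\<lambda>r. hitting_time (X r) V" s p, OF prob Z s(2) p lower' upper[unfolded expected_hitting_time_def]]
  have "((\<lambda>r. enn2real (expected_hitting_time (M r) (X r) V) / scale r) \<longlongrightarrow> 1) at_top"
    unfolding expected_hitting_time_def
  proof (rule Lim_transform_eventually[OF lim(1)])
    show "eventually (\<lambda>r. enn2real (\<integral>\<^sup>+\<omega>. hitting_time (X r) V \<omega> \<partial>M r) / s r =
        enn2real (\<integral>\<^sup>+\<omega>. hitting_time (X r) V \<omega> \<partial>M r) / scale r) at_top"
      using eventually_gt_at_top[of 0] by eventually_elim (simp add: s(1))
  qed
  then show ?thesis
    unfolding conv_def expected_hitting_time_def by (intro conjI asymp_equivI' allI impI lim(2)) auto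
qed

lemma \<beta>_iff:
  "\<beta> < 1 / (real k - 1) \<longleftrightarrow> \<alpha> < 1" "\<beta> = 1 / (real k - 1) \<longleftrightarrow> \<alpha> = 1" "1 / (real k - 1) < \<beta> \<longleftrightarrow> 1 < \<alpha>"
  using card_U by (auto simp: \<alpha>_def field_simps)

lemma subcritical:
  assumes \<alpha>: "\<alpha> < 1" shows "conv (limit_tail k \<beta> G c \<rho>U \<gamma>U)"
proof -
  have tail_eq: "limit_tail k \<beta> G c \<rho>U \<gamma>U = (\<lambda>x. exp (- x))"
    using \<alpha> \<beta>_iff by (auto simp: limit_tail_def fun_eq_iff)
  show ?thesis
    unfolding tail_eq
  proof (rule convI[where s = "\<lambda>r. (\<gamma>U * r) powr \<alpha> / \<kappa>"])
    fix r :: real assume r: "0 < r"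
    show "scale r = (\<gamma>U * r) powr \<alpha> / \<kappa>"
      using \<alpha> \<beta>_iff \<gamma>U_pos r
      by (simp add: scale_def prefactor_def \<alpha>_def[symmetric] \<kappa>_def powr_mult min_def)
    show "0 < (\<gamma>U * r) powr \<alpha> / \<kappa>" using r \<gamma>U_pos \<kappa>_pos by (intro divide_pos_pos) auto
  next
    fix e :: real assume e: "0 < e"
    show "eventually (\<lambda>r. expected_hitting_time (M r) (X r) V \<le> ennreal ((1 + e) * ((\<gamma>U * r) powr \<alpha> / \<kappa>))) at_top"
      using mean_upper[of 1, OF _ e] by simp
  qed (use \<alpha> integral_exp_tail tail_lower_subcritical in auto)
qed

lemma supercritical:
  assumes \<alpha>: "1 < \<alpha>" shows "conv (limit_tail k \<beta> G c \<rho>U \<gamma>U)"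
proof -
  have tail_eq: "limit_tail k \<beta> G c \<rho>U \<gamma>U = (\<lambda>x. if x < 1 then 1 else 0)"
    using \<alpha> \<beta>_iff by (auto simp: limit_tail_def fun_eq_iff)
  show ?thesis
    unfolding tail_eq
  proof (rule convI[where s = "\<lambda>r. \<gamma>U * r / d"])
    fix r :: real assume r: "0 < r"
    show "scale r = \<gamma>U * r / d"
      using \<alpha> \<beta>_iff r by (simp add: scale_def prefactor_def d_def min_def)
    show "0 < \<gamma>U * r / d" using r \<gamma>U_pos d_pos by simp
  next
    fix x e :: real assume "0 < x" "0 < e"
    then show "eventually (\<lambda>r. (if x < 1 then 1 else 0) - e < tail r (x * (\<gamma>U * r / d))) at_top"
      using tail_lower_supercritical[OF \<alpha>, of x e] tail_nonneg
      by (auto intro!: always_eventually simp: less_le_trans[of "- e" 0])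
  qed (use integral_unit_step_tail mean_upper_trivial in auto)
qed

text \<open>In terms of \<kappa> and \<open>d\<close> one has \<open>C = d / (\<kappa> + d)\<close>.
  Hence \<open>(1 - C) / C = \<kappa> / d\<close> is the exponent of the tail bound, and
  \<open>C * (\<kappa> / d + 1) = 1\<close> is the normalization of the limit law.\<close>

lemma critical:
  assumes \<alpha>: "\<alpha> = 1"
  defines "C \<equiv> prefactor k \<beta> G c \<rho>U \<gamma>U * (c - \<rho>U) / \<gamma>U"
  shows "C \<in> {0<..<1}" "conv (limit_tail k \<beta> G c \<rho>U \<gamma>U)"
    "0 \<le> x \<Longrightarrow> isCont (limit_tail k \<beta> G c \<rho>U \<gamma>U) x"
proof -
  have pre: "prefactor k \<beta> G c \<rho>U \<gamma>U = \<gamma>U / (\<kappa> + d)"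
    using \<alpha> \<beta>_iff by (simp add: prefactor_def \<kappa>_def d_def)
  have C: "C = d / (\<kappa> + d)"
    using \<gamma>U_pos by (simp add: C_def pre d_def)
  then show C_in: "C \<in> {0<..<1}" using d_pos \<kappa>_pos by simp
  define q where "q = \<kappa> / d"
  have "\<kappa> + d \<noteq> 0" using d_pos \<kappa>_pos by simp
  then have "1 - C = \<kappa> / (\<kappa> + d)" by (simp add: C field_simps)
  then have q: "0 < q" "(1 - C) / C = q"
    using d_pos \<kappa>_pos by (simp_all add: q_def C)
  have "q + 1 = (\<kappa> + d) / d" using d_pos by (simp add: q_def field_simps)
  then have Cq: "C * (q + 1) = 1" using d_pos \<open>\<kappa> + d \<noteq> 0\<close> by (simp add: C)
  have C0: "0 < C" using C_in by simp
  let ?p = "\<lambda>x. max 0 (1 - C * x) powr q"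
  have tail_eq: "limit_tail k \<beta> G c \<rho>U \<gamma>U = ?p"
  proof
    fix x
    have "x < 1 / C \<longleftrightarrow> 0 < 1 - C * x" using C0 by (simp add: field_simps)
    moreover have "(\<beta> < 1 / (real k - 1)) = False" "(\<beta> = 1 / (real k - 1)) = True"
      using \<alpha> \<beta>_iff by auto
    then have "limit_tail k \<beta> G c \<rho>U \<gamma>U x = (if x < 1 / C then (1 - C * x) powr ((1 - C) / C) else 0)"
      unfolding limit_tail_def Let_def C_def by (simp only: if_True if_False)
    ultimately show "limit_tail k \<beta> G c \<rho>U \<gamma>U x = ?p x"
      unfolding q(2) by (simp add: max_def)
  qed
  show "isCont (limit_tail k \<beta> G c \<rho>U \<gamma>U) x"
    unfolding tail_eq isCont_def using q(1)
    by (intro tendsto_powr' tendsto_intros) (auto intro!: always_eventually)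
  show "conv (limit_tail k \<beta> G c \<rho>U \<gamma>U)"
    unfolding tail_eq
  proof (rule convI[where s = "\<lambda>r. \<gamma>U * r / (\<kappa> + d)"])
    fix r :: real assume r: "0 < r"
    show "scale r = \<gamma>U * r / (\<kappa> + d)" using r \<alpha> by (simp add: scale_def pre)
    show "0 < \<gamma>U * r / (\<kappa> + d)" using r \<gamma>U_pos d_pos \<kappa>_pos by simp
  next
    fix x y :: real assume "0 \<le> x" "x \<le> y"
    then have "C * x \<le> C * y" using C0 by simp
    then show "?p y \<le> ?p x" using q(1) by (intro powr_mono2) auto
  next
    fix x e :: real assume x: "0 < x" and e: "0 < e"
    show "eventually (\<lambda>r. ?p x - e < tail r (x * (\<gamma>U * r / (\<kappa> + d)))) at_top"
    proof (cases "0 < 1 - C * x")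
      case True
      \<comment> \<open>The fraction that remains at this time is \<open>1 - C * x\<close>, because
        \<open>C / d = 1 / (\<kappa> + d)\<close>.\<close>
      have "(1 - (1 - C * x)) * (\<gamma>U * r / d) = x * (\<gamma>U * r / (\<kappa> + d))" for r
        using d_pos \<kappa>_pos by (simp add: C)
      then show ?thesis
        using tail_lower_critical[OF \<alpha> True _ e] x C0 True unfolding q_def[symmetric] by simp
    next
      case False
      then have "?p x = 0" by (simp add: max_def)
      then show ?thesis using e tail_nonneg by (auto intro!: always_eventually simp: less_le_trans[of "- e" 0])
    qed
  next
    fix e :: real assume e: "0 < e"
    have "\<kappa> / (\<kappa> + d) * ((\<gamma>U * r) powr \<alpha> / \<kappa>) = \<gamma>U * r / (\<kappa> + d)" if "0 < r" for r
      using that \<gamma>U_pos \<kappa>_pos \<alpha> by simp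
    then show "eventually (\<lambda>r. expected_hitting_time (M r) (X r) V \<le> ennreal ((1 + e) * (\<gamma>U * r / (\<kappa> + d)))) at_top"
      using eventually_conj[OF mean_upper[of "\<kappa> / (\<kappa> + d)", OF _ e] eventually_gt_at_top[of 0]] \<alpha>
      by (auto elim!: eventually_mono)
  qed (use integral_power_tail[OF C0 q(1) Cq] in auto)
qed

lemma conv_limit_tail: "conv (limit_tail k \<beta> G c \<rho>U \<gamma>U)"
  using subcritical critical(2) supercritical by (cases \<alpha> "1 :: real" rule: linorder_cases)

text \<open>For \<open>\<alpha> = 1\<close> the limit is continuous also at \<open>1 / C\<close>,
  because its exponent is positive; for \<open>\<alpha> > 1\<close> it is locally constant away from
  1.\<close>

lemma isCont_limit_tail:
  assumes x: "0 \<le> x" "\<not> (\<beta> > 1 / (real k - 1) \<and> x = 1)"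
  shows "isCont (limit_tail k \<beta> G c \<rho>U \<gamma>U) x" (is "isCont ?p x")
proof (cases \<alpha> "1 :: real" rule: linorder_cases)
  case less
  then have "?p = (\<lambda>x. exp (- x))"
    using \<beta>_iff by (auto simp: limit_tail_def fun_eq_iff)
  then show ?thesis by simp
next
  case equal
  then show ?thesis using critical(3) x by simp
next
  case greater
  then have p: "?p = (\<lambda>x. if x < 1 then 1 else 0)"
    using \<beta>_iff by (auto simp: limit_tail_def fun_eq_iff)
  have "x \<noteq> 1" using x greater \<beta>_iff by simp
  then consider "x < 1" | "1 < x" by linarith
  then show ?thesis
  proof cases
    case 1
    then have "eventually (\<lambda>y. ?p y = 1) (nhds x)"
      using eventually_nhds_in_open[of "{..<1}" x] by (auto elim!: eventually_mono simp: p)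
    then show ?thesis using isCont_cong[of ?p "\<lambda>_. 1" x] by simp
  next
    case 2
    then have "eventually (\<lambda>y. ?p y = 0) (nhds x)"
      using eventually_nhds_in_open[of "{1<..}" x] by (auto elim!: eventually_mono simp: p)
    then show ?thesis using isCont_cong[of ?p "\<lambda>_. 0" x] by simp
  qed
qed

end

theorem theorem1p7:
  fixes U V :: "'a set"
    and c \<rho>U \<rho>V \<gamma>U \<gamma>V \<beta> G :: real
    and gU gV :: "real \<Rightarrow> real"
    and M :: "real \<Rightarrow> 'w measure"
    and N :: "real \<Rightarrow> 'a clock \<Rightarrow> real \<Rightarrow> 'w \<Rightarrow> nat"
    and X :: "real \<Rightarrow> real \<Rightarrow> 'w \<Rightarrow> 'a set"
  assumes "finite U" "finite V" "U \<noteq> {}" "V \<noteq> {}" "U \<inter> V = {}" "card U \<ge> 2"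
    and "c > \<rho>U" "\<rho>U > 0" "c > \<rho>V" "\<rho>V > 0" "\<gamma>U \<ge> \<gamma>V" "\<gamma>V > 0"
    and "gU \<in> activation_functions" "gV \<in> activation_functions"
    and "filterlim (\<lambda>x. gV x / gU x) at_top at_top"
    and "\<beta> > 0" "G > 0"
    and "\<And>x. gU x = (if x > 0 then G * x powr \<beta> else 0)"
    and "\<And>r. r > 0 \<Longrightarrow>
           hard_core_process U V (external_rate U gU gV c \<rho>U \<rho>V \<gamma>U \<gamma>V r) U (M r) (N r) (X r)"
  shows "(\<lambda>r. enn2real (expected_hitting_time (M r) (X r) V)) \<sim>[at_top]
           (\<lambda>r. prefactor (card U) \<beta> G c \<rho>U \<gamma>U * r powr min 1 (\<beta> * (real (card U) - 1)))
         \<and> (\<forall>x. 0 \<le> x \<and> \<not> (\<beta> > 1 / (real (card U) - 1) \<and> x = 1) \<longrightarrow>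
              ((\<lambda>r. measure (M r) {\<omega> \<in> space (M r).
                       hitting_time (X r) V \<omega> / expected_hitting_time (M r) (X r) V > ennreal x})
                 \<longlongrightarrow> limit_tail (card U) \<beta> G c \<rho>U \<gamma>U x) at_top)
         \<and> (\<beta> = 1 / (real (card U) - 1) \<longrightarrow>
              prefactor (card U) \<beta> G c \<rho>U \<gamma>U * (c - \<rho>U) / \<gamma>U \<in> {0<..<1})"
proof -
  interpret external_model U V c \<rho>U \<rho>V \<gamma>U \<gamma>V \<beta> G gU gV M N X
    by (rule external_model.intro) (fact assms)+
  show ?thesis
    using conv_limit_tail isCont_limit_tail critical(1) \<beta>_iff(2)
    unfolding conv_def scale_def[abs_def] \<alpha>_def by auto
qed


end
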